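(* A strict monoidal functor $F:\mathsf{MD}\to\mathsf{Mat}$ with $F(1)=2$ is given by the pair of complex $4\times4$ matrices $(R,S)=(F(r),F(s))$. The complete set of strict monoidal functors $F:\mathsf{MD}\to\mathsf{Mat}$ with $F(1)=2$ is given, up to local equivalence, transpose, and overall sign, as follows. There are 7 cases, according to the choice of $R$. (1) If $R=I$ then the relations imply that $S_1=S_2$, thus $S=\pm I$. (2) ($a$-glue type) $R=\begin{bmatrix}1&0&0&p\\0&0&1&0\\0&1&0&0\\0&0&0&-1\end{bmatrix}$ with $p\neq 0$ (the case $p=0$ is covered by case (4)). For any $p\ne0$ the set of possible $S$ is given, up to rescaling by $\pm1$, by $S=\begin{bmatrix}1&0&0&q\\0&0&1&0\\0&1&0&0\\0&0&0&-1\end{bmatrix}$, where $q$ can take any value. (3) ($f$-glue type) $R=\begin{bmatrix}1&-p&p&pq\\0&0&1&q\\0&1&0&-q\\0&0&0&1\end{bmatrix}$ with $(p,q)\ne(0,0)$ (the omitted flip case is case (7)). In fact it is assumed that $q\neq0$: if $q=0$, so $p\ne 0$, the solutions are obtained from those given here by antidiagonal symmetry. If $p\neq -q$, then $S=R$ up to scaling by $\pm1$. If $p=-q$, then, up to scaling by $\pm1$, $$R=\begin{bmatrix}1&q&-q&-q^2\\0&0&1&q\\0&1&0&-q\\0&0&0&1\end{bmatrix},\qquad S=\begin{bmatrix}1&s&-s&-s^2\\0&0&1&s\\0&1&0&-s\\0&0&0&1\end{bmatrix},$$ where $q\ne0$ and $s$ can take any value. (4) ($a$-slash type) $R=\begin{bmatrix}1&0&0&0\\0&0&p&0\\0&1/p&0&0\\0&0&0&-1\end{bmatrix}$,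 $p\in\mathbb C^\times$ (setting $p=1$ covers the case omitted from (2)). If $p^2\neq1$ we get $S=\begin{bmatrix}1&0&0&0\\0&0&s&0\\0&1/s&0&0\\0&0&0&\pm1\end{bmatrix}$. If $p=\pm1$ we get $S=\begin{bmatrix}1&0&0&s\\0&0&\pm1&0\\0&\pm1&0&0\\0&0&0&-1\end{bmatrix}$ (the sign in $S$ being that of $p$). (5) ($f$-slash type) $R=\begin{bmatrix}1&0&0&0\\0&0&p&0\\0&1/p&0&0\\0&0&0&1\end{bmatrix}$ with $p\in\mathbb C^\times$, $p\neq1$ (for $p=1$ see case (7)), $p=-1$ being allowed. If $p\ne1$ we get $S=\begin{bmatrix}1&0&0&0\\0&0&s&0\\0&1/s&0&0\\0&0&0&\pm1\end{bmatrix}$. In the case $p=-1$ we also have $S=\begin{bmatrix}0&0&0&s\\0&\pm1&0&0\\0&0&\pm1&0\\1/s&0&0&0\end{bmatrix}$ (the same sign in both middle entries). (6) (anti-slash) $R=\begin{bmatrix}0&0&0&1\\0&1&0&0\\0&0&1&0\\1&0&0&0\end{bmatrix}$, with several choices for $S$: (a) $S=\begin{bmatrix} z & -x & x & -\varepsilon-z \\ x & -\varepsilon-z & z & -x \\ -x & z & -\varepsilon-z & x \\ -\varepsilon-z & x & -x & z \end{bmatrix}$ with $\varepsilon^2=1$, $x^2=z^2+\varepsilon z$. (b) $S=\begin{bmatrix} r & -y+\varepsilon & y & -r \\ y & -r & r & -y+\varepsilon \\ -y+\varepsilon & r & -r & y \\ -r & y & -y+\varepsilon & r \end{bmatrix}$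 with $\varepsilon^2=1$, $2r^2-2y^2+2\varepsilon y-1=0$. (c) $S=\begin{bmatrix} -r & y & y & -r-\varepsilon \\ -y & r+\varepsilon & r & -y \\ -y & r & r+\varepsilon & -y \\ -r-\varepsilon & y & y & -r \end{bmatrix}$ with $\varepsilon^2=1$, $r^2-y^2+\varepsilon r=0$. (7) (flip) If $R=\begin{bmatrix}1&0&0&0\\0&0&1&0\\0&1&0&0\\0&0&0&1\end{bmatrix}$ then $S$ is among: the flip (i.e. $S=R$); the anti-slash matrix $\begin{bmatrix}0&0&0&1\\0&1&0&0\\0&0&1&0\\1&0&0&0\end{bmatrix}$; the $a$-slash type $\begin{bmatrix}1&0&0&0\\0&0&q&0\\0&1/q&0&0\\0&0&0&-1\end{bmatrix}$; or the $f$-glue type with $p=-q$, i.e. $\begin{bmatrix}1&q&-q&-q^2\\0&0&1&q\\0&1&0&-q\\0&0&0&1\end{bmatrix}$. Here all parameters are complex, and any parameter whose reciprocal appears as a matrix entry is nonzero.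
   Context: For $n\in\mathbb N$ the mixed doubles group $\mathsf{MD}_n$ is the group with generators $s_1,\dots,s_{n-1},r_1,\dots,r_{n-1}$ and relations $r_ir_{i+1}r_i=r_{i+1}r_ir_{i+1}$, $r_ir_{i+1}s_i=s_{i+1}r_ir_{i+1}$, $r_is_{i+1}s_i=s_{i+1}s_ir_{i+1}$, $s_is_{i+1}s_i=s_{i+1}s_is_{i+1}$, $s_i^2=1$, $r_i^2=1$, and $r_ir_j=r_jr_i$, $s_is_j=s_js_i$, $r_is_j=s_jr_i$ for $|i-j|>1$. $\mathsf{MD}$ is the strict monoidal category with object monoid $(\mathbb N_0,+)$, $\mathsf{MD}(n,n)=\mathsf{MD}_n$ and no morphisms $n\to m$ for $n\neq m$; the monoidal product of $a\in\mathsf{MD}_m$ and $b\in\mathsf{MD}_n$ is $\phi_0(a)\phi_m(b)\in\mathsf{MD}_{m+n}$, where $\phi_i$ sends $r_j\mapsto r_{j+i}$, $s_j\mapsto s_{j+i}$. Write $r,s\in\mathsf{MD}(2,2)$ for the generators $r_1,s_1$ of $\mathsf{MD}_2$. $\mathsf{Mat}$ is the strict monoidal category of complex matrices (objects are natural numbers with monoidal product multiplication, composition is matrix multiplication, monoidal product of matrices is the Kronecker product). A strict monoidal functor $F:\mathsf{MD}\to\mathsf{Mat}$ with $F(1)=N$ is determined by $R=F(r)$, $S=F(s)$, which are $N^2\times N^2$ matrices with $R^2=S^2=I$ satisfying, with $R_1=R\otimes I_N$, $R_2=I_N\otimes R$, $S_1=S\otimes I_N$, $S_2=I_N\otimes S$: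 $R_1R_2R_1=R_2R_1R_2$, $S_1S_2S_1=S_2S_1S_2$, $R_1S_2S_1=S_2S_1R_2$, $S_1R_2R_1=R_2R_1S_2$; conversely every such pair defines such a functor. Local equivalence: $(R,S)\sim(R',S')$ if there is an invertible $N\times N$ matrix $A$ with $R'=(A\otimes A)R(A\otimes A)^{-1}$ and $S'=(A\otimes A)S(A\otimes A)^{-1}$. Transpose: $(R,S)\mapsto(R^{T},S^{T})$. Overall sign: replacing $R$ by $-R$ and/or $S$ by $-S$. Antidiagonal symmetry: transposing both $R$ and $S$ and then conjugating both by the $4\times4$ antidiagonal permutation matrix.
   Formalization: Two incomplete lists are corrected: in (7), for R the flip, every f-slash S (middle entries q, 1/q, last entry 1) is added; in (4), for p=±1, slash-type S (entries s, 1/s, last entry ±1) also occur besides the glued S, and there S is listed up to sign and transpose. *)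

theory Defs
  imports Complex_Main "HOL-Algebra.Group" "Jordan_Normal_Form.Matrix"
begin

section \<open>Groups given by generators and relations\<close>

text \<open>A letter \<open>(x, True)\<close> stands for the generator \<open>x\<close>, and \<open>(x, False)\<close> for its inverse.\<close>

type_synonym 'g word = "('g \<times> bool) list"

definition words :: "'g set \<Rightarrow> 'g word set" where
  "words X = lists (X \<times> UNIV)"

inductive pres_eq :: "'g set \<Rightarrow> ('g word \<times> 'g word) set \<Rightarrow> 'g word \<Rightarrow> 'g word \<Rightarrow> bool"
  for X :: "'g set" and Q :: "('g word \<times> 'g word) set" where
  pres_refl: "u \<in> words X \<Longrightarrow> pres_eq X Q u u"
| pres_sym: "pres_eq X Q u v \<Longrightarrow> pres_eq X Q v u"
| pres_trans: "pres_eq X Q u v \<Longrightarrow> pres_eq X Q v w \<Longrightarrow> pres_eq X Q u w"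
| pres_append: "pres_eq X Q u u' \<Longrightarrow> pres_eq X Q v v' \<Longrightarrow> pres_eq X Q (u @ v) (u' @ v')"
| pres_cancel: "x \<in> X \<Longrightarrow> pres_eq X Q [(x, b), (x, \<not> b)] []"
| pres_rel: "(u, v) \<in> Q \<Longrightarrow> u \<in> words X \<Longrightarrow> v \<in> words X \<Longrightarrow> pres_eq X Q u v"

definition pres_rel_set :: "'g set \<Rightarrow> ('g word \<times> 'g word) set \<Rightarrow> ('g word \<times> 'g word) set" where
  "pres_rel_set X Q = {(u, v). pres_eq X Q u v}"

definition presented_group ::
  "'g set \<Rightarrow> ('g word \<times> 'g word) set \<Rightarrow> 'g word set monoid" where
  "presented_group X Q =
     \<lparr>carrier = words X // pres_rel_set X Q,
      mult = (\<lambda>A B. \<Union>u\<in>A. \<Union>v\<in>B. pres_rel_set X Q `` {u @ v}),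
      one = pres_rel_set X Q `` {[]}\<rparr>"

lemma words_append: "u \<in> words X \<Longrightarrow> v \<in> words X \<Longrightarrow> u @ v \<in> words X"
  by (auto simp: words_def)

lemma equiv_pres: "equiv (words X) (pres_rel_set X Q)"
proof -
  have "u \<in> words X \<and> v \<in> words X" if "pres_eq X Q u v" for u v
    using that
  proof induction
    case (pres_cancel x b)
    then show ?case by (auto simp: words_def)
  qed (auto simp: words_append)
  then show ?thesis
    by (intro equivI refl_onI symI transI)
       (auto simp: pres_rel_set_def intro: pres_eq.intros)
qed

lemma mult_presented_group:
  assumes "u \<in> words X" "v \<in> words X"
  shows "mult (presented_group X Q) (pres_rel_set X Q `` {u}) (pres_rel_set X Q `` {v})
           = pres_rel_set X Q `` {u @ v}"
proof -
  have "congruent2 (pres_rel_set X Q) (pres_rel_set X Q) (\<lambda>u v. pres_rel_set X Q `` {u @ v})"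
    by (intro congruent2I' equiv_class_eq[OF equiv_pres])
       (auto simp: pres_rel_set_def intro: pres_append)
  from UN_equiv_class2[OF equiv_pres equiv_pres this assms] show ?thesis
    by (simp add: presented_group_def)
qed

lemma group_presented_group: "group (presented_group X Q)"
proof (rule groupI)
  let ?G = "presented_group X Q" and ?c = "\<lambda>u. pres_rel_set X Q `` {u}"
  have car: "carrier ?G = ?c ` words X"
    by (auto simp: presented_group_def quotient_def)
  have one: "one ?G = ?c []" by (simp add: presented_group_def)
  have nil: "[] \<in> words X" by (simp add: words_def)
  show "one ?G \<in> carrier ?G" using car one nil by auto
  show "mult ?G A B \<in> carrier ?G" if "A \<in> carrier ?G" "B \<in> carrier ?G" for A B
    using that by (auto simp: car mult_presented_group words_append)
  show "mult ?G (mult ?G A B) C = mult ?G A (mult ?G B C)"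
    if "A \<in> carrier ?G" "B \<in> carrier ?G" "C \<in> carrier ?G" for A B C
    using that by (auto simp: car mult_presented_group words_append)
  show "mult ?G (one ?G) A = A" if "A \<in> carrier ?G" for A
    using that nil by (auto simp: car one mult_presented_group)
  show "\<exists>B\<in>carrier ?G. mult ?G B A = one ?G" if "A \<in> carrier ?G" for A
  proof -
    from that obtain w where w: "w \<in> words X" "A = ?c w" by (auto simp: car)
    have "\<exists>u\<in>words X. pres_eq X Q (u @ w) []" using w(1)
    proof (induction w)
      case Nil
      then show ?case using nil by (auto intro: pres_eq.intros)
    next
      case (Cons a w)
      obtain x b where a: "a = (x, b)" by force
      from Cons.prems have x: "x \<in> X" and w: "w \<in> words X" by (auto simp: words_def a)
      from Cons.IH[OF w] obtain u where u: "u \<in> words X" "pres_eq X Q (u @ w) []" by auto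
      have "pres_eq X Q [(x, \<not> b), (x, b)] []" using pres_cancel[OF x, of Q "\<not> b"] by simp
      then have "pres_eq X Q ([(x, \<not> b), (x, b)] @ w) ([] @ w)"
        using w by (intro pres_append pres_refl)
      then have "pres_eq X Q (u @ [(x, \<not> b), (x, b)] @ w) (u @ [] @ w)"
        using u(1) by (intro pres_append[of _ _ u] pres_refl)
      with u(2) have "pres_eq X Q ((u @ [(x, \<not> b)]) @ a # w) []"
        using pres_trans a by fastforce
      moreover have "u @ [(x, \<not> b)] \<in> words X" using u(1) x by (auto simp: words_def)
      ultimately show ?case by blast
    qed
    then obtain u where u: "u \<in> words X" "pres_eq X Q (u @ w) []" by auto
    have "?c (u @ w) = ?c []"
      using u(2) by (intro equiv_class_eq[OF equiv_pres]) (simp add: pres_rel_set_def)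
    with u(1) w show ?thesis by (auto simp: car one mult_presented_group)
  qed
qed

section \<open>Strict monoidal categories and functors\<close>

text \<open>Only the data are recorded. Arrows need not have a unique domain and codomain, so the
  operations on arrows take the objects as arguments: \<open>Comp C X Y Z g f\<close> is
  \<open>g \<circ> f\<close> for \<open>f : X \<rightarrow> Y\<close> and \<open>g : Y \<rightarrow> Z\<close>, and \<open>Tens C X Y X' Y' f g\<close> is
  \<open>f \<otimes> g\<close> for \<open>f : X \<rightarrow> Y\<close> and \<open>g : X' \<rightarrow> Y'\<close>.\<close>

record ('o, 'm) smcat =
  Obj :: "'o set"
  Hom :: "'o \<Rightarrow> 'o \<Rightarrow> 'm set"
  Ident :: "'o \<Rightarrow> 'm"
  Comp :: "'o \<Rightarrow> 'o \<Rightarrow> 'o \<Rightarrow> 'm \<Rightarrow> 'm \<Rightarrow> 'm"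
  Unit :: 'o
  OTens :: "'o \<Rightarrow> 'o \<Rightarrow> 'o"
  Tens :: "'o \<Rightarrow> 'o \<Rightarrow> 'o \<Rightarrow> 'o \<Rightarrow> 'm \<Rightarrow> 'm \<Rightarrow> 'm"

definition strict_monoidal_functor ::
  "('o, 'm) smcat \<Rightarrow> ('p, 'n) smcat \<Rightarrow> ('o \<Rightarrow> 'p) \<Rightarrow> ('o \<Rightarrow> 'o \<Rightarrow> 'm \<Rightarrow> 'n) \<Rightarrow> bool" where
  "strict_monoidal_functor C D Fo Fm \<longleftrightarrow>
     (\<forall>X\<in>Obj C. Fo X \<in> Obj D) \<and>
     (\<forall>X\<in>Obj C. \<forall>Y\<in>Obj C. \<forall>f\<in>Hom C X Y. Fm X Y f \<in> Hom D (Fo X) (Fo Y)) \<and>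
     (\<forall>X\<in>Obj C. Fm X X (Ident C X) = Ident D (Fo X)) \<and>
     (\<forall>X\<in>Obj C. \<forall>Y\<in>Obj C. \<forall>Z\<in>Obj C. \<forall>f\<in>Hom C X Y. \<forall>g\<in>Hom C Y Z.
        Fm X Z (Comp C X Y Z g f) = Comp D (Fo X) (Fo Y) (Fo Z) (Fm Y Z g) (Fm X Y f)) \<and>
     Fo (Unit C) = Unit D \<and>
     (\<forall>X\<in>Obj C. \<forall>Y\<in>Obj C. Fo (OTens C X Y) = OTens D (Fo X) (Fo Y)) \<and>
     (\<forall>X\<in>Obj C. \<forall>Y\<in>Obj C. \<forall>X'\<in>Obj C. \<forall>Y'\<in>Obj C. \<forall>f\<in>Hom C X Y. \<forall>g\<in>Hom C X' Y'.
        Fm (OTens C X X') (OTens C Y Y') (Tens C X Y X' Y' f g)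
          = Tens D (Fo X) (Fo Y) (Fo X') (Fo Y') (Fm X Y f) (Fm X' Y' g))"

section \<open>The mixed doubles groups and the category MD\<close>

datatype mdgen = Sgen nat | Rgen nat

definition md_gens :: "nat \<Rightarrow> mdgen set" where
  "md_gens n = {Sgen i | i. 1 \<le> i \<and> i < n} \<union> {Rgen i | i. 1 \<le> i \<and> i < n}"

abbreviation s_letter :: "nat \<Rightarrow> mdgen \<times> bool" where "s_letter i \<equiv> (Sgen i, True)"
abbreviation r_letter :: "nat \<Rightarrow> mdgen \<times> bool" where "r_letter i \<equiv> (Rgen i, True)"

text \<open>The relations for all indices; the presentation below only uses those whose two
  sides are words in the generators of \<open>md_gens n\<close>.\<close>

definition md_rels :: "(mdgen word \<times> mdgen word) set" where
  "md_rels =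
     {([r_letter i, r_letter (i+1), r_letter i], [r_letter (i+1), r_letter i, r_letter (i+1)]) | i. True} \<union>
     {([r_letter i, r_letter (i+1), s_letter i], [s_letter (i+1), r_letter i, r_letter (i+1)]) | i. True} \<union>
     {([r_letter i, s_letter (i+1), s_letter i], [s_letter (i+1), s_letter i, r_letter (i+1)]) | i. True} \<union>
     {([s_letter i, s_letter (i+1), s_letter i], [s_letter (i+1), s_letter i, s_letter (i+1)]) | i. True} \<union>
     {([s_letter i, s_letter i], []) | i. True} \<union>
     {([r_letter i, r_letter i], []) | i. True} \<union>
     {([r_letter i, r_letter j], [r_letter j, r_letter i]) | i j. i + 1 < j \<or> j + 1 < i} \<union>
     {([s_letter i, s_letter j], [s_letter j, s_letter i]) | i j. i + 1 < j \<or> j + 1 < i} \<union>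
     {([r_letter i, s_letter j], [s_letter j, r_letter i]) | i j. i + 1 < j \<or> j + 1 < i}"

definition MD_group :: "nat \<Rightarrow> mdgen word set monoid" where
  "MD_group n = presented_group (md_gens n) md_rels"

definition md_class :: "nat \<Rightarrow> mdgen word \<Rightarrow> mdgen word set" where
  "md_class n w = pres_rel_set (md_gens n) md_rels `` {w}"

fun shift_gen :: "nat \<Rightarrow> mdgen \<Rightarrow> mdgen" where
  "shift_gen i (Sgen j) = Sgen (j + i)"
| "shift_gen i (Rgen j) = Rgen (j + i)"

definition shift_word :: "nat \<Rightarrow> mdgen word \<Rightarrow> mdgen word" where
  "shift_word i w = map (map_prod (shift_gen i) id) w"

text \<open>\<open>md_tens m n a b\<close> is the product in the group on \<open>m + n\<close> strands of the images of
  \<open>a\<close> under the shift by 0 and of \<open>b\<close> under the shift by \<open>m\<close>, computed on representatives.\<close>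

definition md_tens :: "nat \<Rightarrow> nat \<Rightarrow> mdgen word set \<Rightarrow> mdgen word set \<Rightarrow> mdgen word set" where
  "md_tens m n a b = (\<Union>u\<in>a. \<Union>v\<in>b. md_class (m + n) (shift_word 0 u @ shift_word m v))"

definition MD :: "(nat, mdgen word set) smcat" where
  "MD = \<lparr>Obj = UNIV,
         Hom = (\<lambda>m n. if m = n then carrier (MD_group n) else {}),
         Ident = (\<lambda>n. one (MD_group n)),
         Comp = (\<lambda>k m n g f. mult (MD_group n) g f),
         Unit = 0,
         OTens = (+),
         Tens = (\<lambda>m m' n n' a b. md_tens m n a b)\<rparr>"

definition md_r :: "mdgen word set" where "md_r = md_class 2 [r_letter 1]"
definition md_s :: "mdgen word set" where "md_s = md_class 2 [s_letter 1]"

section \<open>The category Mat\<close>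

definition kron :: "complex mat \<Rightarrow> complex mat \<Rightarrow> complex mat" where
  "kron A B = mat (dim_row A * dim_row B) (dim_col A * dim_col B)
     (\<lambda>(i, j). A $$ (i div dim_row B, j div dim_col B) * B $$ (i mod dim_row B, j mod dim_col B))"

definition Mat :: "(nat, complex mat) smcat" where
  "Mat = \<lparr>Obj = UNIV,
          Hom = (\<lambda>m n. carrier_mat n m),
          Ident = (\<lambda>n. 1\<^sub>m n),
          Comp = (\<lambda>k m n g f. g * f),
          Unit = 1,
          OTens = (*),
          Tens = (\<lambda>m m' n n' f g. kron f g)\<rparr>"

definition MD_functor :: "(nat \<Rightarrow> nat) \<Rightarrow> (nat \<Rightarrow> nat \<Rightarrow> mdgen word set \<Rightarrow> complex mat) \<Rightarrow> bool" where
  "MD_functor Fo Fm \<longleftrightarrow> strict_monoidal_functor MD Mat Fo Fm"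

definition MD_pairs :: "nat \<Rightarrow> (complex mat \<times> complex mat) set" where
  "MD_pairs N = {(Fm 2 2 md_r, Fm 2 2 md_s) | Fo Fm. MD_functor Fo Fm \<and> Fo 1 = N}"

section \<open>Symmetries\<close>

definition local_equiv :: "nat \<Rightarrow> complex mat \<times> complex mat \<Rightarrow> complex mat \<times> complex mat \<Rightarrow> bool" where
  "local_equiv N = (\<lambda>(R, S) (R', S').
     R \<in> carrier_mat (N^2) (N^2) \<and> S \<in> carrier_mat (N^2) (N^2) \<and>
     (\<exists>A\<in>carrier_mat N N. \<exists>B\<in>carrier_mat (N^2) (N^2).
        invertible_mat A \<and> inverts_mat (kron A A) B \<and> inverts_mat B (kron A A) \<and>
        R' = kron A A * R * B \<and> S' = kron A A * S * B))"

definition transpose_step :: "complex mat \<times> complex mat \<Rightarrow> complex mat \<times> complex mat \<Rightarrow> bool" where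
  "transpose_step = (\<lambda>(R, S) (R', S'). R' = transpose_mat R \<and> S' = transpose_mat S)"

definition sign_step :: "complex mat \<times> complex mat \<Rightarrow> complex mat \<times> complex mat \<Rightarrow> bool" where
  "sign_step = (\<lambda>(R, S) (R', S'). (R' = R \<or> R' = - R) \<and> (S' = S \<or> S' = - S))"

definition pair_equiv :: "nat \<Rightarrow> complex mat \<times> complex mat \<Rightarrow> complex mat \<times> complex mat \<Rightarrow> bool" where
  "pair_equiv N = equivclp (\<lambda>x y. local_equiv N x y \<or> transpose_step x y \<or> sign_step x y)"

definition antidiag :: "complex mat" where
  "antidiag = mat_of_rows_list 4 [[0, 0, 0, 1], [0, 0, 1, 0], [0, 1, 0, 0], [1, 0, 0, 0]]"

text \<open>The matrix \<open>antidiag\<close> is its own inverse.\<close>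

definition antidiag_sym :: "complex mat \<Rightarrow> complex mat" where
  "antidiag_sym M = antidiag * transpose_mat M * antidiag"

definition up_to_sign :: "complex mat set \<Rightarrow> complex mat set" where
  "up_to_sign X = X \<union> uminus ` X"

section \<open>The matrices of the classification\<close>

definition a_glue :: "complex \<Rightarrow> complex mat" where
  "a_glue p = mat_of_rows_list 4
     [[1, 0, 0, p],
      [0, 0, 1, 0],
      [0, 1, 0, 0],
      [0, 0, 0, -1]]"

definition f_glue :: "complex \<Rightarrow> complex \<Rightarrow> complex mat" where
  "f_glue p q = mat_of_rows_list 4
     [[1, -p, p, p * q],
      [0, 0, 1, q],
      [0, 1, 0, -q],
      [0, 0, 0, 1]]"

text \<open>The \<open>a\<close>-slash matrices are those with last entry \<open>e = -1\<close>, the \<open>f\<close>-slash matrices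
  those with \<open>e = 1\<close>.\<close>

definition slash :: "complex \<Rightarrow> complex \<Rightarrow> complex mat" where
  "slash p e = mat_of_rows_list 4
     [[1, 0, 0, 0],
      [0, 0, p, 0],
      [0, 1/p, 0, 0],
      [0, 0, 0, e]]"

definition a_glue_sgn :: "complex \<Rightarrow> complex \<Rightarrow> complex mat" where
  "a_glue_sgn e s = mat_of_rows_list 4
     [[1, 0, 0, s],
      [0, 0, e, 0],
      [0, e, 0, 0],
      [0, 0, 0, -1]]"

definition anti_slash_gen :: "complex \<Rightarrow> complex \<Rightarrow> complex mat" where
  "anti_slash_gen s e = mat_of_rows_list 4
     [[0, 0, 0, s],
      [0, e, 0, 0],
      [0, 0, e, 0],
      [1/s, 0, 0, 0]]"

definition anti_slash :: "complex mat" where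
  "anti_slash = mat_of_rows_list 4
     [[0, 0, 0, 1],
      [0, 1, 0, 0],
      [0, 0, 1, 0],
      [1, 0, 0, 0]]"

definition flip :: "complex mat" where
  "flip = mat_of_rows_list 4
     [[1, 0, 0, 0],
      [0, 0, 1, 0],
      [0, 1, 0, 0],
      [0, 0, 0, 1]]"

definition anti_slash_S_a :: "complex \<Rightarrow> complex \<Rightarrow> complex \<Rightarrow> complex mat" where
  "anti_slash_S_a e x z = mat_of_rows_list 4
     [[z, -x, x, -e - z],
      [x, -e - z, z, -x],
      [-x, z, -e - z, x],
      [-e - z, x, -x, z]]"

definition anti_slash_S_b :: "complex \<Rightarrow> complex \<Rightarrow> complex \<Rightarrow> complex mat" where
  "anti_slash_S_b e r y = mat_of_rows_list 4
     [[r, -y + e, y, -r],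
      [y, -r, r, -y + e],
      [-y + e, r, -r, y],
      [-r, y, -y + e, r]]"

definition anti_slash_S_c :: "complex \<Rightarrow> complex \<Rightarrow> complex \<Rightarrow> complex mat" where
  "anti_slash_S_c e r y = mat_of_rows_list 4
     [[-r, y, y, -r - e],
      [-y, r + e, r, -y],
      [-y, r, r + e, -y],
      [-r - e, y, y, -r]]"

section \<open>The possible S for a given R\<close>

definition S_identity :: "complex mat set" where
  "S_identity = {1\<^sub>m 4, - 1\<^sub>m 4}"

definition S_a_glue :: "complex mat set" where
  "S_a_glue = {a_glue q | q. True}"

definition S_f_glue :: "complex \<Rightarrow> complex \<Rightarrow> complex mat set" where
  "S_f_glue p q = (if p \<noteq> - q then {f_glue p q} else {f_glue (- s) s | s. True})"

text \<open>A slash matrix maps the basis vector with labels \<open>(i, j)\<close> to a scalar multiple of the one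
  with labels \<open>(j, i)\<close>, so every crossing contributes a scalar depending only on the labels of the
  two strands that cross. Hence any two slash matrices satisfy the mixed relations: in
  \<open>S_a_slash p\<close> the slash matrices occur for every \<open>p\<close> (for \<open>p = 1\<close> and \<open>p = -1\<close> the glued ones
  occur in addition), and \<open>S_flip\<close> contains all \<open>f\<close>-slash matrices. These are not equivalent to
  other entries of the lists: for \<open>R = flip\<close> and \<open>S = slash q 1\<close> the spectrum of \<open>R * S\<close> is
  \<open>{1, 1, q, 1/q}\<close>.\<close>

definition S_a_slash :: "complex \<Rightarrow> complex mat set" where
  "S_a_slash p = {slash s e | s e. s \<noteq> 0 \<and> e \<in> {1, -1}} \<union>
                 (if p\<^sup>2 = 1 then {a_glue_sgn p s | s. True} else {})"

definition S_f_slash :: "complex \<Rightarrow> complex mat set" where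
  "S_f_slash p = {slash s e | s e. s \<noteq> 0 \<and> e \<in> {1, -1}} \<union>
                 (if p = -1 then {anti_slash_gen s e | s e. s \<noteq> 0 \<and> e \<in> {1, -1}} else {})"

definition S_anti_slash :: "complex mat set" where
  "S_anti_slash =
     {anti_slash_S_a e x z | e x z. e\<^sup>2 = 1 \<and> x\<^sup>2 = z\<^sup>2 + e * z} \<union>
     {anti_slash_S_b e r y | e r y. e\<^sup>2 = 1 \<and> 2 * r\<^sup>2 - 2 * y\<^sup>2 + 2 * e * y - 1 = 0} \<union>
     {anti_slash_S_c e r y | e r y. e\<^sup>2 = 1 \<and> r\<^sup>2 - y\<^sup>2 + e * r = 0}"

definition S_flip :: "complex mat set" where
  "S_flip = {flip, anti_slash} \<union>
            {slash q (-1) | q. q \<noteq> 0} \<union>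
            {f_glue (- q) q | q. True} \<union>
            {slash q 1 | q. q \<noteq> 0}"

definition MD_list :: "(complex mat \<times> complex mat) set" where
  "MD_list =
     {(1\<^sub>m 4, S) | S. S \<in> S_identity} \<union>
     {(a_glue p, S) | p S. p \<noteq> 0 \<and> S \<in> S_a_glue} \<union>
     {(f_glue p q, S) | p q S. q \<noteq> 0 \<and> S \<in> S_f_glue p q} \<union>
     {(slash p (-1), S) | p S. p \<noteq> 0 \<and> S \<in> S_a_slash p} \<union>
     {(slash p 1, S) | p S. p \<noteq> 0 \<and> p \<noteq> 1 \<and> S \<in> S_f_slash p} \<union>
     {(anti_slash, S) | S. S \<in> S_anti_slash} \<union>
     {(flip, S) | S. S \<in> S_flip}"

end

theory Submission
  imports Defs
begin

text \<open>A functor amounts to a pair of involutions satisfying four braid relations. To normalise \<open>R\<close>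
  alone: up to sign, \<open>R\<close> fixes a plane in the tensor square of the complex plane, and every such
  plane contains a pure tensor \<open>a \<otimes> b\<close>, because a binary quadratic form has a zero. A change of basis
  makes the fixed tensor \<open>e\<^sub>0 \<otimes> e\<^sub>0\<close> or \<open>e\<^sub>0 \<otimes> e\<^sub>1\<close>; what \<open>R\<close>
    induces on the
  quotient by it is an involution of a three-dimensional space, hence up to sign the identity or a reflection, and
  the braid relation leaves only the glue and slash types. For each of these \<open>R\<close> the relations
  linear in \<open>S\<close> already determine \<open>S\<close> up to few parameters. The flip commutes with
  all \<open>A \<otimes> A\<close>, so for \<open>R = flip\<close> the normalisation is applied to \<open>S\<close> instead.\<close>

section \<open>The Kronecker product\<close>

text \<open>The obstacle is a fixed pure tensor that is not a square, e0 \<otimes> e1. If the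
  induced involution of the quotient fixes a plane, R fixes a hyperplane; that hyperplane contains a
  square x \<otimes> x, and the square case applies. If it fixes only a line, either minus the
  transpose of R fixes a square, or the braid relation is contradictory; that contradiction is the
  longest elimination. Fixed vectors come from the columns of 1 + R, and when too few of these are
  independent, -R has two explicit ones. The anti-slash matrix is absent from the standard forms
  because the Hadamard matrix conjugates it to \<open>slash (-1) 1\<close>. Its three families of S
  are the slash and antidiagonal solutions for that matrix in disguise, and each quadratic
  constraint on their parameters is the equation s * t = 1 between an entry and its reciprocal.
  Normalisation is phrased for a single matrix, so that it can be applied to R with S carried along,
  or to S when R is the flip.\<close>

lemma sum_div_mod:
  fixes f :: "nat \<Rightarrow> nat \<Rightarrow> 'a::comm_monoid_add"
  shows "(\<Sum>k<m * n. f (k div n) (k mod n)) = (\<Sum>a<m. \<Sum>b<n. f a b)"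
proof -
  have "(\<Sum>k<m * n. f (k div n) (k mod n)) = (\<Sum>a<m. \<Sum>k\<in>{a * n..<a * n + n}. f (k div n) (k mod n))"
    by (rule sum.nat_group[symmetric])
  also have "\<dots> = (\<Sum>a<m. \<Sum>b<n. f a b)"
  proof (rule sum.cong[OF refl])
    fix a
    have "(\<Sum>k\<in>{0 + a * n..<n + a * n}. f (k div n) (k mod n)) = (\<Sum>b\<in>{0..<n}. f a b)"
      by (subst sum.shift_bounds_nat_ivl) (auto intro!: sum.cong)
    then show "(\<Sum>k\<in>{a * n..<a * n + n}. f (k div n) (k mod n)) = (\<Sum>b<n. f a b)"
      by (simp add: add.commute atLeast0LessThan)
  qed
  finally show ?thesis .
qed

lemma dim_kron [simp]:
  "dim_row (kron A B) = dim_row A * dim_row B" "dim_col (kron A B) = dim_col A * dim_col B"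
  by (simp_all add: kron_def)

lemma kron_carrier [simp, intro]:
  "A \<in> carrier_mat m n \<Longrightarrow> B \<in> carrier_mat p q \<Longrightarrow> kron A B \<in> carrier_mat (m * p) (n * q)"
  by (metis carrier_matD carrier_matI dim_kron)

lemma index_kron:
  "i < dim_row A * dim_row B \<Longrightarrow> j < dim_col A * dim_col B \<Longrightarrow>
   kron A B $$ (i, j) = A $$ (i div dim_row B, j div dim_col B) * B $$ (i mod dim_row B, j mod dim_col B)"
  by (simp add: kron_def)

lemma mod_less_factor: "(i::nat) < m * n \<Longrightarrow> i mod n < n"
  by (cases n) auto

lemma kron_mult:
  assumes "dim_col A = dim_row C" "dim_col B = dim_row D"
  shows "kron A B * kron C D = kron (A * C) (B * D)"
proof (rule eq_matI)
  fix i j assume "i < dim_row (kron (A * C) (B * D))" "j < dim_col (kron (A * C) (B * D))"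
  then have ij: "i < dim_row A * dim_row B" "j < dim_col C * dim_col D" by simp_all
  note b = less_mult_imp_div_less[OF ij(1)] less_mult_imp_div_less[OF ij(2)]
    mod_less_factor[OF ij(1)] mod_less_factor[OF ij(2)]
  have "(kron A B * kron C D) $$ (i, j) = (\<Sum>k<dim_row C * dim_row D.
      (\<lambda>a b. A $$ (i div dim_row B, a) * C $$ (a, j div dim_col D) *
        (B $$ (i mod dim_row B, b) * D $$ (b, j mod dim_col D))) (k div dim_row D) (k mod dim_row D))"
    using ij assms by (auto simp: scalar_prod_def index_kron atLeast0LessThan ac_simps intro!: sum.cong)
  also have "\<dots> = (\<Sum>a<dim_row C. A $$ (i div dim_row B, a) * C $$ (a, j div dim_col D)) *
      (\<Sum>b<dim_row D. B $$ (i mod dim_row B, b) * D $$ (b, j mod dim_col D))"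
    by (subst sum_div_mod) (simp add: sum_product)
  also have "\<dots> = kron (A * C) (B * D) $$ (i, j)"
    using ij assms b by (simp add: index_kron scalar_prod_def atLeast0LessThan)
  finally show "(kron A B * kron C D) $$ (i, j) = kron (A * C) (B * D) $$ (i, j)" .
qed (simp_all)

lemma kron_assoc: "kron (kron A B) C = kron A (kron B C)"
proof (rule eq_matI)
  fix i j assume "i < dim_row (kron A (kron B C))" "j < dim_col (kron A (kron B C))"
  then have ij: "i < dim_row A * dim_row B * dim_row C" "j < dim_col A * dim_col B * dim_col C"
    by (simp_all add: mult.assoc)
  note b = less_mult_imp_div_less[OF ij(1)] less_mult_imp_div_less[OF ij(2)]
  have c: "i mod (dim_row B * dim_row C) < dim_row B * dim_row C"
    "j mod (dim_col B * dim_col C) < dim_col B * dim_col C"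
    using ij mod_less_factor[of i "dim_row A"] mod_less_factor[of j "dim_col A"] by (simp_all add: mult.assoc)
  have d: "k div p div n = k div (n * p)" "k div p mod n = k mod (n * p) div p"
    "k mod (n * p) mod p = k mod p" for k n p :: nat
    by (simp_all add: div_mult2_eq mult.commute[of n] mod_mult2_eq) (cases "p = 0"; simp)
  have "kron (kron A B) C $$ (i, j) = kron A B $$ (i div dim_row C, j div dim_col C) *
      C $$ (i mod dim_row C, j mod dim_col C)"
    using ij by (intro index_kron) simp_all
  also have "kron A B $$ (i div dim_row C, j div dim_col C) =
      A $$ (i div (dim_row B * dim_row C), j div (dim_col B * dim_col C)) *
      B $$ (i mod (dim_row B * dim_row C) div dim_row C, j mod (dim_col B * dim_col C) div dim_col C)"
    using b by (simp only: index_kron d)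
  also have "\<dots> * C $$ (i mod dim_row C, j mod dim_col C) =
      A $$ (i div (dim_row B * dim_row C), j div (dim_col B * dim_col C)) *
      kron B C $$ (i mod (dim_row B * dim_row C), j mod (dim_col B * dim_col C))"
    using c by (simp only: index_kron d mult.assoc)
  also have "\<dots> = kron A (kron B C) $$ (i, j)"
    using ij by (subst (2) index_kron) (simp_all add: mult.assoc)
  finally show "kron (kron A B) C $$ (i, j) = kron A (kron B C) $$ (i, j)" .
qed (simp_all add: mult.assoc)

lemma kron_one [simp]: "kron (1\<^sub>m m) (1\<^sub>m n) = 1\<^sub>m (m * n)"
proof (rule eq_matI)
  fix i j assume "i < dim_row (1\<^sub>m (m * n))" "j < dim_col (1\<^sub>m (m * n))"
  then have ij: "i < m * n" "j < m * n" by simp_all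
  have "i = j" if "i div n = j div n" "i mod n = j mod n"
    using that by (metis div_mult_mod_eq)
  then show "kron (1\<^sub>m m) (1\<^sub>m n) $$ (i, j) = 1\<^sub>m (m * n) $$ (i, j)"
    using ij by (auto simp: index_kron less_mult_imp_div_less mod_less_factor)
qed simp_all

lemma kron_one_left [simp]: "kron (1\<^sub>m 1) A = A" and kron_one_right [simp]: "kron A (1\<^sub>m 1) = A"
  by (rule eq_matI; simp add: index_kron)+

lemma transpose_kron: "transpose_mat (kron A B) = kron (transpose_mat A) (transpose_mat B)"
  by (rule eq_matI) (auto simp: index_kron less_mult_imp_div_less mod_less_factor)

lemma kron_uminus: "kron (- A) B = - kron A B" "kron A (- B) = - kron A B"
  by (rule eq_matI; auto simp: index_kron less_mult_imp_div_less mod_less_factor)+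

section \<open>Functors and pairs of matrices\<close>

text \<open>Read from right to left, both sides let strands 1 and 2 cross through \<open>C\<close>,
  strands 1 and 3 through \<open>B\<close>, and strands 2 and 3 through \<open>A\<close>. The four
  triple relations are the choices RRR, RRS, RSS and SSS for these three crossings.\<close>

definition ybe :: "nat \<Rightarrow> complex mat \<Rightarrow> complex mat \<Rightarrow> complex mat \<Rightarrow> bool" where
  "ybe N A B C \<longleftrightarrow> kron A (1\<^sub>m N) * kron (1\<^sub>m N) B * kron C (1\<^sub>m N)
                = kron (1\<^sub>m N) C * kron B (1\<^sub>m N) * kron (1\<^sub>m N) A"

definition md_pair :: "nat \<Rightarrow> complex mat \<Rightarrow> complex mat \<Rightarrow> bool" where
  "md_pair N R S \<longleftrightarrow> R \<in> carrier_mat (N^2) (N^2) \<and> S \<in> carrier_mat (N^2) (N^2) \<and>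
     R * R = 1\<^sub>m (N^2) \<and> S * S = 1\<^sub>m (N^2) \<and>
     ybe N R R R \<and> ybe N R R S \<and> ybe N R S S \<and> ybe N S S S"

text \<open>The exponents use truncated subtraction, so the formula has its meaning only for 1 \<le>
  i < n: \<open>X\<close> then sits on strands i and i + 1, with i - 1 strands before it and n - i -
  1 after it.\<close>

definition strand_mat :: "nat \<Rightarrow> nat \<Rightarrow> complex mat \<Rightarrow> nat \<Rightarrow> complex mat" where
  "strand_mat N n X i = kron (1\<^sub>m (N ^ (i - 1))) (kron X (1\<^sub>m (N ^ (n - i - 1))))"

fun gen_mat :: "nat \<Rightarrow> complex mat \<Rightarrow> complex mat \<Rightarrow> nat \<Rightarrow> mdgen \<Rightarrow> complex mat" where
  "gen_mat N R S n (Sgen i) = strand_mat N n S i"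
| "gen_mat N R S n (Rgen i) = strand_mat N n R i"

text \<open>The exponent of a letter is ignored: generators go to involutions, so a letter and its
  inverse have the same matrix.\<close>

fun word_mat :: "nat \<Rightarrow> complex mat \<Rightarrow> complex mat \<Rightarrow> nat \<Rightarrow> mdgen word \<Rightarrow> complex mat" where
  "word_mat N R S n [] = 1\<^sub>m (N ^ n)"
| "word_mat N R S n (l # w) = gen_mat N R S n (fst l) * word_mat N R S n w"

section \<open>Words, their classes, and operators on strands\<close>

lemma pres_eq_words: "pres_eq X Q u v \<Longrightarrow> u \<in> words X \<and> v \<in> words X"
  using equiv_type[OF equiv_pres, of X Q] by (auto simp: pres_rel_set_def)

lemma pres_class_eq_iff:
  "u \<in> words X \<Longrightarrow> v \<in> words X \<Longrightarrow>
   pres_rel_set X Q `` {u} = pres_rel_set X Q `` {v} \<longleftrightarrow> pres_eq X Q u v"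
  using eq_equiv_class_iff[OF equiv_pres, of u X v Q] by (simp add: pres_rel_set_def)

lemma in_md_class: "v \<in> md_class n u \<longleftrightarrow> pres_eq (md_gens n) md_rels u v"
  by (simp add: md_class_def pres_rel_set_def)

lemma md_class_eqI: "pres_eq (md_gens n) md_rels u v \<Longrightarrow> md_class n u = md_class n v"
  unfolding md_class_def using pres_class_eq_iff pres_eq_words by metis

lemma in_md_class_self: "u \<in> words (md_gens n) \<Longrightarrow> u \<in> md_class n u"
  by (simp add: in_md_class pres_refl)

lemma words_Nil [simp]: "[] \<in> words X"
  and words_Cons [simp]: "l # w \<in> words X \<longleftrightarrow> fst l \<in> X \<and> w \<in> words X"
  by (auto simp: words_def mem_Times_iff)

lemma words_append_iff [simp]: "u @ v \<in> words X \<longleftrightarrow> u \<in> words X \<and> v \<in> words X"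
  by (auto simp: words_def)

lemma gens_iff [simp]:
  "Sgen i \<in> md_gens n \<longleftrightarrow> 1 \<le> i \<and> i < n" "Rgen i \<in> md_gens n \<longleftrightarrow> 1 \<le> i \<and> i < n"
  by (auto simp: md_gens_def)

lemma power_strand: "1 \<le> i \<Longrightarrow> i < n \<Longrightarrow> (N::nat) ^ (i - 1) * (N\<^sup>2 * N ^ (n - i - 1)) = N ^ n"
proof -
  assume "1 \<le> i" "i < n"
  then have "n = (i - 1) + (2 + (n - i - 1))" by simp
  then have "N ^ n = N ^ ((i - 1) + (2 + (n - i - 1)))" by (rule arg_cong)
  then show ?thesis by (simp only: power_add)
qed

lemma strand_mat_carrier:
  assumes "X \<in> carrier_mat (N\<^sup>2) (N\<^sup>2)" "1 \<le> i" "i < n"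
  shows "strand_mat N n X i \<in> carrier_mat (N ^ n) (N ^ n)"
proof -
  have "strand_mat N n X i \<in> carrier_mat (N ^ (i - 1) * (N\<^sup>2 * N ^ (n - i - 1))) (N ^ (i - 1) * (N\<^sup>2 * N ^ (n - i - 1)))"
    unfolding strand_mat_def using assms(1) by (intro kron_carrier) auto
  then show ?thesis using power_strand[OF assms(2,3)] by simp
qed

lemma strand_mat_square:
  assumes "X \<in> carrier_mat (N\<^sup>2) (N\<^sup>2)" "X * X = 1\<^sub>m (N\<^sup>2)" "1 \<le> i" "i < n"
  shows "strand_mat N n X i * strand_mat N n X i = 1\<^sub>m (N ^ n)"
  using assms power_strand[OF assms(3,4)] by (simp add: strand_mat_def kron_mult)

text \<open>One identity strand is split off the padding, on the right for index i
  (\<open>s1\<close>) and on the left for index i + 1 (\<open>s2\<close>). Both sides then become a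
  three-strand operator between the same identities.\<close>

lemma strand_mat_ybe:
  assumes X: "A \<in> carrier_mat (N\<^sup>2) (N\<^sup>2)" "B \<in> carrier_mat (N\<^sup>2) (N\<^sup>2)" "C \<in> carrier_mat (N\<^sup>2) (N\<^sup>2)"
    and i: "1 \<le> i" "Suc i < n" and "ybe N A B C"
  shows "strand_mat N n A i * (strand_mat N n B (Suc i) * strand_mat N n C i)
       = strand_mat N n C (Suc i) * (strand_mat N n B i * strand_mat N n A (Suc i))"
proof -
  have n: "n - i - 1 = Suc (n - i - 2)" "i = Suc (i - 1)" using i by auto
  have e: "1\<^sub>m (N ^ Suc k) = kron (1\<^sub>m N) (1\<^sub>m (N ^ k))" "1\<^sub>m (N ^ Suc k) = kron (1\<^sub>m (N ^ k)) (1\<^sub>m N)" for k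
    by (simp_all add: mult.commute)
  have s1: "strand_mat N n Y i
      = kron (1\<^sub>m (N ^ (i - 1))) (kron (kron Y (1\<^sub>m N)) (1\<^sub>m (N ^ (n - i - 2))))" for Y
    unfolding strand_mat_def by (subst n(1), subst e(1)) (simp only: kron_assoc)
  have s2: "strand_mat N n Y (Suc i)
      = kron (1\<^sub>m (N ^ (i - 1))) (kron (kron (1\<^sub>m N) Y) (1\<^sub>m (N ^ (n - i - 2))))" for Y
  proof -
    have "strand_mat N n Y (Suc i) = kron (1\<^sub>m (N ^ Suc (i - 1))) (kron Y (1\<^sub>m (N ^ (n - i - 2))))"
      unfolding strand_mat_def using i by simp
    then show ?thesis unfolding e(2) kron_assoc .
  qed
  let ?M = "N * N\<^sup>2"
  have c: "kron Y (1\<^sub>m N) \<in> carrier_mat ?M ?M" "kron (1\<^sub>m N) Y \<in> carrier_mat ?M ?M"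
    if "Y \<in> carrier_mat (N\<^sup>2) (N\<^sup>2)" for Y
    using kron_carrier[OF that one_carrier_mat[of N]] kron_carrier[OF one_carrier_mat[of N] that]
    by (simp_all add: mult.commute)
  have "kron A (1\<^sub>m N) * (kron (1\<^sub>m N) B * kron C (1\<^sub>m N)) = kron (1\<^sub>m N) C * (kron B (1\<^sub>m N) * kron (1\<^sub>m N) A)"
    using assms(6) unfolding ybe_def
    by (simp only: assoc_mult_mat[OF c(1)[OF X(1)] c(2)[OF X(2)] c(1)[OF X(3)]]
        assoc_mult_mat[OF c(2)[OF X(3)] c(1)[OF X(2)] c(2)[OF X(1)]])
  then show ?thesis using X unfolding s1 s2 by (simp add: kron_mult power2_eq_square mult.commute)
qed

text \<open>The two blocks are separated by j - i - 2 strands, hence sit on disjoint tensor factors,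
  and both products are computed factor by factor.\<close>

lemma strand_mat_commute:
  assumes X: "A \<in> carrier_mat (N\<^sup>2) (N\<^sup>2)" "B \<in> carrier_mat (N\<^sup>2) (N\<^sup>2)"
    and i: "1 \<le> i" "Suc i < j" "j < n"
  shows "strand_mat N n A i * strand_mat N n B j = strand_mat N n B j * strand_mat N n A i"
proof -
  let ?b = "N ^ (j - i - 2)" and ?c = "N ^ (n - j - 1)"
  have "n - i - 1 = (j - i - 2) + (2 + (n - j - 1))" "j - 1 = (i - 1) + (2 + (j - i - 2))"
    using i by auto
  then have n: "N ^ (n - i - 1) = ?b * (N\<^sup>2 * ?c)" "N ^ (j - 1) = N ^ (i - 1) * (N\<^sup>2 * ?b)"
    by (simp_all only: power_add)
  have s1: "strand_mat N n A i = kron (1\<^sub>m (N ^ (i - 1)))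
      (kron A (kron (1\<^sub>m ?b) (kron (1\<^sub>m (N\<^sup>2)) (1\<^sub>m ?c))))"
    unfolding strand_mat_def n by simp
  have s2: "strand_mat N n B j = kron (1\<^sub>m (N ^ (i - 1)))
      (kron (1\<^sub>m (N\<^sup>2)) (kron (1\<^sub>m ?b) (kron B (1\<^sub>m ?c))))"
    unfolding strand_mat_def n kron_one[symmetric] kron_assoc ..
  show ?thesis using X unfolding s1 s2 by (simp add: kron_mult)
qed

lemma gen_mat_carrier:
  assumes "R \<in> carrier_mat (N\<^sup>2) (N\<^sup>2)" "S \<in> carrier_mat (N\<^sup>2) (N\<^sup>2)" "g \<in> md_gens n"
  shows "gen_mat N R S n g \<in> carrier_mat (N ^ n) (N ^ n)"
  using assms by (cases g) (auto intro: strand_mat_carrier)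

lemma word_mat_carrier:
  assumes "R \<in> carrier_mat (N\<^sup>2) (N\<^sup>2)" "S \<in> carrier_mat (N\<^sup>2) (N\<^sup>2)" "w \<in> words (md_gens n)"
  shows "word_mat N R S n w \<in> carrier_mat (N ^ n) (N ^ n)"
  using assms(3) by (induction w) (auto intro: gen_mat_carrier[OF assms(1,2)] mult_carrier_mat)

lemma word_mat_append:
  assumes R: "R \<in> carrier_mat (N\<^sup>2) (N\<^sup>2)" "S \<in> carrier_mat (N\<^sup>2) (N\<^sup>2)"
    and "u \<in> words (md_gens n)" and v: "v \<in> words (md_gens n)"
  shows "word_mat N R S n (u @ v) = word_mat N R S n u * word_mat N R S n v"
  using assms(3)
proof (induction u)
  case Nil
  then show ?case using left_mult_one_mat[OF word_mat_carrier[OF R v]] by simp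
next
  case (Cons l u)
  then show ?case
    using assoc_mult_mat[OF gen_mat_carrier[OF R] word_mat_carrier[OF R] word_mat_carrier[OF R v], of "fst l" u]
    by simp
qed

text \<open>Makes \<open>word_mat\<close> well defined on the presented group. Since exponents are
  ignored, cancelling a letter against its inverse amounts to squaring a strand operator.\<close>

lemma word_mat_pres_eq:
  assumes "md_pair N R S" and "pres_eq (md_gens n) md_rels u v"
  shows "word_mat N R S n u = word_mat N R S n v"
  using assms(2)
proof induction
  case (pres_append u u' v v')
  then show ?case
    using assms(1) pres_eq_words[OF pres_append(1)] pres_eq_words[OF pres_append(2)]
    by (simp add: md_pair_def word_mat_append)
next
  case (pres_cancel x b)
  then show ?case using assms(1)
    by (cases x) (auto simp: md_pair_def strand_mat_square right_mult_one_mat[OF strand_mat_carrier])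
next
  case (pres_rel u v)
  note P = assms(1)[unfolded md_pair_def]
  have c: "strand_mat N n R i * 1\<^sub>m (N ^ n) = strand_mat N n R i"
    "strand_mat N n S i * 1\<^sub>m (N ^ n) = strand_mat N n S i" if "Suc 0 \<le> i" "i < n" for i
    using P that by (auto intro!: right_mult_one_mat strand_mat_carrier)
  from pres_rel show ?case
    unfolding md_rels_def
    by (elim UnE CollectE exE conjE)
       (use P in \<open>auto simp: c strand_mat_ybe strand_mat_square
          intro: strand_mat_commute strand_mat_commute[symmetric]\<close>)
qed auto

text \<open>The relation x x = 1 makes each generator its own inverse, so an arbitrary functor need
  only be evaluated on positive letters.\<close>

lemma pres_eq_inverse_letter:
  assumes "x \<in> md_gens n"
  shows "pres_eq (md_gens n) md_rels [(x, b)] [(x, True)]"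
proof (cases b)
  case True
  then show ?thesis using assms by (simp add: pres_refl)
next
  case False
  let ?E = "pres_eq (md_gens n) md_rels"
  have "([(x, True), (x, True)], []) \<in> md_rels"
    by (cases x) (auto simp: md_rels_def)
  then have "?E ([(x, False)] @ [(x, True), (x, True)]) ([(x, False)] @ [])"
    using assms by (intro pres_append pres_refl pres_rel) auto
  moreover have "?E ([(x, False), (x, \<not> False)] @ [(x, True)]) ([] @ [(x, True)])"
    using assms by (intro pres_append pres_refl pres_cancel) auto
  ultimately have "?E [(x, False)] [(x, True)]"
    by (simp del: words_Cons) (metis pres_sym pres_trans)
  then show ?thesis using False by simp
qed

section \<open>Shifts and the monoidal product of classes\<close>

lemma shift_gen_mem: "x \<in> md_gens n \<Longrightarrow> n + k \<le> m \<Longrightarrow> shift_gen k x \<in> md_gens m"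
  by (cases x) auto

lemma shift_word_simps [simp]:
  "shift_word k [] = []" "shift_word k (l # w) = (shift_gen k (fst l), snd l) # shift_word k w"
  "shift_word k (u @ v) = shift_word k u @ shift_word k v"
  by (auto simp: shift_word_def map_prod_def split_beta)

lemma shift_word_mem: "w \<in> words (md_gens n) \<Longrightarrow> n + k \<le> m \<Longrightarrow> shift_word k w \<in> words (md_gens m)"
  by (induction w) (auto intro: shift_gen_mem)

lemma shift_gen_0 [simp]: "shift_gen 0 x = x"
  by (cases x) auto

lemma shift_word_0 [simp]: "shift_word 0 w = w"
  by (induction w) auto

text \<open>The set \<open>md_rels\<close> is indexed by all natural numbers and is therefore stable
  under shifting; only membership of the words in the larger generator set has to be
  tracked.\<close>

lemma pres_eq_shift:
  assumes "pres_eq (md_gens n) md_rels u v" "n + k \<le> m"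
  shows "pres_eq (md_gens m) md_rels (shift_word k u) (shift_word k v)"
  using assms(1)
proof induction
  case (pres_refl u)
  then show ?case using assms(2) by (intro pres_eq.pres_refl shift_word_mem)
next
  case (pres_trans u v w)
  then show ?case using pres_eq.pres_trans by blast
next
  case (pres_cancel x b)
  then show ?case using pres_eq.pres_cancel[OF shift_gen_mem[OF _ assms(2)]] by simp
next
  case (pres_rel u v)
  have "(shift_word k u, shift_word k v) \<in> md_rels"
    using pres_rel(1) unfolding md_rels_def
    by (elim UnE CollectE exE conjE) auto
  then show ?case
    using pres_rel(2,3) assms(2) by (intro pres_eq.pres_rel shift_word_mem)
next
  case (pres_sym u v)
  then show ?case using pres_eq.pres_sym by blast
next
  case (pres_append u u' v v')
  then show ?case by (simp add: pres_eq.pres_append)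
qed

lemma md_tens_class:
  assumes "u \<in> words (md_gens m)" "v \<in> words (md_gens n)"
  shows "md_tens m n (md_class m u) (md_class n v) = md_class (m + n) (u @ shift_word m v)"
proof -
  have "md_class (m + n) (u' @ shift_word m v') = md_class (m + n) (u @ shift_word m v)"
    if "u' \<in> md_class m u" "v' \<in> md_class n v" for u' v'
  proof -
    have "pres_eq (md_gens (m + n)) md_rels u u'"
      using pres_eq_shift[of m u u' 0 "m + n"] that(1) by (simp add: in_md_class)
    moreover have "pres_eq (md_gens (m + n)) md_rels (shift_word m v) (shift_word m v')"
      using pres_eq_shift[of n v v' m "m + n"] that(2) by (simp add: in_md_class)
    ultimately show ?thesis by (intro md_class_eqI[symmetric] pres_append)
  qed
  then have "md_tens m n (md_class m u) (md_class n v)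
      = (\<Union>u'\<in>md_class m u. \<Union>v'\<in>md_class n v. md_class (m + n) (u @ shift_word m v))"
    unfolding md_tens_def by (intro SUP_cong refl) simp
  \<comment> \<open>A union of copies of one class equals that class only over nonempty index
    sets.\<close>
  moreover have "md_class m u \<noteq> {}" "md_class n v \<noteq> {}"
    using in_md_class_self assms by blast+
  ultimately show ?thesis by (simp only: UN_constant if_False)
qed

lemma carrier_MD_group: "carrier (MD_group n) = md_class n ` words (md_gens n)"
  by (auto simp: MD_group_def presented_group_def quotient_def md_class_def)

lemma one_MD_group: "one (MD_group n) = md_class n []"
  by (simp add: MD_group_def presented_group_def md_class_def)

lemma mult_MD_group:
  "u \<in> words (md_gens n) \<Longrightarrow> v \<in> words (md_gens n) \<Longrightarrow>
   mult (MD_group n) (md_class n u) (md_class n v) = md_class n (u @ v)"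
  by (simp add: MD_group_def md_class_def mult_presented_group)

lemma word_mat_some:
  assumes "md_pair N R S" "w \<in> words (md_gens n)"
  shows "word_mat N R S n (SOME v. v \<in> md_class n w) = word_mat N R S n w"
proof -
  have "(SOME v. v \<in> md_class n w) \<in> md_class n w"
    using in_md_class_self[OF assms(2)] by (rule someI)
  then show ?thesis using word_mat_pres_eq[OF assms(1)] by (metis in_md_class)
qed

section \<open>The functor attached to a pair of matrices\<close>

lemma strand_mat_left:
  assumes "1 \<le> i" "i < m"
  shows "strand_mat N (m + n) X i = kron (strand_mat N m X i) (1\<^sub>m (N ^ n))"
proof -
  have "m + n - i - 1 = (m - i - 1) + n" using assms by auto
  then show ?thesis
    unfolding strand_mat_def by (simp only: power_add kron_one[symmetric] kron_assoc)
qed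

lemma strand_mat_right:
  assumes "1 \<le> i" "i < n"
  shows "strand_mat N (m + n) X (i + m) = kron (1\<^sub>m (N ^ m)) (strand_mat N n X i)"
proof -
  have "m + n - (i + m) - 1 = n - i - 1" "i + m - 1 = m + (i - 1)" using assms by auto
  then show ?thesis
    unfolding strand_mat_def by (simp only: power_add kron_one[symmetric] kron_assoc)
qed

lemma gen_mat_left: "g \<in> md_gens m \<Longrightarrow> gen_mat N R S (m + n) g = kron (gen_mat N R S m g) (1\<^sub>m (N ^ n))"
  by (cases g) (auto simp: strand_mat_left)

lemma gen_mat_right:
  "g \<in> md_gens n \<Longrightarrow> gen_mat N R S (m + n) (shift_gen m g) = kron (1\<^sub>m (N ^ m)) (gen_mat N R S n g)"
  by (cases g) (auto simp: strand_mat_right)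

lemma word_mat_left:
  assumes R: "R \<in> carrier_mat (N\<^sup>2) (N\<^sup>2)" "S \<in> carrier_mat (N\<^sup>2) (N\<^sup>2)"
    and "w \<in> words (md_gens m)"
  shows "word_mat N R S (m + n) w = kron (word_mat N R S m w) (1\<^sub>m (N ^ n))"
  using assms(3)
proof (induction w)
  case (Cons l w)
  then have "fst l \<in> md_gens m" "w \<in> words (md_gens m)" by auto
  then have "dim_col (gen_mat N R S m (fst l)) = dim_row (word_mat N R S m w)"
    using gen_mat_carrier[OF R] word_mat_carrier[OF R] by (metis carrier_matD)
  then show ?case using Cons by (simp add: gen_mat_left kron_mult)
qed (simp add: power_add)

lemma word_mat_right:
  assumes R: "R \<in> carrier_mat (N\<^sup>2) (N\<^sup>2)" "S \<in> carrier_mat (N\<^sup>2) (N\<^sup>2)"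
    and "w \<in> words (md_gens n)"
  shows "word_mat N R S (m + n) (shift_word m w) = kron (1\<^sub>m (N ^ m)) (word_mat N R S n w)"
  using assms(3)
proof (induction w)
  case (Cons l w)
  then have "fst l \<in> md_gens n" "w \<in> words (md_gens n)" by auto
  then have "dim_col (gen_mat N R S n (fst l)) = dim_row (word_mat N R S n w)"
    using gen_mat_carrier[OF R] word_mat_carrier[OF R] by (metis carrier_matD)
  then show ?case using Cons by (simp add: gen_mat_right kron_mult)
qed (simp add: power_add)

lemma word_mat_tens:
  assumes R: "R \<in> carrier_mat (N\<^sup>2) (N\<^sup>2)" "S \<in> carrier_mat (N\<^sup>2) (N\<^sup>2)"
    and w: "u \<in> words (md_gens m)" "v \<in> words (md_gens n)"
  shows "word_mat N R S (m + n) (u @ shift_word m v) = kron (word_mat N R S m u) (word_mat N R S n v)"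
proof -
  have "u \<in> words (md_gens (m + n))" "shift_word m v \<in> words (md_gens (m + n))"
    using shift_word_mem[OF w(1), of 0 "m + n"] shift_word_mem[OF w(2), of m "m + n"] by simp_all
  then have "word_mat N R S (m + n) (u @ shift_word m v)
     = kron (word_mat N R S m u) (1\<^sub>m (N ^ n)) * kron (1\<^sub>m (N ^ m)) (word_mat N R S n v)"
    by (simp add: word_mat_append[OF R] word_mat_left[OF R w(1)] word_mat_right[OF R w(2)])
  also have "\<dots> = kron (word_mat N R S m u) (word_mat N R S n v)"
    using word_mat_carrier[OF R w(1)] word_mat_carrier[OF R w(2)] by (subst kron_mult) auto
  finally show ?thesis .
qed

lemma strand_mat_2: "X \<in> carrier_mat (N\<^sup>2) (N\<^sup>2) \<Longrightarrow> strand_mat N 2 X 1 = X"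
  using kron_one_left kron_one_right by (simp add: strand_mat_def)

lemma md_pair_functor:
  assumes P: "md_pair N R S"
  shows "\<exists>Fo Fm. MD_functor Fo Fm \<and> Fo 1 = N \<and> Fm 2 2 md_r = R \<and> Fm 2 2 md_s = S"
proof -
  have R: "R \<in> carrier_mat (N\<^sup>2) (N\<^sup>2)" "S \<in> carrier_mat (N\<^sup>2) (N\<^sup>2)"
    using P by (auto simp: md_pair_def)
  define Fo :: "nat \<Rightarrow> nat" where "Fo n = N ^ n" for n
  \<comment> \<open>An arrow is a class of words, and by \<open>word_mat_some\<close> any
    representative gives the same matrix.\<close>
  define Fm :: "nat \<Rightarrow> nat \<Rightarrow> mdgen word set \<Rightarrow> complex mat"
    where "Fm m n a = word_mat N R S n (SOME v. v \<in> a)" for m n a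
  have F: "Fm m n (md_class n w) = word_mat N R S n w" if "w \<in> words (md_gens n)" for m n w
    unfolding Fm_def using word_mat_some[OF P that] .
  \<comment> \<open>Stated for a product, because in the final simplification
    \<open>word_mat_append\<close> first splits the word that represents the monoidal
    product.\<close>
  have T: "word_mat N R S (m + n) u * word_mat N R S (m + n) (shift_word m v)
      = kron (word_mat N R S m u) (word_mat N R S n v)"
    if w: "u \<in> words (md_gens m)" "v \<in> words (md_gens n)" for m n u v
  proof -
    have "u \<in> words (md_gens (m + n))" "shift_word m v \<in> words (md_gens (m + n))"
      using shift_word_mem[OF w(1), of 0 "m + n"] shift_word_mem[OF w(2), of m "m + n"] by simp_all
    then show ?thesis using word_mat_tens[OF R w] word_mat_append[OF R] by metis
  qed
  have "MD_functor Fo Fm"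
    unfolding MD_functor_def strict_monoidal_functor_def
    by (auto simp: MD_def Mat_def Fo_def F carrier_MD_group one_MD_group mult_MD_group md_tens_class
        word_mat_carrier[OF R] word_mat_append[OF R] T power_add
        shift_word_mem[of _ _ 0, simplified] shift_word_mem split: if_splits)
  moreover have "Fm 2 2 md_r = R" "Fm 2 2 md_s = S"
    unfolding md_r_def md_s_def using R by (simp_all add: F strand_mat_2[unfolded One_nat_def])
  moreover have "Fo 1 = N" by (simp add: Fo_def)
  ultimately show ?thesis by blast
qed

text \<open>Every generator on n strands is a two-strand generator tensored with identities on both
  sides, so strictness leaves no freedom beyond the images of r and s.\<close>

lemma functor_word:
  assumes F: "MD_functor Fo Fm" and N: "Fo 1 = N"
  shows "Fo n = N ^ n"
    and "w \<in> words (md_gens n) \<Longrightarrow> Fm n n (md_class n w) = word_mat N (Fm 2 2 md_r) (Fm 2 2 md_s) n w"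
proof -
  note A = F[unfolded MD_functor_def strict_monoidal_functor_def]
  have o0: "Fo 0 = 1" using A by (simp add: MD_def Mat_def)
  have o_add: "Fo (m + n) = Fo m * Fo n" for m n using A by (simp add: MD_def Mat_def)
  show o: "Fo n = N ^ n" for n
  proof (induction n)
    case (Suc n)
    then show ?case using o_add[of n 1] N by simp
  qed (simp add: o0)
  have id: "Fm n n (md_class n []) = 1\<^sub>m (N ^ n)" for n
    using A o by (simp add: MD_def Mat_def one_MD_group)
  have comp: "Fm n n (md_class n (u @ v)) = Fm n n (md_class n u) * Fm n n (md_class n v)"
    if "u \<in> words (md_gens n)" "v \<in> words (md_gens n)" for n u v
  proof -
    have "md_class n u \<in> carrier (MD_group n)" "md_class n v \<in> carrier (MD_group n)"
      using that by (auto simp: carrier_MD_group)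
    then have "Fm n n (mult (MD_group n) (md_class n u) (md_class n v))
        = Fm n n (md_class n u) * Fm n n (md_class n v)"
      using A[THEN conjunct2, THEN conjunct2, THEN conjunct2, THEN conjunct1, rule_format,
          of n n n "md_class n v" "md_class n u"] by (simp add: MD_def Mat_def)
    then show ?thesis using that by (simp add: mult_MD_group)
  qed
  have tens: "Fm (m + n) (m + n) (md_class (m + n) (u @ shift_word m v))
      = kron (Fm m m (md_class m u)) (Fm n n (md_class n v))"
    if "u \<in> words (md_gens m)" "v \<in> words (md_gens n)" for m n u v
  proof -
    have "md_class m u \<in> carrier (MD_group m)" "md_class n v \<in> carrier (MD_group n)"
      using that by (auto simp: carrier_MD_group)
    then have "Fm (m + n) (m + n) (md_tens m n (md_class m u) (md_class n v))
        = kron (Fm m m (md_class m u)) (Fm n n (md_class n v))"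
      using A[THEN conjunct2, THEN conjunct2, THEN conjunct2, THEN conjunct2, THEN conjunct2,
          THEN conjunct2, rule_format, of m m n n "md_class m u" "md_class n v"]
      by (simp add: MD_def Mat_def)
    then show ?thesis using that by (simp add: md_tens_class)
  qed
  have letter: "Fm n n (md_class n [(g, b)]) = gen_mat N (Fm 2 2 md_r) (Fm 2 2 md_s) n g"
    if g: "g \<in> md_gens n" for n g b
  proof -
    \<comment> \<open>The two-strand generator is padded by applying \<open>tens\<close> twice with
      an empty word: once for the strands on its right, once for those on its left.\<close>
    have strand: "Fm n n (md_class n [(shift_gen (i - 1) x, True)])
        = strand_mat N n (Fm 2 2 (md_class 2 [(x, True)])) i"
      if i: "1 \<le> i" "i < n" and x: "x \<in> md_gens 2" for i x
    proof -
      have n: "(i - 1) + (2 + (n - i - 1)) = n" using i by simp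
      have "x \<in> md_gens (2 + (n - i - 1))" using shift_gen_mem[OF x, of 0] by simp
      then show ?thesis
        using tens[of "[]" "i - 1" "[(x, True)]" "2 + (n - i - 1)"] tens[of "[(x, True)]" 2 "[]" "n - i - 1"] x
        unfolding n by (simp add: id strand_mat_def)
    qed
    have "Fm n n (md_class n [(g, b)]) = Fm n n (md_class n [(g, True)])"
      using md_class_eqI[OF pres_eq_inverse_letter[OF g, of b]] by simp
    also have "\<dots> = gen_mat N (Fm 2 2 md_r) (Fm 2 2 md_s) n g"
    proof (cases g)
      case (Sgen i)
      then show ?thesis using g strand[of i "Sgen 1"] by (simp add: md_s_def)
    next
      case (Rgen i)
      then show ?thesis using g strand[of i "Rgen 1"] by (simp add: md_r_def)
    qed
    finally show ?thesis .
  qed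
  show "Fm n n (md_class n w) = word_mat N (Fm 2 2 md_r) (Fm 2 2 md_s) n w"
    if "w \<in> words (md_gens n)" using that
  proof (induction w)
    case Nil
    then show ?case using id by simp
  next
    case (Cons l w)
    then show ?case using comp[of "[l]" n w] letter[of "fst l" n "snd l"] by simp
  qed
qed

lemma functor_md_pair:
  assumes F: "MD_functor Fo Fm" and N: "Fo 1 = N"
  shows "md_pair N (Fm 2 2 md_r) (Fm 2 2 md_s)"
proof -
  let ?R = "Fm 2 2 md_r" and ?S = "Fm 2 2 md_s"
  note W = functor_word(2)[OF F N]
  note A = F[unfolded MD_functor_def strict_monoidal_functor_def, THEN conjunct2, THEN conjunct1, rule_format, of 2 2]
  have "md_r \<in> carrier (MD_group 2)" "md_s \<in> carrier (MD_group 2)"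
    by (auto simp: carrier_MD_group md_r_def md_s_def)
  then have "?R \<in> carrier_mat (Fo 2) (Fo 2)" "?S \<in> carrier_mat (Fo 2) (Fo 2)"
    using A by (simp_all add: MD_def Mat_def)
  then have c: "?R \<in> carrier_mat (N\<^sup>2) (N\<^sup>2)" "?S \<in> carrier_mat (N\<^sup>2) (N\<^sup>2)"
    using functor_word(1)[OF F N, of 2] by simp_all
  have rel: "word_mat N ?R ?S n u = word_mat N ?R ?S n v"
    if "(u, v) \<in> md_rels" "u \<in> words (md_gens n)" "v \<in> words (md_gens n)" for n u v
    using that W md_class_eqI[OF pres_rel[OF that]] by metis
  have sq: "strand_mat N 2 ?R 1 * strand_mat N 2 ?R 1 = 1\<^sub>m (N\<^sup>2)"
      "strand_mat N 2 ?S 1 * strand_mat N 2 ?S 1 = 1\<^sub>m (N\<^sup>2)"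
    using rel[of "[r_letter 1, r_letter 1]" "[]" 2] rel[of "[s_letter 1, s_letter 1]" "[]" 2] c
    by (auto simp: md_rels_def strand_mat_2[unfolded One_nat_def])
  have st: "strand_mat N 3 X 1 = kron X (1\<^sub>m N)" "strand_mat N 3 X 2 = kron (1\<^sub>m N) X" for X
    using kron_one_left kron_one_right by (simp_all add: strand_mat_def)
  have d: "N ^ 3 = N * N\<^sup>2" "N ^ 3 = N\<^sup>2 * N" by (simp_all add: power_numeral_reduce power2_eq_square)
  have kc: "kron X (1\<^sub>m N) \<in> carrier_mat (N ^ 3) (N ^ 3)" "kron (1\<^sub>m N) X \<in> carrier_mat (N ^ 3) (N ^ 3)"
    if "X \<in> carrier_mat (N\<^sup>2) (N\<^sup>2)" for X
    using kron_carrier[OF that one_carrier_mat[of N]] kron_carrier[OF one_carrier_mat[of N] that]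
    by (simp_all only: d[symmetric])
  have tr: "word_mat N ?R ?S 3 [(x, True), (y, True), (z, True)] = gen_mat N ?R ?S 3 x * gen_mat N ?R ?S 3 y * gen_mat N ?R ?S 3 z"
    if "x \<in> md_gens 3" "y \<in> md_gens 3" "z \<in> md_gens 3" for x y z
    using gen_mat_carrier[OF c that(1)] gen_mat_carrier[OF c that(2)] gen_mat_carrier[OF c that(3)]
    by simp
  \<comment> \<open>Here \<open>x\<close>, \<open>y\<close>, \<open>z\<close> stand for the
    constructors \<open>Rgen\<close> or \<open>Sgen\<close>, so that one argument serves all four
    triple relations.\<close>
  have y: "ybe N X Y Z"
    if "([(x 1, True), (y 2, True), (z 1, True)], [(z 2, True), (y 1, True), (x 2, True)]) \<in> md_rels"
      "\<forall>i\<in>{1,2}. gen_mat N ?R ?S 3 (x i) = strand_mat N 3 X i \<and> gen_mat N ?R ?S 3 (y i) = strand_mat N 3 Y i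
         \<and> gen_mat N ?R ?S 3 (z i) = strand_mat N 3 Z i"
      "\<forall>i\<in>{1,2}. x i \<in> md_gens 3 \<and> y i \<in> md_gens 3 \<and> z i \<in> md_gens 3" for x y z :: "nat \<Rightarrow>
        mdgen" and X Y Z
    using rel[OF that(1), of 3] that(2,3) unfolding ybe_def by (simp add: tr st[unfolded One_nat_def] del: word_mat.simps)
  have "ybe N ?R ?R ?R" by (rule y[of Rgen Rgen Rgen]) (auto simp: md_rels_def)
  moreover have "ybe N ?R ?R ?S" by (rule y[of Rgen Rgen Sgen]) (auto simp: md_rels_def)
  moreover have "ybe N ?R ?S ?S" by (rule y[of Rgen Sgen Sgen]) (auto simp: md_rels_def)
  moreover have "ybe N ?S ?S ?S" by (rule y[of Sgen Sgen Sgen]) (auto simp: md_rels_def)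
  ultimately show ?thesis
    using sq c by (simp add: md_pair_def strand_mat_2[unfolded One_nat_def])
qed

lemma MD_pairs_iff: "(R, S) \<in> MD_pairs N \<longleftrightarrow> md_pair N R S"
proof
  assume "(R, S) \<in> MD_pairs N"
  then obtain Fo Fm where "R = Fm 2 2 md_r" "S = Fm 2 2 md_s" "MD_functor Fo Fm" "Fo 1 = N"
    unfolding MD_pairs_def by blast
  then show "md_pair N R S" using functor_md_pair by blast
next
  assume "md_pair N R S"
  then show "(R, S) \<in> MD_pairs N" using md_pair_functor[of N R S] unfolding MD_pairs_def by blast
qed

lemma functor_unique:
  assumes F: "MD_functor Fo Fm" "Fo 1 = N" and G: "MD_functor Go Gm" "Go 1 = N"
    and RS: "Fm 2 2 md_r = Gm 2 2 md_r" "Fm 2 2 md_s = Gm 2 2 md_s"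
  shows "Fo = Go \<and> (\<forall>m n. \<forall>a\<in>Hom MD m n. Fm m n a = Gm m n a)"
proof (intro conjI allI ballI)
  show "Fo = Go"
    by (rule ext) (simp only: functor_word(1)[OF F] functor_word(1)[OF G])
next
  fix m n a
  assume "a \<in> Hom MD m n"
  then have "m = n" "a \<in> md_class n ` words (md_gens n)"
    by (simp_all add: MD_def carrier_MD_group split: if_splits)
  then obtain w where "m = n" "a = md_class n w" "w \<in> words (md_gens n)"
    by blast
  then show "Fm m n a = Gm m n a"
    using functor_word(2)[OF F, of w n] functor_word(2)[OF G, of w n] RS by metis
qed

section \<open>Matrices of size four\<close>

text \<open>Sixteen scalar arguments instead of a list of rows: through \<open>mat4_eq_iff\<close> a
  matrix equation becomes a conjunction of polynomial equations, ready for elimination.\<close>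

definition mat4 :: "complex \<Rightarrow> complex \<Rightarrow> complex \<Rightarrow> complex \<Rightarrow> complex \<Rightarrow> complex
  \<Rightarrow> complex \<Rightarrow> complex
    \<Rightarrow> complex \<Rightarrow> complex \<Rightarrow> complex \<Rightarrow> complex \<Rightarrow> complex \<Rightarrow> complex
      \<Rightarrow> complex \<Rightarrow> complex \<Rightarrow> complex mat" where
  "mat4 a00 a01 a02 a03 a10 a11 a12 a13 a20 a21 a22 a23 a30 a31 a32 a33 =
     mat 4 4 (\<lambda>(i, j). [[a00, a01, a02, a03], [a10, a11, a12, a13], [a20, a21, a22, a23], [a30, a31, a32, a33]] ! i ! j)"

definition mat2 :: "complex \<Rightarrow> complex \<Rightarrow> complex \<Rightarrow> complex \<Rightarrow> complex mat" where
  "mat2 a b c d = mat 2 2 (\<lambda>(i, j). [[a, b], [c, d]] ! i ! j)"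

lemma mat4_carrier [simp, intro]: "mat4 a00 a01 a02 a03 a10 a11 a12 a13 a20 a21 a22 a23 a30 a31 a32 a33 \<in> carrier_mat 4 4"
  by (simp add: mat4_def)

lemma mat2_carrier [simp, intro]: "mat2 a b c d \<in> carrier_mat 2 2"
  by (simp add: mat2_def)

lemma mat4_dim [simp]: "dim_row (mat4 a00 a01 a02 a03 a10 a11 a12 a13 a20 a21 a22 a23 a30 a31 a32 a33) = 4" "dim_col (mat4 a00 a01 a02 a03
  a10 a11 a12 a13 a20 a21 a22 a23 a30 a31 a32 a33) = 4"
  by (simp_all add: mat4_def)

lemma mat2_dim [simp]: "dim_row (mat2 a b c d) = 2" "dim_col (mat2 a b c d) = 2"
  by (simp_all add: mat2_def)

text \<open>Index 1 is written \<open>Suc 0\<close>, the form in which the simplifier leaves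
  it.\<close>

lemma mat4_index [simp]:
  "mat4 a00 a01 a02 a03 a10 a11 a12 a13 a20 a21 a22 a23 a30 a31 a32 a33 $$ (0, 0) = a00"
  "mat4 a00 a01 a02 a03 a10 a11 a12 a13 a20 a21 a22 a23 a30 a31 a32 a33 $$ (0, Suc 0) = a01"
  "mat4 a00 a01 a02 a03 a10 a11 a12 a13 a20 a21 a22 a23 a30 a31 a32 a33 $$ (0, 2) = a02"
  "mat4 a00 a01 a02 a03 a10 a11 a12 a13 a20 a21 a22 a23 a30 a31 a32 a33 $$ (0, 3) = a03"
  "mat4 a00 a01 a02 a03 a10 a11 a12 a13 a20 a21 a22 a23 a30 a31 a32 a33 $$ (Suc 0, 0) = a10"
  "mat4 a00 a01 a02 a03 a10 a11 a12 a13 a20 a21 a22 a23 a30 a31 a32 a33 $$ (Suc 0, Suc 0) = a11"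
  "mat4 a00 a01 a02 a03 a10 a11 a12 a13 a20 a21 a22 a23 a30 a31 a32 a33 $$ (Suc 0, 2) = a12"
  "mat4 a00 a01 a02 a03 a10 a11 a12 a13 a20 a21 a22 a23 a30 a31 a32 a33 $$ (Suc 0, 3) = a13"
  "mat4 a00 a01 a02 a03 a10 a11 a12 a13 a20 a21 a22 a23 a30 a31 a32 a33 $$ (2, 0) = a20"
  "mat4 a00 a01 a02 a03 a10 a11 a12 a13 a20 a21 a22 a23 a30 a31 a32 a33 $$ (2, Suc 0) = a21"
  "mat4 a00 a01 a02 a03 a10 a11 a12 a13 a20 a21 a22 a23 a30 a31 a32 a33 $$ (2, 2) = a22"
  "mat4 a00 a01 a02 a03 a10 a11 a12 a13 a20 a21 a22 a23 a30 a31 a32 a33 $$ (2, 3) = a23"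
  "mat4 a00 a01 a02 a03 a10 a11 a12 a13 a20 a21 a22 a23 a30 a31 a32 a33 $$ (3, 0) = a30"
  "mat4 a00 a01 a02 a03 a10 a11 a12 a13 a20 a21 a22 a23 a30 a31 a32 a33 $$ (3, Suc 0) = a31"
  "mat4 a00 a01 a02 a03 a10 a11 a12 a13 a20 a21 a22 a23 a30 a31 a32 a33 $$ (3, 2) = a32"
  "mat4 a00 a01 a02 a03 a10 a11 a12 a13 a20 a21 a22 a23 a30 a31 a32 a33 $$ (3, 3) = a33"
  by (simp_all add: mat4_def)

lemma mat2_index [simp]:
  "mat2 a b c d $$ (0, 0) = a" "mat2 a b c d $$ (0, Suc 0) = b"
  "mat2 a b c d $$ (Suc 0, 0) = c" "mat2 a b c d $$ (Suc 0, Suc 0) = d"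
  by (simp_all add: mat2_def)

lemma mat4_of_rows: "mat_of_rows_list 4 [[a00, a01, a02, a03], [a10, a11, a12, a13], [a20, a21, a22, a23], [a30, a31, a32, a33]] = mat4 a00
  a01 a02 a03 a10 a11 a12 a13 a20 a21 a22 a23 a30 a31 a32 a33"
  by (simp add: mat4_def mat_of_rows_list_def eval_nat_numeral)

lemma less_four: "i < 4 \<longleftrightarrow> i = 0 \<or> i = Suc 0 \<or> i = 2 \<or> i = (3::nat)"
  by auto

lemma index_less_4: "0 < (4::nat)" "Suc 0 < 4" "2 < (4::nat)" "3 < (4::nat)"
  by simp_all

lemma less_two: "i < 2 \<longleftrightarrow> i = 0 \<or> i = Suc (0::nat)"
  by auto

lemma mat4_eqI:
  assumes "A \<in> carrier_mat 4 4"
    and "A $$ (0, 0) = a00" "A $$ (0, Suc 0) = a01" "A $$ (0, 2) = a02" "A $$ (0, 3) = a03"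
    and "A $$ (Suc 0, 0) = a10" "A $$ (Suc 0, Suc 0) = a11" "A $$ (Suc 0, 2) = a12" "A $$ (Suc 0, 3) = a13"
    and "A $$ (2, 0) = a20" "A $$ (2, Suc 0) = a21" "A $$ (2, 2) = a22" "A $$ (2, 3) = a23"
    and "A $$ (3, 0) = a30" "A $$ (3, Suc 0) = a31" "A $$ (3, 2) = a32" "A $$ (3, 3) = a33"
  shows "A = mat4 a00 a01 a02 a03 a10 a11 a12 a13 a20 a21 a22 a23 a30 a31 a32 a33"
  using assms by (intro eq_matI) (auto simp: less_four)

lemma mat2_eqI:
  assumes "A \<in> carrier_mat 2 2"
    and "A $$ (0, 0) = a" "A $$ (0, Suc 0) = b" "A $$ (Suc 0, 0) = c" "A $$ (Suc 0, Suc 0) = d"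
  shows "A = mat2 a b c d"
  using assms by (intro eq_matI) (auto simp: less_two)

lemma mat4_cases:
  assumes "A \<in> carrier_mat 4 4"
  obtains a00 a01 a02 a03 a10 a11 a12 a13 a20 a21 a22 a23 a30 a31 a32 a33 where "A = mat4 a00 a01 a02 a03 a10 a11 a12 a13 a20 a21 a22 a23
    a30 a31 a32 a33"
  using mat4_eqI[OF assms refl refl refl refl refl refl refl refl refl refl refl refl refl refl refl refl] by blast

lemma mat2_cases:
  assumes "A \<in> carrier_mat 2 2"
  obtains a b c d where "A = mat2 a b c d"
  using mat2_eqI[OF assms refl refl refl refl] by blast

lemma mat4_eq_iff [simp]:
  "mat4 a00 a01 a02 a03 a10 a11 a12 a13 a20 a21 a22 a23 a30 a31 a32 a33 = mat4 b00 b01 b02 b03 b10 b11 b12 b13 b20 b21 b22 b23 b30 b31 b32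
    b33 \<longleftrightarrow>
   a00 = b00 \<and> a01 = b01 \<and> a02 = b02 \<and> a03 = b03 \<and> a10 = b10 \<and> a11 = b11 \<and> a12 = b12 \<and> a13 = b13 \<and>
     a20 = b20 \<and> a21 = b21 \<and> a22 = b22 \<and> a23 = b23 \<and> a30 = b30 \<and> a31 = b31 \<and> a32 = b32 \<and> a33 = b33"
proof
  assume e: "mat4 a00 a01 a02 a03 a10 a11 a12 a13 a20 a21 a22 a23 a30 a31 a32 a33 = mat4 b00 b01 b02 b03 b10 b11 b12 b13 b20 b21 b22 b23 b30
    b31 b32 b33"
  show "a00 = b00 \<and> a01 = b01 \<and> a02 = b02 \<and> a03 = b03 \<and> a10 = b10 \<and> a11 = b11 \<and> a12 = b12 \<and> a13 = b13
    \<and> a20 = b20 \<and> a21 = b21 \<and> a22 = b22 \<and> a23 = b23 \<and> a30 = b30 \<and> a31 = b31 \<and> a32 = b32 \<and> a33 = b33"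
    using arg_cong[OF e, of "\<lambda>M. M $$ (0, 0)"] arg_cong[OF e, of "\<lambda>M. M $$ (0, Suc 0)"] arg_cong[OF e, of "\<lambda>M. M $$ (0, 2)"]
      arg_cong[OF e, of "\<lambda>M. M $$ (0, 3)"]
      arg_cong[OF e, of "\<lambda>M. M $$ (Suc 0, 0)"] arg_cong[OF e, of "\<lambda>M. M $$ (Suc 0, Suc 0)"] arg_cong[OF e, of "\<lambda>M. M
        $$ (Suc 0, 2)"] arg_cong[OF e, of "\<lambda>M. M $$ (Suc 0, 3)"]
      arg_cong[OF e, of "\<lambda>M. M $$ (2, 0)"] arg_cong[OF e, of "\<lambda>M. M $$ (2, Suc 0)"] arg_cong[OF e, of "\<lambda>M. M $$ (2,
        2)"] arg_cong[OF e, of "\<lambda>M. M $$ (2, 3)"]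
      arg_cong[OF e, of "\<lambda>M. M $$ (3, 0)"] arg_cong[OF e, of "\<lambda>M. M $$ (3, Suc 0)"] arg_cong[OF e, of "\<lambda>M. M $$ (3,
        2)"] arg_cong[OF e, of "\<lambda>M. M $$ (3, 3)"]
    by simp
qed simp

lemma mat2_eq_iff [simp]: "mat2 a b c d = mat2 a' b' c' d' \<longleftrightarrow> a = a' \<and> b = b' \<and> c = c' \<and> d = d'"
proof
  assume e: "mat2 a b c d = mat2 a' b' c' d'"
  show "a = a' \<and> b = b' \<and> c = c' \<and> d = d'"
    using arg_cong[OF e, of "\<lambda>M. M $$ (0, 0)"] arg_cong[OF e, of "\<lambda>M. M $$ (0, Suc 0)"]
      arg_cong[OF e, of "\<lambda>M. M $$ (Suc 0, 0)"] arg_cong[OF e, of "\<lambda>M. M $$ (Suc 0, Suc 0)"]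
    by simp
qed simp

lemma sum_4: "(\<Sum>i\<in>{0..<4}. f i) = f 0 + f (Suc 0) + f 2 + (f 3 :: complex)"
proof -
  have "{0..<4} = {0, Suc 0, 2, 3::nat}" by auto
  then show ?thesis by (simp add: add.assoc)
qed

lemma mult_index_4:
  fixes A B :: "complex mat"
  assumes "A \<in> carrier_mat 4 4" "B \<in> carrier_mat 4 4" "i < 4" "j < 4"
  shows "(A * B) $$ (i, j) = A $$ (i, 0) * B $$ (0, j) + A $$ (i, Suc 0) * B $$ (Suc 0, j)
    + A $$ (i, 2) * B $$ (2, j) + A $$ (i, 3) * B $$ (3, j)"
  using assms by (simp add: scalar_prod_def sum_4)

lemma mat4_mult:
  "mat4 a00 a01 a02 a03 a10 a11 a12 a13 a20 a21 a22 a23 a30 a31 a32 a33 *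
   mat4 b00 b01 b02 b03 b10 b11 b12 b13 b20 b21 b22 b23 b30 b31 b32 b33 =
   mat4 (a00*b00 + a01*b10 + a02*b20 + a03*b30) (a00*b01 + a01*b11 + a02*b21 + a03*b31) (a00*b02 + a01*b12 + a02*b22 + a03*b32) (a00*b03 +
     a01*b13 + a02*b23 + a03*b33) (a10*b00 + a11*b10 + a12*b20 + a13*b30) (a10*b01 + a11*b11 + a12*b21 + a13*b31) (a10*b02 + a11*b12 +
     a12*b22 + a13*b32) (a10*b03 + a11*b13 + a12*b23 + a13*b33) (a20*b00 + a21*b10 + a22*b20 + a23*b30) (a20*b01 + a21*b11 + a22*b21 +
     a23*b31) (a20*b02 + a21*b12 + a22*b22 + a23*b32) (a20*b03 + a21*b13 + a22*b23 + a23*b33) (a30*b00 + a31*b10 + a32*b20 + a33*b30)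
     (a30*b01 + a31*b11 + a32*b21 + a33*b31) (a30*b02 + a31*b12 + a32*b22 + a33*b32) (a30*b03 + a31*b13 + a32*b23 + a33*b33)"
  by (rule mat4_eqI[OF mult_carrier_mat[OF mat4_carrier mat4_carrier]])
    (simp_all only: mult_index_4[OF mat4_carrier mat4_carrier] index_less_4 mat4_index)

lemma sum_2: "(\<Sum>i<2. f i) = f 0 + (f (Suc 0) :: complex)"
  by (simp add: numeral_2_eq_2)

lemma mat2_mult: "mat2 a b c d * mat2 a' b' c' d' = mat2 (a*a' + b*c') (a*b' + b*d') (c*a' + d*c') (c*b' + d*d')"
  by (rule mat2_eqI[OF mult_carrier_mat[OF mat2_carrier mat2_carrier]]) (simp_all add: scalar_prod_def atLeast0LessThan sum_2)

lemma kron_mat2: "kron (mat2 a b c d) (mat2 a' b' c' d') =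
   mat4 (a*a') (a*b') (b*a') (b*b') (a*c') (a*d') (b*c') (b*d') (c*a') (c*b') (d*a') (d*b') (c*c') (c*d') (d*c') (d*d')"
  by (rule mat4_eqI[OF kron_carrier[OF mat2_carrier mat2_carrier, simplified]]) (simp_all add: index_kron)

lemma mat4_transpose: "transpose_mat (mat4 a00 a01 a02 a03 a10 a11 a12 a13 a20 a21 a22 a23 a30 a31 a32 a33) =
   mat4 a00 a10 a20 a30 a01 a11 a21 a31 a02 a12 a22 a32 a03 a13 a23 a33"
  by (rule mat4_eqI) simp_all

lemma mat4_uminus: "- mat4 a00 a01 a02 a03 a10 a11 a12 a13 a20 a21 a22 a23 a30 a31 a32 a33 =
   mat4 (- a00) (- a01) (- a02) (- a03) (- a10) (- a11) (- a12) (- a13) (- a20) (- a21) (- a22) (- a23) (- a30) (- a31) (- a32) (- a33)"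
  by (rule mat4_eqI) simp_all

lemma mat4_one: "1\<^sub>m 4 = mat4 1 0 0 0 0 1 0 0 0 0 1 0 0 0 0 1"
  by (rule mat4_eqI) simp_all

lemma mat2_one: "1\<^sub>m 2 = mat2 1 0 0 1"
  by (rule mat2_eqI) simp_all

lemmas mat4_algebra = mat4_mult mat2_mult kron_mat2 mat4_transpose mat4_uminus mat4_one mat2_one

section \<open>The braid relation in coordinates\<close>

lemma sum_8: "(\<Sum>i<8. f i) = (\<Sum>a<2. \<Sum>b<2. \<Sum>c<2. f (4 * a + 2 * b + c))" for f :: "nat \<Rightarrow> complex"
proof -
  have "(\<Sum>i<2 * 4. f (4 * (i div 4) + i mod 4)) = (\<Sum>a<2. \<Sum>d<4. f (4 * a + d))"
    by (rule sum_div_mod)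
  moreover have "(\<Sum>d<2 * 2. f (4 * a + (2 * (d div 2) + d mod 2))) = (\<Sum>b<2. \<Sum>c<2. f (4 * a + (2 * b + c)))" for a
    by (rule sum_div_mod)
  ultimately show ?thesis by (simp add: add.assoc)
qed

lemma bits_div_mod:
  "k < 2 \<Longrightarrow> (4 * i + 2 * j + k) div 2 = 2 * i + (j::nat)" "k < 2 \<Longrightarrow> (4 * i + 2 * j + k) mod 2 = (k::nat)"
  "j < 2 \<Longrightarrow> k < 2 \<Longrightarrow> (4 * i + 2 * j + k) div 4 = (i::nat)" "j < 2 \<Longrightarrow> k < 2 \<Longrightarrow> (4
    * i + 2 * j + k) mod 4 = 2 * j + (k::nat)"
proof -
  have e: "4 * i + 2 * j + k = 4 * i + (2 * j + k)" by simp
  assume k: "k < 2"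
  show "(4 * i + 2 * j + k) div 2 = 2 * i + j" "(4 * i + 2 * j + k) mod 2 = k" using k by arith+
  assume j: "j < 2"
  show "(4 * i + 2 * j + k) div 4 = i" "(4 * i + 2 * j + k) mod 4 = 2 * j + k"
    using j k by (simp_all only: e) simp_all
qed

text \<open>The binary digits of an index are the labels of the three strands; an operator on two
  neighbouring strands is a Kronecker delta on the third.\<close>

lemma kron_left_index:
  assumes "A \<in> carrier_mat 4 4" "i < 2" "j < 2" "k < 2" "a < 2" "b < 2" "c < 2"
  shows "kron A (1\<^sub>m 2) $$ (4 * i + 2 * j + k, 4 * a + 2 * b + c) = (if k = c then A $$ (2 * i + j, 2 * a + b) else 0)"
  using assms by (simp add: index_kron bits_div_mod)

lemma kron_right_index:
  assumes "A \<in> carrier_mat 4 4" "i < 2" "j < 2" "k < 2" "a < 2" "b < 2" "c < 2"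
  shows "kron (1\<^sub>m 2) A $$ (4 * i + 2 * j + k, 4 * a + 2 * b + c) = (if i = a then A $$ (2 * j + k, 2 * b + c) else 0)"
  using assms by (simp add: index_kron bits_div_mod)

lemma mult_index_8:
  fixes A B :: "complex mat"
  assumes "A \<in> carrier_mat 8 8" "B \<in> carrier_mat 8 8" "p < 8" "q < 8"
  shows "(A * B) $$ (p, q) = (\<Sum>a<2. \<Sum>b<2. \<Sum>c<2. A $$ (p, 4 * a + 2 * b + c) * B $$ (4 * a + 2 * b + c, q))"
  using assms by (simp add: scalar_prod_def atLeast0LessThan sum_8)

lemma bits_less_8: "i < 2 \<Longrightarrow> j < 2 \<Longrightarrow> k < 2 \<Longrightarrow> 4 * i + 2 * j + k < (8::nat)"
  by auto

lemma kron_carrier_8: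
  assumes "A \<in> carrier_mat 4 4"
  shows "kron A (1\<^sub>m 2) \<in> carrier_mat 8 8" "kron (1\<^sub>m 2) A \<in> carrier_mat 8 8"
  using kron_carrier[OF assms one_carrier_mat[of 2]] kron_carrier[OF one_carrier_mat[of 2] assms] by simp_all

lemma braid_left_index:
  assumes ABC: "A \<in> carrier_mat 4 4" "B \<in> carrier_mat 4 4" "C \<in> carrier_mat 4 4"
    and bits: "i < 2" "j < 2" "k < 2" "l < 2" "m < 2" "n < 2"
  shows "(kron A (1\<^sub>m 2) * kron (1\<^sub>m 2) B * kron C (1\<^sub>m 2)) $$ (4 * i + 2 * j + k, 4 * l + 2 * m + n) =
    (\<Sum>a<2. \<Sum>b<2. \<Sum>c<2. A $$ (2 * i + j, 2 * a + b) * B $$ (2 * b + k, 2 * c + n) * C $$ (2 * a + c, 2 * l + m))"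
proof -
  note c8 = kron_carrier_8[OF ABC(1)] kron_carrier_8[OF ABC(2)] kron_carrier_8[OF ABC(3)]
  \<comment> \<open>Multiplying in two stages lets the delta of the untouched strand collapse one
    sum at a time.\<close>
  have inner: "(kron A (1\<^sub>m 2) * kron (1\<^sub>m 2) B) $$ (4 * i + 2 * j + k, 4 * a + 2 * c + n') =
      (\<Sum>b<2. A $$ (2 * i + j, 2 * a + b) * B $$ (2 * b + k, 2 * c + n'))"
    if "a < 2" "c < 2" "n' < 2" for a c n'
  proof -
    have "(kron A (1\<^sub>m 2) * kron (1\<^sub>m 2) B) $$ (4 * i + 2 * j + k, 4 * a + 2 * c + n') =
      (\<Sum>a'<2. \<Sum>b<2. \<Sum>k'<2. (if k = k' then A $$ (2 * i + j, 2 * a' + b) else 0) *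
         (if a' = a then B $$ (2 * b + k', 2 * c + n') else 0))"
      unfolding mult_index_8[OF c8(1,4) bits_less_8[OF bits(1-3)] bits_less_8[OF that]]
      using bits that by (intro sum.cong refl) (simp add: kron_left_index[OF ABC(1)] kron_right_index[OF ABC(2)])
    also have "\<dots> = (\<Sum>b<2. A $$ (2 * i + j, 2 * a + b) * B $$ (2 * b + k, 2 * c + n'))"
      using bits(3) that(1) unfolding less_two by (elim disjE) (simp_all add: sum_2 numeral_2_eq_2[symmetric])
    finally show ?thesis .
  qed
  have "(kron A (1\<^sub>m 2) * kron (1\<^sub>m 2) B * kron C (1\<^sub>m 2)) $$ (4 * i + 2 * j + k, 4 * l + 2 * m + n) =
      (\<Sum>a<2. \<Sum>c<2. \<Sum>n'<2. (\<Sum>b<2. A $$ (2 * i + j, 2 * a + b) * B $$ (2 * b + k, 2 * c + n')) *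
         (if n' = n then C $$ (2 * a + c, 2 * l + m) else 0))"
    unfolding mult_index_8[OF mult_carrier_mat[OF c8(1,4)] c8(5) bits_less_8[OF bits(1-3)] bits_less_8[OF bits(4-6)]]
    using bits by (intro sum.cong refl) (simp add: inner kron_left_index[OF ABC(3)])
  also have "\<dots> = (\<Sum>a<2. \<Sum>b<2. \<Sum>c<2. A $$ (2 * i + j, 2 * a + b) * B $$ (2 * b + k, 2 * c + n) * C $$ (2 * a + c, 2 * l + m))"
    using bits(6) unfolding less_two by (elim disjE) (simp_all add: sum_2 numeral_2_eq_2[symmetric] algebra_simps)
  finally show ?thesis .
qed

lemma braid_right_index:
  assumes ABC: "A \<in> carrier_mat 4 4" "B \<in> carrier_mat 4 4" "C \<in> carrier_mat 4 4"
    and bits: "i < 2" "j < 2" "k < 2" "l < 2" "m < 2" "n < 2"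
  shows "(kron (1\<^sub>m 2) C * kron B (1\<^sub>m 2) * kron (1\<^sub>m 2) A) $$ (4 * i + 2 * j + k, 4 * l + 2 * m + n) =
    (\<Sum>a<2. \<Sum>b<2. \<Sum>c<2. C $$ (2 * j + k, 2 * a + b) * B $$ (2 * i + a, 2 * l + c) * A $$ (2 * c + b, 2 * m + n))"
proof -
  note c8 = kron_carrier_8[OF ABC(1)] kron_carrier_8[OF ABC(2)] kron_carrier_8[OF ABC(3)]
  have inner: "(kron (1\<^sub>m 2) C * kron B (1\<^sub>m 2)) $$ (4 * i + 2 * j + k, 4 * l' + 2 * c + b) =
      (\<Sum>a<2. C $$ (2 * j + k, 2 * a + b) * B $$ (2 * i + a, 2 * l' + c))"
    if "l' < 2" "c < 2" "b < 2" for l' c b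
  proof -
    have "(kron (1\<^sub>m 2) C * kron B (1\<^sub>m 2)) $$ (4 * i + 2 * j + k, 4 * l' + 2 * c + b) =
      (\<Sum>i'<2. \<Sum>a<2. \<Sum>b'<2. (if i = i' then C $$ (2 * j + k, 2 * a + b') else 0) *
         (if b' = b then B $$ (2 * i' + a, 2 * l' + c) else 0))"
      unfolding mult_index_8[OF c8(6,3) bits_less_8[OF bits(1-3)] bits_less_8[OF that]]
      using bits that by (intro sum.cong refl) (simp add: kron_left_index[OF ABC(2)] kron_right_index[OF ABC(3)])
    also have "\<dots> = (\<Sum>a<2. C $$ (2 * j + k, 2 * a + b) * B $$ (2 * i + a, 2 * l' + c))"
      using bits(1) that(3) unfolding less_two by (elim disjE) (simp_all add: sum_2 numeral_2_eq_2[symmetric])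
    finally show ?thesis .
  qed
  have "(kron (1\<^sub>m 2) C * kron B (1\<^sub>m 2) * kron (1\<^sub>m 2) A) $$ (4 * i + 2 * j + k, 4 * l + 2 * m + n) =
      (\<Sum>l'<2. \<Sum>c<2. \<Sum>b<2. (\<Sum>a<2. C $$ (2 * j + k, 2 * a + b) * B $$ (2 * i + a, 2 * l' + c)) *
         (if l' = l then A $$ (2 * c + b, 2 * m + n) else 0))"
    unfolding mult_index_8[OF mult_carrier_mat[OF c8(6,3)] c8(2) bits_less_8[OF bits(1-3)] bits_less_8[OF bits(4-6)]]
    using bits by (intro sum.cong refl) (simp add: inner kron_right_index[OF ABC(1)])
  also have "\<dots> = (\<Sum>a<2. \<Sum>b<2. \<Sum>c<2. C $$ (2 * j + k, 2 * a + b) * B $$ (2 * i + a, 2 * l + c) * A $$ (2 * c + b, 2 * m + n))"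
    using bits(4) unfolding less_two by (elim disjE) (simp_all add: sum_2 numeral_2_eq_2[symmetric] algebra_simps)
  finally show ?thesis .
qed

text \<open>One of the 64 scalar equations, with row labels \<open>i j k\<close> and column labels
  \<open>l m n\<close>. Few terms survive for the sparse matrices below, so single useful entries
  can be picked by hand.\<close>

definition ybe_at where
  "ybe_at A B C i j k l m n \<longleftrightarrow>
    (\<Sum>a<2. \<Sum>b<2. \<Sum>c<2. A $$ (2 * i + j, 2 * a + b) * B $$ (2 * b + k, 2 * c + n) * C $$ (2 * a + c, 2 * l + m)) =
    (\<Sum>a<2. \<Sum>b<2. \<Sum>c<2. C $$ (2 * j + k, 2 * a + b) * B $$ (2 * i + a, 2 * l + c) * (A $$ (2 * c + b, 2 * m + n) :: complex))"
  for A B C :: "complex mat" and i j k l m n :: nat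

lemma bits_of_8: "p < 8 \<Longrightarrow> \<exists>i j k. p = 4 * i + 2 * j + k \<and> i < 2 \<and> j < 2 \<and> k < (2::nat)"
proof (intro exI conjI)
  show "p = 4 * (p div 4) + 2 * (p mod 4 div 2) + p mod 4 mod 2"
    by (metis mult_div_mod_eq add.assoc)
  assume "p < 8"
  then show "p div 4 < 2" by simp
  show "p mod 4 div 2 < 2" by (simp add: less_mult_imp_div_less)
qed simp

lemma ybe_2_iff:
  assumes ABC: "A \<in> carrier_mat 4 4" "B \<in> carrier_mat 4 4" "C \<in> carrier_mat 4 4"
  shows "ybe 2 A B C \<longleftrightarrow> (\<forall>i<2. \<forall>j<2. \<forall>k<2. \<forall>l<2. \<forall>m<2. \<forall>n<2. ybe_at A B C
    i j k l m n)"
    (is "_ \<longleftrightarrow> ?all")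
proof
  assume "ybe 2 A B C"
  then show ?all
    unfolding ybe_def ybe_at_def
    using braid_left_index[OF ABC, symmetric] braid_right_index[OF ABC, symmetric] by simp
next
  note c8 = kron_carrier_8[OF ABC(1)] kron_carrier_8[OF ABC(2)] kron_carrier_8[OF ABC(3)]
  assume all: ?all
  show "ybe 2 A B C"
    unfolding ybe_def
  proof (rule eq_matI)
    fix p q
    assume "p < dim_row (kron (1\<^sub>m 2) C * kron B (1\<^sub>m 2) * kron (1\<^sub>m 2) A)"
      "q < dim_col (kron (1\<^sub>m 2) C * kron B (1\<^sub>m 2) * kron (1\<^sub>m 2) A)"
    then have "p < 8" "q < 8" using ABC by auto
    then obtain i j k l m n where pq: "p = 4 * i + 2 * j + k" "q = 4 * l + 2 * m + n"
      and bits: "i < 2" "j < 2" "k < 2" "l < 2" "m < 2" "n < 2"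
      using bits_of_8 by meson
    show "(kron A (1\<^sub>m 2) * kron (1\<^sub>m 2) B * kron C (1\<^sub>m 2)) $$ (p, q) =
        (kron (1\<^sub>m 2) C * kron B (1\<^sub>m 2) * kron (1\<^sub>m 2) A) $$ (p, q)"
      unfolding pq braid_left_index[OF ABC bits] braid_right_index[OF ABC bits]
      using all bits by (simp add: ybe_at_def)
  qed (use ABC in auto)
qed

lemma all_less_2: "(\<forall>i<2. P i) \<longleftrightarrow> P 0 \<and> P (Suc (0::nat))"
  by (auto simp: less_two)

lemma entries_mat4:
  "a_glue p = mat4 1 0 0 p  0 0 1 0  0 1 0 0  0 0 0 (-1)"
  "f_glue p q = mat4 1 (-p) p (p * q)  0 0 1 q  0 1 0 (-q)  0 0 0 1"
  "slash p e = mat4 1 0 0 0  0 0 p 0  0 (1/p) 0 0  0 0 0 e"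
  "a_glue_sgn e s = mat4 1 0 0 s  0 0 e 0  0 e 0 0  0 0 0 (-1)"
  "anti_slash_gen s e = mat4 0 0 0 s  0 e 0 0  0 0 e 0  (1/s) 0 0 0"
  "anti_slash = mat4 0 0 0 1  0 1 0 0  0 0 1 0  1 0 0 0"
  "flip = mat4 1 0 0 0  0 0 1 0  0 1 0 0  0 0 0 1"
  "antidiag = mat4 0 0 0 1  0 0 1 0  0 1 0 0  1 0 0 0"
  "anti_slash_S_a e x z = mat4 z (-x) x (-e - z)  x (-e - z) z (-x)  (-x) z (-e - z) x  (-e - z) x (-x) z"
  "anti_slash_S_b e r y = mat4 r (-y + e) y (-r)  y (-r) r (-y + e)  (-y + e) r (-r) y  (-r) y (-y + e) r"
  "anti_slash_S_c e r y = mat4 (-r) y y (-r - e)  (-y) (r + e) r (-y)  (-y) r (r + e) (-y)  (-r - e) y y (-r)"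
  by (simp_all add: a_glue_def f_glue_def slash_def a_glue_sgn_def anti_slash_gen_def anti_slash_def
      flip_def antidiag_def anti_slash_S_a_def anti_slash_S_b_def anti_slash_S_c_def mat4_of_rows)

section \<open>The listed families satisfy the braid relations\<close>

lemmas ybe_2_mat4 = ybe_2_iff[OF mat4_carrier mat4_carrier mat4_carrier]
lemmas ybe_expand = ybe_at_def all_less_2 sum_2 numeral_2_eq_2[symmetric]

lemma ybe_slash:
  "p \<noteq> 0 \<Longrightarrow> q \<noteq> 0 \<Longrightarrow> r \<noteq> 0 \<Longrightarrow> ybe 2 (slash p e) (slash q f) (slash r g)"
  by (simp add: entries_mat4 ybe_2_mat4 ybe_expand)

lemma ybe_a_glue_sgn:
  "e\<^sup>2 = 1 \<Longrightarrow> ybe 2 (a_glue_sgn e p) (a_glue_sgn e q) (a_glue_sgn e r)"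
  by (simp add: entries_mat4 ybe_2_mat4 ybe_expand power2_eq_square)

lemma ybe_f_glue_neg:
  "ybe 2 (f_glue (- p) p) (f_glue (- q) q) (f_glue (- r) r)"
  by (simp add: entries_mat4 ybe_2_mat4 ybe_expand algebra_simps)

lemma ybe_f_glue: "ybe 2 (f_glue p q) (f_glue p q) (f_glue p q)"
  by (simp add: entries_mat4 ybe_2_mat4 ybe_expand algebra_simps)

lemma ybe_anti_slash_gen:
  assumes "s \<noteq> 0" "e\<^sup>2 = 1"
  shows "ybe 2 (slash (-1) 1) (slash (-1) 1) (anti_slash_gen s e)"
    and "ybe 2 (slash (-1) 1) (anti_slash_gen s e) (anti_slash_gen s e)"
    and "ybe 2 (anti_slash_gen s e) (anti_slash_gen s e) (anti_slash_gen s e)"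
  using assms by (simp_all add: entries_mat4 ybe_2_mat4 ybe_expand power2_eq_square)

lemma square_one:
  "p \<noteq> 0 \<Longrightarrow> e\<^sup>2 = 1 \<Longrightarrow> slash p e * slash p e = 1\<^sub>m 4"
  "e\<^sup>2 = 1 \<Longrightarrow> a_glue_sgn e p * a_glue_sgn e p = 1\<^sub>m 4"
  "f_glue p q * f_glue p q = 1\<^sub>m 4"
  "p \<noteq> 0 \<Longrightarrow> e\<^sup>2 = 1 \<Longrightarrow> anti_slash_gen p e * anti_slash_gen p e = 1\<^sub>m 4"
  by (simp_all add: entries_mat4 mat4_algebra power2_eq_square)

lemma ybe_atD:
  "ybe 2 A B C \<Longrightarrow> A \<in> carrier_mat 4 4 \<Longrightarrow> B \<in> carrier_mat 4 4 \<Longrightarrow> C \<in> carrier_mat 4 4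
    \<Longrightarrow>
   i < 2 \<Longrightarrow> j < 2 \<Longrightarrow> k < 2 \<Longrightarrow> l < 2 \<Longrightarrow> m < 2 \<Longrightarrow> n < 2
     \<Longrightarrow> ybe_at A B C i j k l m n"
  by (simp add: ybe_2_iff)

lemmas entries_carrier = entries_mat4[THEN arg_cong[where f = "\<lambda>M. M \<in> carrier_mat 4 4"], simplified]

section \<open>Solving for S\<close>

lemma uminus_eq_one_cases: "x * x = 1 \<Longrightarrow> x = 1 \<or> x = (-1 :: complex)"
  by (simp add: square_eq_1_iff)

text \<open>As p is nonzero, the linear relation \<open>M\<close> removes every entry outside the
  glue pattern except the middle diagonal. That goes by the quadratic entry
  \<open>s11 * s22 = 0\<close> together with S * S = 1, while the corner \<open>s03\<close> stays
  free.\<close>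

lemma solve_a_glue:
  assumes p: "p \<noteq> 0" and S: "S \<in> carrier_mat 4 4"
    and M: "ybe 2 (a_glue p) (a_glue p) S" and N: "ybe 2 (a_glue p) S S" and I: "S * S = 1\<^sub>m 4"
  shows "S \<in> up_to_sign S_a_glue"
proof -
  obtain s00 s01 s02 s03 s10 s11 s12 s13 s20 s21 s22 s23 s30 s31 s32 s33 where S: "S = mat4 s00 s01 s02 s03 s10 s11 s12 s13 s20 s21 s22 s23
    s30 s31 s32 s33" using mat4_cases[OF S] .
  note m = ybe_atD[OF M[unfolded S entries_mat4]] and n = ybe_atD[OF N[unfolded S entries_mat4]]
  have z: "s01 = 0" "s02 = 0" "s10 = 0" "s13 = 0" "s20 = 0" "s23 = 0" "s31 = 0" "s32 = 0" "s30 = 0"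
    using m[of 1 0 0 0 1 1] m[of 1 0 0 1 0 1] m[of 1 0 1 0 0 1] m[of 1 0 1 1 1 1] m[of 1 1 0 0 0 1] m[of 1 1 0 1 1 1] m[of 1 1 1 0 1 1] m[of
      1 1 1 1 0 1] m[of 0 0 1 0 0 1] p
    by (simp_all add: ybe_expand)
  have "s11 * s22 = 0" "p * (s21 - (s00 - s11)) = 0" "p * (s12 - (s00 - s22)) = 0" "p * (s33 - (s11 - s12)) = 0"
    using n[of 0 1 0 0 0 1] m[of 0 0 0 0 1 1] m[of 0 0 0 1 0 1] m[of 0 0 1 1 1 1]
    by (simp_all add: ybe_expand z algebra_simps)
  then have "s11 * s22 = 0" "s21 = s00 - s11" "s12 = s00 - s22" "s33 = s11 - s12" using p by simp_all
  moreover have "s11 * s11 + s12 * s21 = 1" "s12 * s21 + s22 * s22 = 1" "s00 * s00 = 1"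
    using I by (simp_all add: S z mat4_algebra algebra_simps)
  ultimately have e: "s11 = 0" "s22 = 0" "s21 = s00" "s12 = s00" "s33 = - s00" "s00 * s00 = 1"
    by auto
  have "S = a_glue s03 \<or> S = - a_glue (- s03)"
    using uminus_eq_one_cases[OF e(6)] by (auto simp: S z e entries_mat4 mat4_uminus)
  then show ?thesis by (auto simp: up_to_sign_def S_a_glue_def)
qed

lemma up_to_signI: "x \<in> X \<Longrightarrow> x \<in> up_to_sign X" "x \<in> X \<Longrightarrow> - x \<in> up_to_sign X"
  by (auto simp: up_to_sign_def)

text \<open>If a = -1, extracting a global sign negates the slash parameter and the last entry,
  which keeps the shape.\<close>

lemma up_to_sign_slash:
  assumes "a * a = 1" "b * b = 1" "c * d = (1::complex)" and X: "\<And>s e. s \<noteq> 0 \<Longrightarrow> e \<in> {1, -1} \<Longrightarrow>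
    slash s e \<in> X"
  shows "mat4 a 0 0 0 0 0 c 0 0 d 0 0 0 0 0 b \<in> up_to_sign X"
proof -
  have c: "c \<noteq> 0" "d = 1 / c" using assms(3) by (auto simp: eq_divide_eq mult.commute)
  have ab: "a = 1 \<or> a = -1" "b = 1 \<or> b = -1" using assms(1,2) uminus_eq_one_cases by auto
  then have "mat4 a 0 0 0 0 0 c 0 0 d 0 0 0 0 0 b = slash c b \<or>
      mat4 a 0 0 0 0 0 c 0 0 d 0 0 0 0 0 b = - slash (- c) (- b)"
    using c by (auto simp: entries_mat4 mat4_uminus)
  then show ?thesis
    using X[of c b] X[of "- c" "- b"] c ab by (auto simp: up_to_sign_def)
qed

text \<open>The linear relation multiplies the corners \<open>s03\<close> and \<open>s30\<close> by
  1 - p^2 up to sign, so the hypothesis on p excludes the glue and antidiagonal solutions.\<close>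

lemma solve_slash:
  assumes p: "p \<noteq> 0" "p\<^sup>2 \<noteq> 1" and S: "S \<in> carrier_mat 4 4"
    and M: "ybe 2 (slash p e) (slash p e) S" and N: "ybe 2 (slash p e) S S" and I: "S * S = 1\<^sub>m 4"
    and X: "\<And>s e. s \<noteq> 0 \<Longrightarrow> e \<in> {1, -1} \<Longrightarrow> slash s e \<in> X"
  shows "S \<in> up_to_sign X"
proof -
  obtain s00 s01 s02 s03 s10 s11 s12 s13 s20 s21 s22 s23 s30 s31 s32 s33 where S: "S = mat4 s00 s01 s02 s03 s10 s11 s12 s13 s20 s21 s22 s23
    s30 s31 s32 s33" using mat4_cases[OF S] .
  note m = ybe_atD[OF M[unfolded S entries_mat4]] and n = ybe_atD[OF N[unfolded S entries_mat4]]
  have p': "p * p \<noteq> 1" "p \<noteq> 1" using p by (auto simp: power2_eq_square)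
  have z: "s01 = 0" "s02 = 0" "s10 = 0" "s20 = 0" "s13 = 0" "s23 = 0" "s31 = 0" "s32 = 0" "s03 = 0" "s30 = 0"
    using m[of 0 0 0 0 1 0] m[of 0 0 0 1 0 0] m[of 0 0 1 0 0 0] m[of 0 1 0 0 0 0] m[of 0 0 1 1 1 0] m[of 0 1 0 1 1 0] m[of 0 1 1 0 1 0] m[of
      0 1 1 1 0 0] m[of 0 0 0 1 1 0] m[of 0 1 1 0 0 0] p p'
    by (auto simp: ybe_expand field_simps)
  have "s11 * s22 = 0"
    using n[of 0 1 0 0 0 1] p by (auto simp: ybe_expand z)
  moreover have i: "s11 * s11 + s12 * s21 = 1" "s12 * s21 + s22 * s22 = 1" "s00 * s00 = 1" "s33 * s33 = 1"
    using I by (simp_all add: S z mat4_algebra algebra_simps)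
  \<comment> \<open>The first two square relations give s11^2 = s22^2, so the vanishing product
    kills both entries.\<close>
  ultimately have e: "s11 = 0" "s22 = 0" "s12 * s21 = 1" by auto
  show ?thesis unfolding S z e(1,2) using i e X by (intro up_to_sign_slash) auto
qed

text \<open>At p = 1 and p = -1 the corners escape the linear relation; the quadratic relation and S
  * S = 1 leave at most one of them nonzero. A surviving \<open>s30\<close> is the reason for the
  transposed solutions.\<close>

lemma solve_a_slash:
  assumes p: "p\<^sup>2 = 1" and S: "S \<in> carrier_mat 4 4"
    and M: "ybe 2 (slash p (-1)) (slash p (-1)) S" and N: "ybe 2 (slash p (-1)) S S" and I: "S * S = 1\<^sub>m 4"
  shows "S \<in> up_to_sign (S_a_slash p \<union> transpose_mat ` S_a_slash p)"
proof -
  obtain s00 s01 s02 s03 s10 s11 s12 s13 s20 s21 s22 s23 s30 s31 s32 s33 where S: "S = mat4 s00 s01 s02 s03 s10 s11 s12 s13 s20 s21 s22 s23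
    s30 s31 s32 s33" using mat4_cases[OF S] .
  note m = ybe_atD[OF M[unfolded S entries_mat4]] and n = ybe_atD[OF N[unfolded S entries_mat4]]
  have p1: "p = 1 \<or> p = -1" using p by (simp add: power2_eq_1_iff)
  \<comment> \<open>The first entry carries the factor 1 - p and the second the factor 1 + p, so
    together they settle both values of p. The next seven zeros also use two entries each.\<close>
  have "s01 = 0" using p1 m[of 0 0 0 0 1 0] m[of 1 0 0 0 1 1] by (auto simp: ybe_expand)
  moreover have "s02 = 0" using p1 m[of 0 0 0 1 0 0] m[of 1 0 0 1 0 1] by (auto simp: ybe_expand)
  moreover have "s10 = 0" using p1 m[of 0 0 1 0 0 0] m[of 1 0 1 0 0 1] by (auto simp: ybe_expand)
  moreover have "s20 = 0" using p1 m[of 0 1 0 0 0 0] m[of 1 1 0 0 0 1] by (auto simp: ybe_expand)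
  moreover have "s13 = 0" using p1 m[of 0 0 1 1 1 0] m[of 1 0 1 1 1 1] by (auto simp: ybe_expand)
  moreover have "s23 = 0" using p1 m[of 0 1 0 1 1 0] m[of 1 1 0 1 1 1] by (auto simp: ybe_expand)
  moreover have "s31 = 0" using p1 m[of 0 1 1 0 1 0] m[of 1 1 1 0 1 1] by (auto simp: ybe_expand)
  moreover have "s32 = 0" using p1 m[of 0 1 1 1 0 0] m[of 1 1 1 1 0 1] by (auto simp: ybe_expand)
  ultimately have z: "s01 = 0" "s02 = 0" "s10 = 0" "s20 = 0" "s13 = 0" "s23 = 0" "s31 = 0" "s32 = 0" by auto
  have "s03 * s11 = 0"
    using p1 n[of 0 0 0 0 1 1] by (auto simp: ybe_expand z algebra_simps)
  moreover have "s22 * s30 = 0"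
    using p1 n[of 1 1 0 0 0 0] by (auto simp: ybe_expand z algebra_simps)
  moreover have "s11 * s22 = s03 * s30"
    using p1 n[of 0 1 0 0 0 1] by (auto simp: ybe_expand z algebra_simps)
  moreover have "s03 * (s12 - p * s00) = 0"
    using p1 n[of 0 0 0 1 0 1] by (auto simp: ybe_expand z algebra_simps)
  moreover have "s03 * (s21 + p * s33) = 0"
    using p1 n[of 0 1 0 1 1 1] by (auto simp: ybe_expand z algebra_simps)
  moreover have "s30 * (s12 - p * s00) = 0"
    using p1 n[of 0 1 1 0 0 0] by (auto simp: ybe_expand z algebra_simps)
  moreover have "s30 * (s21 + p * s33) = 0"
    using p1 n[of 1 1 1 0 0 1] by (auto simp: ybe_expand z algebra_simps neg_eq_iff_add_eq_0)
  ultimately have q: "s03 * s11 = 0" "s22 * s30 = 0" "s11 * s22 = s03 * s30" "s03 * (s12 - p * s00) = 0" "s03 * (s21 + p * s33) = 0" "s30 *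
    (s12 - p * s00) = 0" "s30 * (s21 + p * s33) = 0" by auto
  have i: "s11 * s11 + s12 * s21 = 1" "s12 * s21 + s22 * s22 = 1" "s00 * s00 + s03 * s30 = 1" "s03 * s30 + s33 * s33 = 1"
      "s03 * (s00 + s33) = 0" "s30 * (s00 + s33) = 0"
    using I by (simp_all add: S z mat4_algebra algebra_simps)
  have "s11 = 0" "s22 = 0" using q(1-3) i(1,2) by auto
  then have e: "s11 = 0" "s22 = 0" "s12 * s21 = 1" "s03 * s30 = 0" "s00 * s00 = 1" "s33 * s33 = 1"
    using q i by auto
  consider "s03 = 0" "s30 = 0" | "s03 \<noteq> 0" "s30 = 0" | "s03 = 0" "s30 \<noteq> 0" using e(4) by auto
  then show ?thesis
  proof cases
    case 1
    show ?thesis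
      unfolding S z e(1,2) 1 using e by (intro up_to_sign_slash) (auto simp: S_a_slash_def)
  next
    case 2
    then have f: "s12 = p * s00" "s21 = p * s00" "s33 = - s00" using q i by (auto simp: add_eq_0_iff)
    have "S = a_glue_sgn p s03 \<or> S = - a_glue_sgn p (- s03)"
      using uminus_eq_one_cases[OF e(5)] by (auto simp: S z e 2 f entries_mat4 mat4_uminus)
    then show ?thesis using p by (auto simp: up_to_sign_def S_a_slash_def)
  next
    case 3
    then have f: "s12 = p * s00" "s21 = p * s00" "s33 = - s00" using q i by (auto simp: add_eq_0_iff)
    have "S = transpose_mat (a_glue_sgn p s30) \<or> S = - transpose_mat (a_glue_sgn p (- s30))"
      using uminus_eq_one_cases[OF e(5)] by (auto simp: S z e 3 f entries_mat4 mat4_uminus mat4_transpose)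
    moreover have "transpose_mat (a_glue_sgn p t) \<in> S_a_slash p \<union> transpose_mat ` S_a_slash p" for t
      using p by (auto simp: S_a_slash_def)
    ultimately show ?thesis using up_to_signI by metis
  qed
qed

text \<open>The product of the corners decides: if it is zero the solution is a slash matrix,
  otherwise both corners survive and the outer diagonal vanishes.\<close>

lemma solve_f_slash:
  assumes S: "S \<in> carrier_mat 4 4"
    and M: "ybe 2 (slash (-1) 1) (slash (-1) 1) S" and N: "ybe 2 (slash (-1) 1) S S" and I: "S * S = 1\<^sub>m 4"
  shows "S \<in> up_to_sign (S_f_slash (-1))"
proof -
  obtain s00 s01 s02 s03 s10 s11 s12 s13 s20 s21 s22 s23 s30 s31 s32 s33 where S: "S = mat4 s00 s01 s02 s03 s10 s11 s12 s13 s20 s21 s22 s23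
    s30 s31 s32 s33" using mat4_cases[OF S] .
  note m = ybe_atD[OF M[unfolded S entries_mat4]] and n = ybe_atD[OF N[unfolded S entries_mat4]]
  have z: "s01 = 0" "s02 = 0" "s10 = 0" "s20 = 0" "s13 = 0" "s23 = 0" "s31 = 0" "s32 = 0"
    using m[of 0 0 0 0 1 0] m[of 0 0 0 1 0 0] m[of 0 0 1 0 0 0] m[of 0 1 0 0 0 0] m[of 0 0 1 1 1 0] m[of 0 1 0 1 1 0] m[of 0 1 1 0 1 0] m[of
      0 1 1 1 0 0] by (auto simp: ybe_expand)
  have "s11 * s22 = s03 * s30"
    using n[of 0 1 0 0 0 1] by ((simp add: ybe_expand z algebra_simps; fail) | (simp add: ybe_expand z algebra_simps neg_eq_iff_add_eq_0
      del: mult_eq_0_iff; fail) | (simp add: ybe_expand z del: mult_eq_0_iff, Groebner_Basis.algebra))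
  moreover have "s03 * (s00 + s12) = 0"
    using n[of 0 0 0 1 0 1] by ((simp add: ybe_expand z algebra_simps; fail) | (simp add: ybe_expand z algebra_simps neg_eq_iff_add_eq_0
      del: mult_eq_0_iff; fail) | (simp add: ybe_expand z del: mult_eq_0_iff, Groebner_Basis.algebra))
  moreover have "s30 * (s00 + s12) = 0"
    using n[of 0 1 1 0 0 0] by ((simp add: ybe_expand z algebra_simps; fail) | (simp add: ybe_expand z algebra_simps neg_eq_iff_add_eq_0
      del: mult_eq_0_iff; fail) | (simp add: ybe_expand z del: mult_eq_0_iff, Groebner_Basis.algebra))
  moreover have "s11 * (s00 + s12) = 0"
    using n[of 0 0 1 0 0 1] by ((simp add: ybe_expand z algebra_simps; fail) | (simp add: ybe_expand z algebra_simps neg_eq_iff_add_eq_0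
      del: mult_eq_0_iff; fail) | (simp add: ybe_expand z del: mult_eq_0_iff, Groebner_Basis.algebra))
  moreover have "s03 * (s21 + s33) = 0"
    using n[of 0 1 0 1 1 1] by ((simp add: ybe_expand z algebra_simps; fail) | (simp add: ybe_expand z algebra_simps neg_eq_iff_add_eq_0
      del: mult_eq_0_iff; fail) | (simp add: ybe_expand z del: mult_eq_0_iff, Groebner_Basis.algebra))
  moreover have "s30 * (s21 + s33) = 0"
    using n[of 1 1 1 0 0 1] by ((simp add: ybe_expand z algebra_simps; fail) | (simp add: ybe_expand z algebra_simps neg_eq_iff_add_eq_0
      del: mult_eq_0_iff; fail) | (simp add: ybe_expand z del: mult_eq_0_iff, Groebner_Basis.algebra))
  moreover have "s11 * (s21 + s33) = 0"
    using n[of 0 1 1 0 1 1] by ((simp add: ybe_expand z algebra_simps; fail) | (simp add: ybe_expand z algebra_simps neg_eq_iff_add_eq_0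
      del: mult_eq_0_iff; fail) | (simp add: ybe_expand z del: mult_eq_0_iff, Groebner_Basis.algebra))
  ultimately have q: "s11 * s22 = s03 * s30" "s03 * (s00 + s12) = 0" "s30 * (s00 + s12) = 0" "s11 * (s00 + s12) = 0" "s03 * (s21 + s33) = 0"
    "s30 * (s21 + s33) = 0" "s11 * (s21 + s33) = 0" by blast+
  have i: "s11 * s11 + s12 * s21 = 1" "s12 * s21 + s22 * s22 = 1" "s00 * s00 + s03 * s30 = 1" "s03 * s30 + s33 * s33 = 1"
      "s03 * (s00 + s33) = 0" "s30 * (s00 + s33) = 0" "s12 * (s11 + s22) = 0" "s21 * (s11 + s22) = 0"
    using I by (simp_all add: S z mat4_algebra algebra_simps)
  show ?thesis
  proof (cases "s03 * s30 = 0")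
    case True
    have "s11 = 0" "s22 = 0" using True q(1) i(1,2) by auto
    then have e: "s11 = 0" "s22 = 0" "s12 * s21 = 1" "s00 * s00 = 1" "s33 * s33 = 1" using True i(1-4) by auto
    \<comment> \<open>A single nonzero corner would give
      \<open>s12 * s21 = - (s00 * s00) = -1\<close>, against \<open>e\<close>.\<close>
    have "s03 = 0 \<and> s30 = 0"
    proof (rule ccontr)
      assume "\<not> (s03 = 0 \<and> s30 = 0)"
      then have "s00 + s12 = 0" "s21 + s33 = 0" "s00 + s33 = 0" using q(2,3,5,6) i(5,6) by auto
      then have "s12 = - s00" "s21 = s00" by (auto simp: add_eq_0_iff)
      then show False using e by simp
    qed
    then show ?thesis
      unfolding S z e(1,2) using e by (auto intro!: up_to_sign_slash simp: S_f_slash_def)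
  next
    case False
    then have "s03 \<noteq> 0" "s30 \<noteq> 0" "s11 \<noteq> 0" "s22 \<noteq> 0" using q(1) by auto
    then have "s00 + s12 = 0" "s21 + s33 = 0" "s00 + s33 = 0" using q(2,5) i(5) by auto
    then have f: "s12 = - s00" "s33 = - s00" "s21 = s00" by (auto simp: add_eq_0_iff)
    have "s11 = s22 \<or> s11 = - s22" using i(1,2) by (metis add.commute add_left_cancel square_eq_iff)
    then have "s11 = s22"
    proof
      \<comment> \<open>With this sign two of the square relations add up to 0 = 2.\<close>
      assume "s11 = - s22"
      then have "s03 * s30 = - (s22 * s22)" using q(1) by simp
      then have "s00 * s00 - s22 * s22 = 1" "s22 * s22 - s00 * s00 = 1" using i(2,3) f by simp_all
      then have "(1::complex) + 1 = 0" by (metis diff_add_cancel add_diff_cancel_left' diff_add_eq diff_self add.commute)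
      then show ?thesis by simp
    qed
    then have g: "s11 = s22" "s00 = 0" using i(8) f \<open>s22 \<noteq> 0\<close> by auto
    then have "s03 * s30 = 1" "s22 * s22 = 1" using i(2,3) f by auto
    then have h: "s30 = 1 / s03" "s22 \<in> {1, -1}" using \<open>s03 \<noteq> 0\<close> uminus_eq_one_cases[of s22] by (auto simp:
      eq_divide_eq mult.commute)
    have "S = anti_slash_gen s03 s22" by (simp add: S z f g h entries_mat4)
    then show ?thesis using h \<open>s03 \<noteq> 0\<close> by (auto simp: up_to_sign_def S_f_slash_def)
  qed
qed

lemma solve_f_glue:
  assumes q: "q \<noteq> 0" and S: "S \<in> carrier_mat 4 4"
    and M: "ybe 2 (f_glue p q) (f_glue p q) S" and N: "ybe 2 (f_glue p q) S S" and I: "S * S = 1\<^sub>m 4"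
  shows "S \<in> up_to_sign (S_f_glue p q)"
proof -
  obtain s00 s01 s02 s03 s10 s11 s12 s13 s20 s21 s22 s23 s30 s31 s32 s33 where S: "S = mat4 s00 s01 s02 s03 s10 s11 s12 s13 s20 s21 s22 s23
    s30 s31 s32 s33" using mat4_cases[OF S] .
  note m = ybe_atD[OF M[unfolded S entries_mat4]] and n = ybe_atD[OF N[unfolded S entries_mat4]]
  have z0: "s30 = 0" using m[of 1 0 1 0 0 1] q by (simp add: ybe_expand algebra_simps)
  have "q * (s10 + s20) = 0" "q * (s10 - s31) = 0" "q * (s10 - s32) = 0" "q * (s31 + s32) = 0"
    using m[of 1 0 0 0 0 1] m[of 1 0 1 0 1 1] m[of 1 0 1 1 0 1] m[of 1 1 1 1 1 1]
    by (simp_all add: ybe_expand z0 algebra_simps)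
  then have "s10 + s20 = 0" "s10 = s31" "s10 = s32" "s31 + s32 = 0" using q by simp_all
  then have z: "s30 = 0" "s10 = 0" "s20 = 0" "s31 = 0" "s32 = 0" using z0 by auto
  have "s11 * s22 = 0"
    using n[of 0 1 0 0 0 1] by (auto simp: ybe_expand z)
  moreover have "s11 * s11 + s12 * s21 = 1" "s12 * s21 + s22 * s22 = 1"
    using I by (simp_all add: S z mat4_algebra algebra_simps)
  ultimately have e0: "s11 = 0" "s22 = 0" by auto
  have e: "s12 = s00" "s21 = s00" "s33 = s00"
    using m[of 1 0 0 0 1 1] m[of 1 0 0 1 0 1] m[of 1 0 1 1 1 1] q by (auto simp: ybe_expand z e0)
  have i: "s00 * s00 = 1" "s00 * (s01 + s02) = 0" "s00 * (s13 + s23) = 0" "s00 * (2 * s03) + s01 * s13 + s02 * s23 = 0"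
    using I by (simp_all add: S z e0 e mat4_algebra algebra_simps)
  then have f: "s01 = - s02" "s13 = - s23" by (auto simp: eq_neg_iff_add_eq_0)
  have "2 * (s00 * s03 + s02 * s23) = 0" using i(4) unfolding f by (simp add: algebra_simps)
  then have "s00 * s03 = - (s02 * s23)" by (simp add: add_eq_0_iff2)
  then have "s00 * s00 * s03 = - (s00 * s02 * s23)" by (simp add: mult.assoc)
  then have g: "s03 = - s00 * s02 * s23" using i(1) by simp
  \<comment> \<open>The factor p + q is the origin of the case distinction in the classification: if
    it is nonzero these linear equations determine \<open>s02\<close> and \<open>s23\<close>; if it
    is zero they are void and the quadratic relation takes over.\<close>
  have pq: "(p + q) * (s02 - p * s00) = 0" "(p + q) * (s23 + q * s00) = 0"
    subgoal using m[of 0 0 0 0 1 1, simplified, simplified ybe_expand z e0 e f, simplified] by Groebner_Basis.algebra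
    subgoal using m[of 0 0 1 1 1 1, simplified, simplified ybe_expand z e0 e f, simplified] by Groebner_Basis.algebra
    done
  have S': "S = mat4 s00 (- s02) s02 s03 0 0 s00 (- s23) 0 s00 0 s23 0 0 0 s00"
    by (simp add: S z e0 e f)
  show ?thesis
  proof (cases "p = - q")
    case True
    have "(q * s00 + s02) * (s02 - s23) = 0" "(q * s00 + s23) * (s02 - s23) = 0"
      subgoal using n[of 0 0 0 1 0 1, simplified, simplified ybe_expand z e0 e f True, simplified] by Groebner_Basis.algebra
      subgoal using n[of 0 1 0 1 1 1, simplified, simplified ybe_expand z e0 e f True, simplified] by Groebner_Basis.algebra
      done
    \<comment> \<open>The difference of the two preceding equations.\<close>
    then have "(s02 - s23) * (s02 - s23) = 0" by Groebner_Basis.algebra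
    then have "s02 = s23" by simp
    then have "S = f_glue (- (- s23)) (- s23) \<or> S = - f_glue (- s23) s23"
      using uminus_eq_one_cases[OF i(1)] by (auto simp: S' g entries_mat4 mat4_uminus)
    moreover have "f_glue (- s) s \<in> S_f_glue p q" for s using True by (auto simp: S_f_glue_def)
    ultimately show ?thesis by (metis UnCI imageI up_to_sign_def)
  next
    case False
    then have "s02 = p * s00" "s23 = - q * s00" using pq by (auto simp: eq_neg_iff_add_eq_0)
    then have "S = f_glue p q \<or> S = - f_glue p q"
      using uminus_eq_one_cases[OF i(1)] by (auto simp: S' g entries_mat4 mat4_uminus)
    then show ?thesis using False by (auto simp: up_to_sign_def S_f_glue_def)
  qed
qed

lemma solve_one:
  assumes S: "S \<in> carrier_mat 4 4" and M: "ybe 2 (1\<^sub>m 4) (1\<^sub>m 4) S" and I: "S * S = 1\<^sub>m 4"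
  shows "S \<in> S_identity"
proof -
  obtain s00 s01 s02 s03 s10 s11 s12 s13 s20 s21 s22 s23 s30 s31 s32 s33 where S: "S = mat4 s00 s01 s02 s03 s10 s11 s12 s13 s20 s21 s22 s23
    s30 s31 s32 s33" using mat4_cases[OF S] .
  note m = ybe_atD[OF M[unfolded S mat4_one]]
  have "s01 = 0" using m[of 0 0 0 0 0 1] by (simp add: ybe_expand)
  moreover have "s03 = 0" using m[of 0 0 0 0 1 1] by (simp add: ybe_expand)
  moreover have "s10 = 0" using m[of 0 0 1 0 0 0] by (simp add: ybe_expand)
  moreover have "s12 = 0" using m[of 0 0 1 0 1 0] by (simp add: ybe_expand)
  moreover have "s21 = 0" using m[of 0 1 0 0 0 1] by (simp add: ybe_expand)
  moreover have "s23 = 0" using m[of 0 1 0 0 1 1] by (simp add: ybe_expand)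
  moreover have "s30 = 0" using m[of 0 1 1 0 0 0] by (simp add: ybe_expand)
  moreover have "s32 = 0" using m[of 0 1 1 0 1 0] by (simp add: ybe_expand)
  moreover have "s02 = 0" using m[of 0 0 0 1 0 0] by (simp add: ybe_expand)
  moreover have "s13 = 0" using m[of 0 1 0 1 1 0] by (simp add: ybe_expand)
  moreover have "s20 = 0" using m[of 1 0 0 0 0 0] by (simp add: ybe_expand)
  moreover have "s31 = 0" using m[of 1 1 0 0 1 0] by (simp add: ybe_expand)
  moreover have "s11 = s00" using m[of 0 0 1 0 0 1] by (simp add: ybe_expand)
  moreover have "s22 = s11" using m[of 0 1 0 0 1 0] by (simp add: ybe_expand)
  moreover have "s33 = s22" using m[of 1 1 0 1 1 0] by (simp add: ybe_expand)
  ultimately have z: "s01 = 0" "s02 = 0" "s03 = 0" "s10 = 0" "s11 = s00" "s12 = 0" "s13 = 0" "s20 = 0" "s21 = 0" "s22 = s00" "s23 = 0" "s30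
    = 0" "s31 = 0" "s32 = 0" "s33 = s00"
    by simp_all
  have "s00 * s00 = 1" using I by (simp add: S z mat4_algebra)
  then show ?thesis
    using uminus_eq_one_cases[of s00] by (auto simp: S z S_identity_def mat4_one mat4_uminus)
qed

section \<open>Symmetries\<close>

lemma mat_left_cancel:
  fixes A B C :: "complex mat"
  assumes "A \<in> carrier_mat n n" "B \<in> carrier_mat n n" "C \<in> carrier_mat n n" "A * B = 1\<^sub>m n"
  shows "A * (B * C) = C"
  using assms by (metis assoc_mult_mat left_mult_one_mat)

lemma conj_mult:
  fixes P Q A B :: "complex mat"
  assumes "P \<in> carrier_mat n n" "Q \<in> carrier_mat n n" "A \<in> carrier_mat n n" "B \<in> carrier_mat n n"
    and "Q * P = 1\<^sub>m n"
  shows "(P * A * Q) * (P * B * Q) = P * (A * B) * Q"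
proof -
  have "(P * A * Q) * (P * B * Q) = P * (A * (Q * (P * (B * Q))))"
    using assms(1-4) by (simp add: assoc_mult_mat[of _ n n _ n _ n])
  also have "Q * (P * (B * Q)) = B * Q"
    using assms by (intro mat_left_cancel) auto
  finally show ?thesis using assms(1-4) by (simp add: assoc_mult_mat[of _ n n _ n _ n])
qed

text \<open>The untouched strand contributes A * 1 * B = 1, so conjugating on two strands agrees
  with conjugating by the triple Kronecker power on three.\<close>

lemma kron_conj:
  assumes A: "A \<in> carrier_mat 2 2" "B \<in> carrier_mat 2 2" and AB: "A * B = 1\<^sub>m 2" and X: "X \<in> carrier_mat 4 4"
  shows "kron (kron A A * X * kron B B) (1\<^sub>m 2) = kron A (kron A A) * kron X (1\<^sub>m 2) * kron B (kron B B)"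
    and "kron (1\<^sub>m 2) (kron A A * X * kron B B) = kron A (kron A A) * kron (1\<^sub>m 2) X * kron B (kron B B)"
proof -
  have "kron A (kron A A) * kron X (1\<^sub>m 2) * kron B (kron B B) = kron (kron A A * X * kron B B) (A * 1\<^sub>m 2 * B)"
    unfolding kron_assoc[symmetric] using A X by (simp add: kron_mult)
  then show "kron (kron A A * X * kron B B) (1\<^sub>m 2) = kron A (kron A A) * kron X (1\<^sub>m 2) * kron B (kron B B)"
    using A AB by simp
  have "kron A (kron A A) * kron (1\<^sub>m 2) X * kron B (kron B B) = kron (A * 1\<^sub>m 2 * B) (kron A A * X * kron B B)"
    using A X by (simp add: kron_mult)
  then show "kron (1\<^sub>m 2) (kron A A * X * kron B B) = kron A (kron A A) * kron (1\<^sub>m 2) X * kron B (kron B B)"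
    using A AB by simp
qed

lemma kron_square_carrier [intro]: "A \<in> carrier_mat 2 2 \<Longrightarrow> kron A A \<in> carrier_mat 4 4"
  using kron_carrier[of A 2 2 A 2 2] by simp

lemma kron_square_inverse:
  assumes "A \<in> carrier_mat 2 2" "B \<in> carrier_mat 2 2" "A * B = 1\<^sub>m 2"
  shows "kron A A * kron B B = 1\<^sub>m 4"
  using assms by (simp add: kron_mult)

lemma conj_carrier:
  "A \<in> carrier_mat 2 2 \<Longrightarrow> B \<in> carrier_mat 2 2 \<Longrightarrow> X \<in> carrier_mat 4 4 \<Longrightarrow> kron A A *
    X * kron B B \<in> carrier_mat 4 4"
  by (meson kron_square_carrier mult_carrier_mat)

lemma conj_square:
  assumes "A \<in> carrier_mat 2 2" "B \<in> carrier_mat 2 2" "A * B = 1\<^sub>m 2" "B * A = 1\<^sub>m 2"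
    and "X \<in> carrier_mat 4 4" "X * X = 1\<^sub>m 4"
  shows "(kron A A * X * kron B B) * (kron A A * X * kron B B) = 1\<^sub>m 4"
  using assms kron_square_carrier[OF assms(1)] kron_square_carrier[OF assms(2)]
  by (subst conj_mult[of _ 4]) (simp_all add: kron_square_inverse)

lemma ybe_conj:
  assumes A: "A \<in> carrier_mat 2 2" "B \<in> carrier_mat 2 2" and AB: "A * B = 1\<^sub>m 2" "B * A = 1\<^sub>m 2"
    and X: "X \<in> carrier_mat 4 4" "Y \<in> carrier_mat 4 4" "Z \<in> carrier_mat 4 4"
    and "ybe 2 X Y Z"
  shows "ybe 2 (kron A A * X * kron B B) (kron A A * Y * kron B B) (kron A A * Z * kron B B)"
proof -
  let ?P = "kron A (kron A A)" and ?Q = "kron B (kron B B)"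
  have P: "?P \<in> carrier_mat 8 8" "?Q \<in> carrier_mat 8 8"
    using kron_carrier[OF A(1) kron_square_carrier[OF A(1)]] kron_carrier[OF A(2) kron_square_carrier[OF A(2)]] by simp_all
  have QP: "?Q * ?P = 1\<^sub>m 8" using A AB by (simp add: kron_mult)
  have conj3: "(?P * U * ?Q) * (?P * V * ?Q) * (?P * W * ?Q) = ?P * (U * V * W) * ?Q"
    if "U \<in> carrier_mat 8 8" "V \<in> carrier_mat 8 8" "W \<in> carrier_mat 8 8" for U V W
    by (simp only: conj_mult[OF P that(1,2) QP] conj_mult[OF P mult_carrier_mat[OF that(1,2)] that(3) QP])
  note c = kron_carrier_8[OF X(1)] kron_carrier_8[OF X(2)] kron_carrier_8[OF X(3)]
  show ?thesis
    using assms(8) unfolding ybe_def kron_conj[OF A AB(1) X(1)] kron_conj[OF A AB(1) X(2)] kron_conj[OF A AB(1) X(3)]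
      conj3[OF c(1,4,5)] conj3[OF c(6,3,2)] by (rule arg_cong)
qed

text \<open>Each of the three matrices occurs exactly once on either side, so signs cancel
  independently.\<close>

lemma ybe_uminus:
  assumes "X \<in> carrier_mat 4 4" "Y \<in> carrier_mat 4 4" "Z \<in> carrier_mat 4 4"
    and "ybe 2 X Y Z" and "X' = X \<or> X' = - X" "Y' = Y \<or> Y' = - Y" "Z' = Z \<or> Z' = - Z"
  shows "ybe 2 X' Y' Z'"
  using assms(4-) unfolding ybe_def
  by (elim disjE) (use assms(1-3) in \<open>simp_all add: kron_uminus del: assoc_mult_mat\<close>)

text \<open>Inverting both sides of the relation reverses the order of the factors, and the factors
  are involutions.\<close>

lemma ybe_swap:
  assumes X: "X \<in> carrier_mat 4 4" "Y \<in> carrier_mat 4 4" "Z \<in> carrier_mat 4 4"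
    and sq: "X * X = 1\<^sub>m 4" "Y * Y = 1\<^sub>m 4" "Z * Z = 1\<^sub>m 4" and "ybe 2 X Y Z"
  shows "ybe 2 Z Y X"
proof -
  note c = kron_carrier_8[OF X(1)] kron_carrier_8[OF X(2)] kron_carrier_8[OF X(3)]
  have k: "kron U (1\<^sub>m 2) * kron U (1\<^sub>m 2) = 1\<^sub>m 8" "kron (1\<^sub>m 2) U * kron (1\<^sub>m 2) U = 1\<^sub>m 8"
    if "U \<in> carrier_mat 4 4" "U * U = 1\<^sub>m 4" for U
    using that by (simp_all add: kron_mult)
  have inv: "(U * V * W) * (W * V * U) = 1\<^sub>m 8"
    if "U \<in> carrier_mat 8 8" "V \<in> carrier_mat 8 8" "W \<in> carrier_mat 8 8"
      "U * U = 1\<^sub>m 8" "V * V = 1\<^sub>m 8" "W * W = 1\<^sub>m 8" for U V W :: "complex mat"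
  proof -
    have "(U * V * W) * (W * V * U) = U * (V * (W * (W * (V * U))))"
      using that(1-3) by (simp add: assoc_mult_mat[of _ 8 8 _ 8 _ 8])
    also have "W * (W * (V * U)) = V * U" using that by (intro mat_left_cancel) auto
    also have "V * (V * U) = U" using that by (intro mat_left_cancel) auto
    finally show ?thesis using that by simp
  qed
  let ?l = "kron X (1\<^sub>m 2) * kron (1\<^sub>m 2) Y * kron Z (1\<^sub>m 2)" and ?l' = "kron Z (1\<^sub>m 2) * kron (1\<^sub>m 2) Y *
    kron X (1\<^sub>m 2)"
  let ?r' = "kron (1\<^sub>m 2) X * kron Y (1\<^sub>m 2) * kron (1\<^sub>m 2) Z"
  have c': "?l \<in> carrier_mat 8 8" "?l' \<in> carrier_mat 8 8" "?r' \<in> carrier_mat 8 8"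
    using c by auto
  have 1: "?l' * ?l = 1\<^sub>m 8" using inv[OF c(5,4,1) k(1)[OF X(3) sq(3)] k(2)[OF X(2) sq(2)] k(1)[OF X(1) sq(1)]] .
  have "?l * ?r' = 1\<^sub>m 8"
    using inv[OF c(6,3,2) k(2)[OF X(3) sq(3)] k(1)[OF X(2) sq(2)] k(2)[OF X(1) sq(1)]] assms(7)
    unfolding ybe_def by simp
  then have "?l' = ?r'"
    using mat_left_cancel[OF c'(2,1,3) 1] c' by (metis right_mult_one_mat)
  then show ?thesis unfolding ybe_def .
qed

lemma ybe_transpose:
  assumes X: "X \<in> carrier_mat 4 4" "Y \<in> carrier_mat 4 4" "Z \<in> carrier_mat 4 4" and "ybe 2 X Y Z"
  shows "ybe 2 (transpose_mat Z) (transpose_mat Y) (transpose_mat X)"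
proof -
  note c = kron_carrier_8[OF X(1)] kron_carrier_8[OF X(2)] kron_carrier_8[OF X(3)]
  have t: "transpose_mat (U * V * W) = transpose_mat W * transpose_mat V * transpose_mat U"
    if "U \<in> carrier_mat 8 8" "V \<in> carrier_mat 8 8" "W \<in> carrier_mat 8 8" for U V W :: "complex mat"
    using that by (simp add: transpose_mult[of _ 8 8 _ 8] assoc_mult_mat[of _ 8 8 _ 8 _ 8])
  show ?thesis
    using arg_cong[OF assms(4)[unfolded ybe_def], of transpose_mat]
    unfolding ybe_def t[OF c(1,4,5)] t[OF c(6,3,2)] by (simp add: transpose_kron)
qed

lemma md_pair_2:
  "md_pair 2 R S \<longleftrightarrow> R \<in> carrier_mat 4 4 \<and> S \<in> carrier_mat 4 4 \<and> R * R = 1\<^sub>m 4 \<and> S * S =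
    1\<^sub>m 4 \<and>
     ybe 2 R R R \<and> ybe 2 R R S \<and> ybe 2 R S S \<and> ybe 2 S S S"
  by (simp add: md_pair_def)

lemma md_pair_conj:
  assumes "A \<in> carrier_mat 2 2" "B \<in> carrier_mat 2 2" "A * B = 1\<^sub>m 2" "B * A = 1\<^sub>m 2" and "md_pair 2 R S"
  shows "md_pair 2 (kron A A * R * kron B B) (kron A A * S * kron B B)"
  using assms by (simp add: md_pair_2 conj_carrier conj_square ybe_conj del: assoc_mult_mat)

text \<open>Transposition turns RRS into SRR and RSS into SSR; \<open>ybe_swap\<close> restores the
  order. This is where the involution property enters.\<close>

lemma md_pair_transpose:
  assumes "md_pair 2 R S" shows "md_pair 2 (transpose_mat R) (transpose_mat S)"
proof -
  have sq: "transpose_mat X * transpose_mat X = 1\<^sub>m 4" if "X \<in> carrier_mat 4 4" "X * X = 1\<^sub>m 4" for X :: "complex mat"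
    using transpose_mult[OF that(1,1)] that(2) by (metis transpose_one)
  show ?thesis
    using assms by (auto simp: md_pair_2 sq intro!: ybe_transpose intro: ybe_swap)
qed

lemma md_pair_sign:
  assumes "md_pair 2 R S" "R' = R \<or> R' = - R" "S' = S \<or> S' = - S"
  shows "md_pair 2 R' S'"
  using assms ybe_uminus[of R R R R' R' R'] ybe_uminus[of R R S R' R' S'] ybe_uminus[of R S S R' S' S']
    ybe_uminus[of S S S S' S' S'] by (auto simp: md_pair_2)

text \<open>Indices of the form \<open>of_bool\<close> need no bound checks, and unfolding by
  \<open>ybe_raw\<close> alone hands the entry over as an unrearranged polynomial equation.\<close>

lemma ybe_atB:
  "ybe 2 A B C \<Longrightarrow> A \<in> carrier_mat 4 4 \<Longrightarrow> B \<in> carrier_mat 4 4 \<Longrightarrow> C \<in> carrier_mat 4 4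
    \<Longrightarrow>
   ybe_at A B C (of_bool i) (of_bool j) (of_bool k) (of_bool l) (of_bool m) (of_bool n)"
  by (rule ybe_atD) auto

lemma bit_index: "2 * 0 + 0 = (0::nat)" "2 * 0 + Suc 0 = Suc 0" "2 * Suc 0 + 0 = 2" "2 * Suc 0 + Suc 0 = 3"
  by simp_all

lemmas ybe_raw = ybe_at_def sum_2 of_bool_eq One_nat_def bit_index mat4_index

section \<open>Involutive braidings in dimension two\<close>

text \<open>The matrix is the general involution that fixes e0 \<otimes> e1 and induces on the
  quotient the reflection 2 u v^T - 1 with u = (1, u2, u3). The first coordinate of v comes from the
  normalisation u . v = 1, and the entry below the upper left corner from R * R = 1. After several
  quantities are shown to be nonzero, the remaining entries factor.\<close>

lemma no_mixed_fixed_vector: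
  assumes "ybe 2 R R R" and R: "R = mat4 (2 * (1 - u2*v2 - u3*v3) - 1) 0 (2 * v2) (2 * v3)  (- g*u2 - h*u3) 1 g h
      (2 * u2 * (1 - u2*v2 - u3*v3)) 0 (2 * u2 * v2 - 1) (2 * u2 * v3)  (2 * u3 * (1 - u2*v2 - u3*v3)) 0 (2 * u3 * v2) (2 * u3 * v3 - 1)"
  shows False
proof -
  note y = ybe_atB[OF assms(1)[unfolded R] mat4_carrier mat4_carrier mat4_carrier]
  (* pijklmn is the entry of the braid relation in row ijk and column lmn, written in binary. *)
  have p001011: "- 4*g*u2*u3*v3^2 - 4*g*u2^2*v2*v3 - 4*h*u2*u3*v2*v3 - 4*h*u3^2*v3^2 + 2*g*h*u3*v3 + g*h^2*u2 + 2*g^2*u2*v3 + h^3*u3 + h = 0"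
    using y[of False False True False True True] by (simp only: ybe_raw) Groebner_Basis.algebra
  have p001010: "- 4*g*u2*u3*v2*v3 - 4*g*u2^2*v2^2 - 4*h*u2*u3*v2^2 - 4*h*u3^2*v2*v3 + 2*g*h*u3*v2 + g*h^2*u3 + g^2*h*u2 + 2*g^2*u2*v2 + g = 0"
    using y[of False False True False True False] by (simp only: ybe_raw) Groebner_Basis.algebra
  have p011101: "4*h*u3^2*v2*v3 + 2*g*h*u3*v2 - g*h^2*u3 - g^2*h*u2 - 4*h*u3*v2 - g = 0"
    using y[of False True True True False True] by (simp only: ybe_raw) Groebner_Basis.algebra
  have p010010: "- 8*u2*u3^2*v2*v3^2 - 16*u2^2*u3*v2^2*v3 - 8*u2^3*v2^3 + 2*g*h*u2*u3*v3 + 4*g*u2^2*v2^2 + 2*g^2*u2^2*v3 + 4*h*u2*u3*v2^2 +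
    8*u2*u3*v2*v3 + 8*u2^2*v2^2 - 4*g*u2*v2 - 4*h*u3*v2 + 2*u2*v2 - 2 = 0"
    using y[of False True False False True False] by (simp only: ybe_raw) Groebner_Basis.algebra
  have p101101: "8*u2*u3^2*v2*v3^2 - 2*g*h*u2*u3*v3 - 2*g*h*u2^2*v2 + 4*h*u2*u3*v2^2 - 8*u2*u3*v2*v3 + 2*g*h*u2 - 4*h*u3*v2 - 2*u2*v2 + 2 = 0"
    using y[of True False True True False True] by (simp only: ybe_raw) Groebner_Basis.algebra
  have p010001: "- 4*h*u2*u3^2*v3^2 - 4*h*u2^2*u3*v2*v3 + 4*g*h*u2*u3*v3 - 4*g*u2*u3*v2*v3 - 4*g*u3^2*v3^2 + 2*g^2*u2^2*v3 + 2*h^2*u3^2*v3 +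
    4*h*u2*u3*v3 + 4*g*u3*v3 = 0"
    using y[of False True False False False True] by (simp only: ybe_raw) Groebner_Basis.algebra
  have p010101: "4*h*u2*u3*v2*v3 - 2*g*h*u3*v3 + 4*g*u3*v2*v3 - 2*g^2*u2*v3 = 0"
    using y[of False True False True False True] by (simp only: ybe_raw) Groebner_Basis.algebra
  have p101010: "- 4*g*u2^2*u3*v2*v3 - 4*g*u2^3*v2^2 - 4*h*u2*u3^2*v2*v3 - 4*h*u2^2*u3*v2^2 + 2*g*h*u2*u3*v2 + 2*g*h*u3^2*v3 +
    4*g*u2*u3*v2^2 + 4*g*u3^2*v2*v3 + 4*g*u2^2*v2 + 4*h*u2*u3*v2 - 2*g*h*u3 - 4*g*u3*v2 = 0"
    using y[of True False True False True False] by (simp only: ybe_raw) Groebner_Basis.algebra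
  have p101011: "- 4*g*u2^2*u3*v3^2 - 4*g*u2^3*v2*v3 - 4*h*u2*u3^2*v3^2 - 4*h*u2^2*u3*v2*v3 + 4*g*u2*u3*v2*v3 + 4*g*u3^2*v3^2 +
    2*h^2*u2*u3*v2 + 2*h^2*u3^2*v3 + 4*g*u2^2*v3 + 4*h*u2*u3*v3 - 4*g*u3*v3 - 2*h^2*u3 = 0"
    using y[of True False True False True True] by (simp only: ybe_raw) Groebner_Basis.algebra
  have p001101: "8*u3^2*v2*v3^2 - 2*g*h*u2*v2 - 2*g*h*u3*v3 + 4*h*u3*v2^2 - 8*u3*v2*v3 - 2*v2 = 0"
    using y[of False False True True False True] by (simp only: ybe_raw) Groebner_Basis.algebra
  have p001111: "4*g*u2^2*v3^2 + 4*h*u2*u3*v3^2 + 8*u3^2*v3^3 - 2*g*h*u2*v3 + 4*g*u2*v2*v3 + 8*h*u3*v2*v3 - 2*h^2*u2*v2 - 4*h^2*u3*v3 -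
    g*h^2 - 2*g^2*v3 - 16*u3*v3^2 - 4*h*v2 + 2*h^2 + 6*v3 = 0"
    using y[of False False True True True True] by (simp only: ybe_raw) Groebner_Basis.algebra
  have p000010: "- 16*u2*u3*v2^2*v3 - 8*u2^2*v2^3 - 8*u3^2*v2*v3^2 + 2*g*h*u3*v3 + 4*g*u2*v2^2 + 2*g^2*u2*v3 + 4*h*u3*v2^2 + 2*v2 = 0"
    using y[of False False False False True False] by (simp only: ybe_raw) Groebner_Basis.algebra
  have p111011: "- 8*u2*u3^3*v3^3 - 16*u2^2*u3^2*v2*v3^2 - 8*u2^3*u3*v2^2*v3 + 4*h*u2*u3^2*v2*v3 + 4*h*u3^3*v3^2 + 8*u2*u3^2*v2^2*v3 +
    8*u3^3*v2*v3^2 + 16*u2*u3^2*v3^2 + 16*u2^2*u3*v2*v3 - 4*h*u2*u3*v2 - 8*h*u3^2*v3 - 8*u3^2*v2*v3 - 8*u2*u3*v3 + 4*h*u3 = 0"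
    using y[of True True True False True True] by (simp only: ybe_raw) Groebner_Basis.algebra
  have p011011: "- 16*u2*u3^2*v2*v3^2 - 8*u2^2*u3*v2^2*v3 - 8*u3^3*v3^3 + 2*g*h*u2*u3*v3 + 4*g*u2*u3*v2*v3 + 4*h*u3^2*v2*v3 + 2*h^2*u3^2*v3
    + 8*u2*u3*v2*v3 + 8*u3^2*v3^2 - 2*g*h*u2 - 2*h^2*u3 + 2*u3*v3 - 2 = 0"
    using y[of False True True False True True] by (simp only: ybe_raw) Groebner_Basis.algebra
  have p011010: "- 16*u2*u3^2*v2^2*v3 - 8*u2^2*u3*v2^3 - 8*u3^3*v2*v3^2 + 2*g*h*u3^2*v3 + 4*g*u2*u3*v2^2 + 2*g^2*u2*u3*v3 + 4*h*u3^2*v2^2 +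
    8*u2*u3*v2^2 + 8*u3^2*v2*v3 - 2*g*h*u3 - 2*g^2*u2 + 2*u3*v2 = 0"
    using y[of False True True False True False] by (simp only: ybe_raw) Groebner_Basis.algebra
  have u2: "u2 \<noteq> 0"
  proof
    assume "u2 = 0"
    then have "- 4 * h * u3 * v2 - 2 = 0" "- 4 * h * u3 * v2 + 2 = 0" using p010010 p101101 by simp_all
    then have "(4::complex) = 0" by Groebner_Basis.algebra
    then show False by simp
  qed
  \<comment> \<open>Two quadratic equations for X = \<open>u3 * v3\<close> result; their difference
    forces X = 1, which is not a root.\<close>
  have t0: False if "g = 0" "h = 0"
  proof -
    let ?X = "u3 * v3"
    have v2: "v2 \<noteq> 0" using p010010 that by auto
    have "v2 * (8 * ?X * ?X - 8 * ?X - 2) = 0" using p001101 that by Groebner_Basis.algebra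
    then have X: "8 * ?X * ?X - 8 * ?X - 2 = 0" using v2 by simp
    then have "v3 \<noteq> 0" by auto
    moreover have "v3 * (8 * ?X * ?X - 16 * ?X + 6) = 0" using p001111 that by Groebner_Basis.algebra
    ultimately have "8 * ?X * ?X - 16 * ?X + 6 = 0" by simp
    with X have "8 * (?X - 1) = 0" by Groebner_Basis.algebra
    then have "?X = 1" by simp
    with X show False by simp
  qed
  \<comment> \<open>Modulo \<open>g * u2 + h * u3\<close>, which is minus the entry in row 1 and
    column 0, the equations \<open>p001011\<close> and \<open>p001010\<close> reduce to h = 0 and g
    = 0.\<close>
  have E: "g * u2 + h * u3 \<noteq> 0"
  proof
    assume e: "g * u2 + h * u3 = 0"
    have "h = 0" using p001011 e by Groebner_Basis.algebra
    moreover have "g = 0" using p001010 e by Groebner_Basis.algebra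
    ultimately show False using t0 by simp
  qed
  have h: "h \<noteq> 0"
  proof
    assume "h = 0"
    then have "g = 0" using p011101 by Groebner_Basis.algebra
    then show False using t0 \<open>h = 0\<close> by simp
  qed
  have u3: "u3 \<noteq> 0"
  proof
    assume "u3 = 0"
    then have "g * g * u2 = 0" using p011010 by (simp add: power2_eq_square)
    then show False using u2 E \<open>u3 = 0\<close> by simp
  qed
  \<comment> \<open>If v3 vanished, the entries would force \<open>u2 * v2 = 1\<close>,
    \<open>h = - 2 * v2\<close> and g = 2 one after the other, and these values are inconsistent
    with the remaining two equations.\<close>
  have v3: "v3 \<noteq> 0"
  proof
    assume v3: "v3 = 0"
    have "h * u3 * (1 - u2 * v2) = 0" using p111011 v3 by (simp add: algebra_simps)
    then have uv: "u2 * v2 = 1" using h u3 by simp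
    then have v2: "v2 \<noteq> 0" by auto
    have "2 * (g * h * u2 + h * h * u3 + 1) = 0" using p011011 v3 by Groebner_Basis.algebra
    then have 1: "g * h * u2 + h * h * u3 + 1 = 0" unfolding mult_eq_0_iff by simp
    have "h * u3 * v2 * (h + 2 * v2) = 0" using p001101 v3 uv 1 by Groebner_Basis.algebra
    then have h2: "h = - 2 * v2" using h u3 v2 by (simp add: add_eq_0_iff2)
    have "h * h * (g - 2) = 0" using p001111 v3 uv h2 by Groebner_Basis.algebra
    then have g: "g = 2" using h by simp
    have "v2 * (2 - 8 * u3 * v2 * v2) = 0" using p000010 v3 uv h2 g by Groebner_Basis.algebra
    then have "2 - 8 * u3 * v2 * v2 = 0" using v2 by simp
    then have "(4::complex) = 0" using 1 uv unfolding h2 g by Groebner_Basis.algebra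
    then show False by simp
  qed
  \<comment> \<open>This is the first coordinate of v, so
    \<open>?v1 + u2 * v2 + u3 * v3 = 1\<close>.\<close>
  let ?v1 = "1 - u2 * v2 - u3 * v3" and ?E = "g * u2 + h * u3"
  have "?E * v3 * (?E * v2 + g * ?v1) = 0" using p010001 p010101 by Groebner_Basis.algebra
  then have A: "?E * v2 + g * ?v1 = 0" using v3 E by simp
  have "h * u3 * ?v1 * (g * v3 - h * v2) = 0" using p101010 p101011 by Groebner_Basis.algebra
  then consider "?v1 = 0" | "g * v3 - h * v2 = 0" using h u3 by auto
  then show False
  proof cases
    case 1
    then have "v2 = 0" using A E by simp
    moreover from this have "u3 * v3 = 1" using 1 by simp
    ultimately have "(2::complex) = 0" using p101101 by Groebner_Basis.algebra
    then show False by simp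
  next
    case 2
    show False
    proof (cases "v2 = 0")
      case True
      then have "g = 0" using 2 v3 by simp
      then show False using p010010 True by simp
    next
      case False
      have "v2 * (?E * v3 + h * ?v1) = 0" using A 2 by Groebner_Basis.algebra
      then have "?E * v3 + h * ?v1 = 0" using False by simp
      \<comment> \<open>Adding u2 times \<open>A\<close> to u3 times the last equation gives E * (v1
        + u2 * v2 + u3 * v3), which is E itself.\<close>
      then have "?E = 0" using A by Groebner_Basis.algebra
      then show False using E by simp
    qed
  qed
qed

section \<open>Reduction of a single involutive braiding\<close>

definition braiding :: "complex mat \<Rightarrow> bool" where
  "braiding R \<longleftrightarrow> R \<in> carrier_mat 4 4 \<and> R * R = 1\<^sub>m 4 \<and> ybe 2 R R R"

text \<open>The rules run backwards, from a transformed matrix to the original, so that a goal about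
  \<open>R\<close> is replaced by one about a simpler matrix. Only one matrix is moved; the effect
  on the other member of a pair is added later, in two different ways.\<close>

inductive orbit :: "complex mat \<Rightarrow> complex mat \<Rightarrow> bool" for R0 where
  orbit_refl: "orbit R0 R0"
| orbit_conj: "A \<in> carrier_mat 2 2 \<Longrightarrow> B \<in> carrier_mat 2 2 \<Longrightarrow> A * B = 1\<^sub>m 2 \<Longrightarrow> B *
  A = 1\<^sub>m 2 \<Longrightarrow>
    orbit R0 (kron A A * R * kron B B) \<Longrightarrow> R \<in> carrier_mat 4 4 \<Longrightarrow> orbit R0 R"
| orbit_transpose: "orbit R0 (transpose_mat R) \<Longrightarrow> R \<in> carrier_mat 4 4 \<Longrightarrow> orbit R0 R"
| orbit_uminus: "orbit R0 (- R) \<Longrightarrow> R \<in> carrier_mat 4 4 \<Longrightarrow> orbit R0 R"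

text \<open>The anti-slash matrix is reached from \<open>slash (-1) 1\<close>, the flip is
  \<open>slash 1 1\<close>, and \<open>f_glue p 0\<close> is reached from \<open>f_glue 0 p\<close>
  by a transposition and an exchange of the basis vectors.\<close>

definition std_braidings :: "complex mat set" where
  "std_braidings = {1\<^sub>m 4} \<union> {a_glue p | p. p \<noteq> 0} \<union> {f_glue p q | p q. q \<noteq> 0} \<union> {slash p e | p e.
    p \<noteq> 0 \<and> e \<in> {1, -1}}"

definition listed :: "complex mat \<Rightarrow> bool" where
  "listed R \<longleftrightarrow> (\<exists>R0\<in>std_braidings. orbit R0 R)"

lemma listed_std: "R \<in> std_braidings \<Longrightarrow> listed R"
  unfolding listed_def by (rule bexI, rule orbit_refl)

lemma listed_std_forms:
  "listed (1\<^sub>m 4)" "p \<noteq> 0 \<Longrightarrow> listed (a_glue p)" "q \<noteq> 0 \<Longrightarrow> listed (f_glue p q)"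
  "p \<noteq> 0 \<Longrightarrow> listed (slash p 1)" "p \<noteq> 0 \<Longrightarrow> listed (slash p (-1))"
  by (rule listed_std; auto simp: std_braidings_def)+

lemma listed_conj:
  "A \<in> carrier_mat 2 2 \<Longrightarrow> B \<in> carrier_mat 2 2 \<Longrightarrow> A * B = 1\<^sub>m 2 \<Longrightarrow> B * A =
    1\<^sub>m 2 \<Longrightarrow> R \<in> carrier_mat 4 4 \<Longrightarrow>
   listed (kron A A * R * kron B B) \<Longrightarrow> listed R"
  unfolding listed_def by (erule bexE, rule bexI, rule orbit_conj, assumption+)

lemma listed_transpose: "R \<in> carrier_mat 4 4 \<Longrightarrow> listed (transpose_mat R) \<Longrightarrow> listed R"
  unfolding listed_def by (erule bexE, rule bexI, rule orbit_transpose, assumption+)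

lemma listed_uminus: "R \<in> carrier_mat 4 4 \<Longrightarrow> listed (- R) \<Longrightarrow> listed R"
  unfolding listed_def by (erule bexE, rule bexI, rule orbit_uminus, assumption+)

lemma braiding_conj:
  "A \<in> carrier_mat 2 2 \<Longrightarrow> B \<in> carrier_mat 2 2 \<Longrightarrow> A * B = 1\<^sub>m 2 \<Longrightarrow> B * A =
    1\<^sub>m 2 \<Longrightarrow> braiding R \<Longrightarrow>
   braiding (kron A A * R * kron B B)"
  unfolding braiding_def by (simp only: conj_carrier conj_square ybe_conj simp_thms)

lemma braiding_transpose: "braiding R \<Longrightarrow> braiding (transpose_mat R)"
  using md_pair_transpose[of R R] by (simp add: braiding_def md_pair_2)

lemma braiding_uminus: "braiding R \<Longrightarrow> braiding (- R)"
  using md_pair_sign[of R R "- R" "- R"] by (simp add: braiding_def md_pair_2)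

lemma braidingD:
  assumes "braiding R"
  shows "R \<in> carrier_mat 4 4" "R * R = 1\<^sub>m 4"
    "ybe_at R R R (of_bool i) (of_bool j) (of_bool k) (of_bool l) (of_bool m) (of_bool n)"
  using assms ybe_atB[of R R R] by (auto simp: braiding_def)

text \<open>Exchanging e0 and e1 reverses the order of rows and of columns.\<close>

lemma listed_reverse:
  assumes "listed (mat4 a33 a32 a31 a30 a23 a22 a21 a20 a13 a12 a11 a10 a03 a02 a01 a00)"
  shows "listed (mat4 a00 a01 a02 a03 a10 a11 a12 a13 a20 a21 a22 a23 a30 a31 a32 a33)"
  by (rule listed_conj[of "mat2 0 1 1 0" "mat2 0 1 1 0"]) (use assms in \<open>simp_all add: mat4_algebra\<close>)

lemma listed_mat4_transpose: "listed (mat4 a00 a10 a20 a30 a01 a11 a21 a31 a02 a12 a22 a32 a03 a13 a23 a33) \<Longrightarrow> listed (mat4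
  a00 a01 a02 a03 a10 a11 a12 a13 a20 a21 a22 a23 a30 a31 a32 a33)"
  by (rule listed_transpose[OF mat4_carrier]) (simp add: mat4_transpose)

lemma listed_mat4_uminus: "listed (mat4 (- a00) (- a01) (- a02) (- a03) (- a10) (- a11) (- a12) (- a13) (- a20) (- a21) (- a22) (- a23) (-
  a30) (- a31) (- a32) (- a33)) \<Longrightarrow> listed (mat4 a00 a01 a02 a03 a10 a11 a12 a13 a20 a21 a22 a23 a30 a31 a32 a33)"
  by (rule listed_uminus[OF mat4_carrier]) (simp add: mat4_uminus)

text \<open>The new basis is e0, e1 + c e0. These are the unipotent changes of basis that keep e0
  \<otimes> e0 fixed.\<close>

lemma listed_shift:
  assumes "braiding R" and "\<And>R'. braiding R' \<Longrightarrow> R' = kron (mat2 1 (- c) 0 1) (mat2 1 (- c) 0 1) * R * kron (mat2 1 c 0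
    1) (mat2 1 c 0 1) \<Longrightarrow> listed R'"
  shows "listed R"
proof -
  have i: "mat2 1 (- c) 0 1 * mat2 1 c 0 1 = 1\<^sub>m 2" "mat2 1 c 0 1 * mat2 1 (- c) 0 1 = 1\<^sub>m 2"
    by (simp_all add: mat4_algebra)
  show ?thesis
    by (rule listed_conj[OF mat2_carrier mat2_carrier i braidingD(1)[OF assms(1)]],
        rule assms(2)[OF braiding_conj[OF mat2_carrier mat2_carrier i assms(1)] refl])
qed

text \<open>A nonzero corner d forces p = 1 or p = -1. The second case is
  \<open>a_glue (- d)\<close> after a sign, a transposition and an exchange of the basis
  vectors.\<close>

lemma listed_a_slash_form:
  assumes R: "braiding (mat4 1 0 0 d 0 0 p 0 0 (1/p) 0 0 0 0 0 (-1))" and p: "p \<noteq> 0"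
  shows "listed (mat4 1 0 0 d 0 0 p 0 0 (1/p) 0 0 0 0 0 (-1))"
proof -
  note y = braidingD(3)[OF R]
  have "d * (p - 1 / p) = 0"
    using y[of False False False True False True] by (simp only: ybe_raw) Groebner_Basis.algebra
  then consider "d = 0" | "d \<noteq> 0" "p - 1 / p = 0" by auto
  then show ?thesis
  proof cases
    case 1
    then show ?thesis using p by (auto intro!: listed_std simp: std_braidings_def entries_mat4)
  next
    case 2
    then have "p * p = 1" using p by (simp add: field_simps)
    then consider "p = 1" | "p = -1" using uminus_eq_one_cases by blast
    then show ?thesis
    proof cases
      case 1
      then show ?thesis using 2 by (auto intro!: listed_std simp: std_braidings_def entries_mat4)
    next
      case p: 2
      have "listed (mat4 1 0 0 (- d) 0 0 1 0 0 1 0 0 0 0 0 (-1))"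
        using 2 by (auto intro!: listed_std simp: std_braidings_def entries_mat4)
      then have "listed (mat4 (-1) 0 0 0 0 0 1 0 0 1 0 0 (- d) 0 0 1)" by (rule listed_reverse)
      then have "listed (mat4 (-1) 0 0 (- d) 0 0 1 0 0 1 0 0 0 0 0 1)"
        by (rule listed_mat4_transpose)
      then show ?thesis using listed_mat4_uminus[of 1 0 0 d 0 0 "-1" 0 0 "-1" 0 0 0 0 0 "-1"] by (simp add: p)
    qed
  qed
qed

lemma listed_a_slash_shifted:
  assumes R: "braiding (mat4 1 b (- p * b) d 0 0 p w 0 (1/p) 0 (w/p) 0 0 0 (-1))" and p: "p \<noteq> 0"
  shows "listed (mat4 1 b (- p * b) d 0 0 p w 0 (1/p) 0 (w/p) 0 0 0 (-1))"
proof -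
  note y = braidingD(3)[OF R]
  have pi: "p * (1 / p) = 1" "w / p = w * (1 / p)" using p by simp_all
  have bw: "b * p * (p + 1) = w * (p - 1)"
    using y[of False False True True False True] pi by (simp only: ybe_raw) Groebner_Basis.algebra
  have bw': "b * (p + 1) = w * (1 - 1 / p)" using bw p by (simp add: field_simps)
  \<comment> \<open>The shift has to solve both equations below, and \<open>bw\<close> is their
    compatibility condition. At p = -1 the second one loses its unknown (and w = 0), so the first
    one determines the shift.\<close>
  define c where "c = (if p = -1 then - b / 2 else - w / (1 + p))"
  have c: "b + c - c / p = 0" "w + c + c * p = 0"
  proof -
    show "w + c + c * p = 0"
    proof (cases "p = -1")
      case True
      then show ?thesis using bw by (simp add: c_def)
    next
      case False
      then have "1 + p \<noteq> 0" by (metis add.commute add_eq_0_iff)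
      then show ?thesis using False by (simp add: c_def field_simps)
    qed
    show "b + c - c / p = 0"
    proof (cases "p = -1")
      case True
      then show ?thesis by (simp add: c_def)
    next
      case False
      then have q: "1 + p \<noteq> 0" by (metis add.commute add_eq_0_iff)
      have "(1 + p) * c = - w" using False q by (simp add: c_def)
      moreover have "(1 + p) * (b + c - c / p) = b * (p + 1) + (1 + p) * c - (1 + p) * c / p"
        using p by (simp add: field_simps)
      ultimately have "(1 + p) * (b + c - c / p) = 0"
        using bw' by (simp add: algebra_simps)
      then show ?thesis using q by simp
    qed
  qed
  show ?thesis
  proof (rule listed_shift[OF R, of c])
    fix R' assume R': "braiding R'"
      "R' = kron (mat2 1 (- c) 0 1) (mat2 1 (- c) 0 1) * mat4 1 b (- p * b) d 0 0 p w 0 (1/p) 0 (w/p) 0 0 0 (-1) *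
        kron (mat2 1 c 0 1) (mat2 1 c 0 1)"
    have "c - (p * b + c * p) = - (p * (b + c - c / p))" "w / p + c / p + c = (w + c + c * p) / p"
      using p by (simp_all add: field_simps)
    then have e: "c - (p * b + c * p) = 0" "w / p + c / p + c = 0" using c by simp_all
    have "R' = mat4 1 0 0 (R' $$ (0, 3)) 0 0 p 0 0 (1/p) 0 0 0 0 0 (-1)"
      unfolding R'(2) using c e by (simp add: mat4_algebra algebra_simps)
    then show "listed R'" using listed_a_slash_form[OF _ p] R'(1) by metis
  qed
qed

lemma listed_a_slash_degenerate:
  assumes R: "braiding (mat4 1 b c d 0 (-1) 0 0 0 0 (-1) 0 0 (2 * v1) (2 * v2) 1)"
  shows "listed (mat4 1 b c d 0 (-1) 0 0 0 0 (-1) 0 0 (2 * v1) (2 * v2) 1)"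
proof -
  note y = braidingD(3)[OF R]
  have bv: "2 * (2 * (b * v1) - 1) = 0"
    using y[of False False True False False True] by (simp only: ybe_raw) Groebner_Basis.algebra
  have cv: "2 * (2 * (c * v2) - 1) = 0"
    using y[of True False False True False False] by (simp only: ybe_raw) Groebner_Basis.algebra
  have e: "- 4 * b * v2 * v2 + 4 * c * v1 * v1 - 6 * v1 + 6 * v2 = 0"
    using y[of True True True True False True] by (simp only: ybe_raw) Groebner_Basis.algebra
  \<comment> \<open>This is \<open>e\<close> multiplied by \<open>v1 * v2\<close>, with
    \<open>b * v1\<close> and \<open>c * v2\<close> replaced by 1/2.\<close>
  have "2 * ((v1 - v2) * (v1 - v2) * (v1 - v2)) = 0" using bv cv e by Groebner_Basis.algebra
  then have v: "v2 = v1" by simp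
  have v1: "v1 \<noteq> 0" "b = 1 / (2 * v1)" "c = 1 / (2 * v1)" using bv cv v by (auto simp: eq_divide_eq ac_simps)
  have "d + d = 0" using braidingD(2)[OF R] by (simp add: mat4_algebra)
  then have d: "d = 0" by simp
  \<comment> \<open>The first column of \<open>?B\<close> is the vector x, unique up to scaling, for
    which x \<otimes> x lies in the (-1)-eigenspace. In the new basis the first column of the matrix
    is minus a unit vector.\<close>
  let ?A = "mat2 (1/2) (- 1 / (4 * v1)) (1/2) (1 / (4 * v1))" and ?B = "mat2 1 1 (- 2 * v1) (2 * v1)"
  have i: "?A * ?B = 1\<^sub>m 2" "?B * ?A = 1\<^sub>m 2" using v1(1) by (simp_all add: mat4_algebra)
  have e: "kron ?A ?A * mat4 1 b c d 0 (-1) 0 0 0 0 (-1) 0 0 (2 * v1) (2 * v2) 1 * kron ?B ?B =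
      mat4 (-1) 0 0 2 0 0 1 0 0 1 0 0 0 0 0 1"
    using v1(1) by (simp add: mat4_algebra d v v1(2,3) field_simps)
  have "braiding (- mat4 (-1) 0 0 2 0 0 1 0 0 1 0 0 0 0 0 1)"
    using braiding_uminus[OF braiding_conj[OF mat2_carrier mat2_carrier i R]] by (simp only: e)
  then have "listed (mat4 1 0 0 (-2) 0 0 (-1) 0 0 (-1) 0 0 0 0 0 (-1))"
    using listed_a_slash_form[of "-2" "-1"] by (simp add: mat4_uminus)
  then have "listed (mat4 (-1) 0 0 2 0 0 1 0 0 1 0 0 0 0 0 1)"
    using listed_mat4_uminus[of "-1" 0 0 2 0 0 1 0 0 1 0 0 0 0 0 1] by simp
  then show ?thesis by (intro listed_conj[OF mat2_carrier mat2_carrier i mat4_carrier]) (simp only: e)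
qed

text \<open>Squaring and one braid entry clear the top row, which leaves the transpose of
  \<open>f_glue 0 (- 2 * v)\<close>.\<close>

lemma listed_f_glue_degenerate:
  assumes R: "braiding (mat4 1 k1 k2 k3 0 0 1 0 0 1 0 0 0 (- 2 * v) (2 * v) 1)" and v: "v \<noteq> 0"
  shows "listed (mat4 1 k1 k2 k3 0 0 1 0 0 1 0 0 0 (- 2 * v) (2 * v) 1)"
proof -
  note y = braidingD(3)[OF R]
  have "k1 + k2 - 2 * v * k3 = 0" "k1 + k2 + 2 * v * k3 = 0" "k3 + k3 = 0"
    using braidingD(2)[OF R] by (simp_all add: mat4_algebra algebra_simps)
  then have k: "k3 = 0" "k2 = - k1" by (simp_all add: add_eq_0_iff)
  have "k1 * v = 0"
    using y[of False False True False False True] k by (simp only: ybe_raw) Groebner_Basis.algebra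
  then have "k1 = 0" using v by simp
  have "listed (mat4 1 0 0 0 0 0 1 (- 2 * v) 0 1 0 (2 * v) 0 0 0 1)"
    using v by (intro listed_std) (auto simp: std_braidings_def entries_mat4)
  then have "listed (mat4 1 0 0 0 0 0 1 0 0 1 0 0 0 (- 2 * v) (2 * v) 1)" by (rule listed_mat4_transpose)
  then show ?thesis by (simp add: k \<open>k1 = 0\<close>)
qed

text \<open>One braid entry factors as (1 + p) * (k - w / p). At p = -1 the matrix is an f-glue form
  or the flip, where w = 0 with k nonzero is reached by transposing and reversing
  \<open>f_glue 0 (- k)\<close>. Otherwise k = w / p, and a shift removes both parameters.\<close>

lemma listed_f_slash_shifted:
  assumes R: "braiding (mat4 1 k (k * p) (k * w) 0 0 (- p) (- w) 0 (- 1 / p) 0 (- w / p) 0 0 0 1)" and p: "p \<noteq> 0"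
  shows "listed (mat4 1 k (k * p) (k * w) 0 0 (- p) (- w) 0 (- 1 / p) 0 (- w / p) 0 0 0 1)"
proof -
  note y = braidingD(3)[OF R]
  define q where "q = 1 / p"
  have q: "p * q = 1" "1 / p = q" "- 1 / p = - q" "- w / p = - w * q" using p by (simp_all add: q_def)
  have "(1 + p) * (k - w * q) = 0"
    using y[of False False True True False True] q(1) by (simp only: ybe_raw q(2-4)) Groebner_Basis.algebra
  then consider "p = -1" | "p \<noteq> -1" "k = w * q" by (auto simp: add_eq_0_iff)
  then show ?thesis
  proof cases
    case 1
    show ?thesis
    proof (cases "w = 0")
      case False
      have "listed (f_glue (- k) (- w))" using False listed_std_forms(3)[of "- w"] by simp
      then show ?thesis by (simp add: 1 entries_mat4)
    next
      case w: True
      show ?thesis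
      proof (cases "k = 0")
        case True
        have "listed (slash 1 1)" using listed_std_forms(4)[of 1] by simp
        then show ?thesis by (simp add: 1 w True entries_mat4)
      next
        case False
        have "listed (f_glue 0 (- k))" using False listed_std_forms(3)[of "- k"] by simp
        then have "listed (mat4 1 0 0 0 0 0 1 (- k) 0 1 0 k 0 0 0 1)" by (simp add: entries_mat4)
        then have "listed (mat4 1 0 0 0 0 0 1 0 0 1 0 0 0 (- k) k 1)" by (rule listed_mat4_transpose)
        then have "listed (mat4 1 k (- k) 0 0 0 1 0 0 1 0 0 0 0 0 1)" by (rule listed_reverse)
        then show ?thesis by (simp add: 1 w)
      qed
    qed
  next
    case 2
    then have p1: "p + 1 \<noteq> 0" by (simp add: add_eq_0_iff2)
    have w: "w = k * p" using 2 q p by (metis mult.assoc mult.commute mult.right_neutral)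
    define c where "c = - k * p / (p + 1)"
    have c: "c * (p + 1) = - k * p" using p1 by (simp add: c_def)
    show ?thesis
    proof (rule listed_shift[OF R, of c])
      fix R' assume R': "braiding R'"
        "R' = kron (mat2 1 (- c) 0 1) (mat2 1 (- c) 0 1) *
          mat4 1 k (k * p) (k * w) 0 0 (- p) (- w) 0 (- 1 / p) 0 (- w / p) 0 0 0 1 * kron (mat2 1 c 0 1) (mat2 1 c 0 1)"
      have "R' = slash (- p) 1"
        unfolding R'(2) entries_mat4 w using p p1 by (simp add: mat4_algebra c_def field_simps) 
      moreover have "listed (slash (- p) 1)" using p listed_std_forms(4)[of "- p"] by simp
      ultimately show "listed R'" by simp
    qed
  qed
qed

text \<open>The lower right block of \<open>bordered s b c d u v\<close> is \<open>s * (2 u v\<^sup>T - 1)\<close>.\<close>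

definition bordered :: "complex \<Rightarrow> complex \<Rightarrow> complex \<Rightarrow> complex \<Rightarrow> complex \<Rightarrow>
  complex \<Rightarrow> complex \<Rightarrow> complex \<Rightarrow> complex \<Rightarrow> complex \<Rightarrow> complex mat" where
  "bordered s b c d u1 u2 u3 v1 v2 v3 = mat4 1 b c d
     0 (s * (2 * u1 * v1 - 1)) (s * (2 * u1 * v2)) (s * (2 * u1 * v3))
     0 (s * (2 * u2 * v1)) (s * (2 * u2 * v2 - 1)) (s * (2 * u2 * v3))
     0 (s * (2 * u3 * v1)) (s * (2 * u3 * v2)) (s * (2 * u3 * v3 - 1))"

lemma listed_bordered_1_u3_zero:
  assumes R: "braiding (bordered 1 b c d u1 u2 0 v1 v2 v3)" and uv: "u1 * v1 + u2 * v2 = 1" and t: "b * u1 + c * u2 = 0"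
  shows "listed (bordered 1 b c d u1 u2 0 v1 v2 v3)"
proof -
  note y = braidingD(3)[OF R[unfolded bordered_def]]
  let ?x = "u1 * v1"
  have "2 * ((?x - 1) * ((2 * ?x - 1) * (2 * ?x - 1))) = 0"
    using y[of False False True False False True] uv by (simp only: ybe_raw) Groebner_Basis.algebra
  moreover have "2 * ((u2 * v2 - 1) * ((2 * (u2 * v2) - 1) * (2 * (u2 * v2) - 1))) = 0"
    using y[of True False False True False False] uv by (simp only: ybe_raw) Groebner_Basis.algebra
  \<comment> \<open>The products sum to 1. If one of them were 1, the other would be 0, which its
    own cubic rejects; hence both equal 1/2.\<close>
  ultimately have x: "2 * (u1 * v1) = 1" "2 * (u2 * v2) = 1" using uv by auto
  then have nz: "v1 \<noteq> 0" "v2 \<noteq> 0" by auto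
  have u: "u1 = 1 / (2 * v1)" "u2 = 1 / (2 * v2)" using x nz by (simp_all add: field_simps)
  \<comment> \<open>With p = v2 / v1 this gives the top row required by
    \<open>listed_a_slash_shifted\<close>.\<close>
  have "c = - (v2 / v1) * b" using t nz by (simp add: u field_simps add_eq_0_iff)
  then have e: "bordered 1 b c d u1 u2 0 v1 v2 v3 =
      mat4 1 b (- (v2 / v1) * b) d 0 0 (v2 / v1) (v3 / v1) 0 (1 / (v2 / v1)) 0 (v3 / v1 / (v2 / v1)) 0 0 0 (-1)"
    using nz by (simp add: bordered_def u)
  show ?thesis using R nz unfolding e by (intro listed_a_slash_shifted) auto
qed

text \<open>The braid relation forces u1 = u2. Modulo e0 \<otimes> e0, the vector u is then the
  square of e1 + u1 e0, and the shift by u1 turns it into e1 \<otimes> e1.\<close>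

lemma listed_bordered_1_u3_one:
  assumes R: "braiding (bordered 1 b c d u1 u2 1 v1 v2 v3)" and uv: "u1 * v1 + u2 * v2 + v3 = 1"
  shows "listed (bordered 1 b c d u1 u2 1 v1 v2 v3)"
proof -
  note y = braidingD(3)[OF R[unfolded bordered_def]]
  have v3: "v3 = 1 - u1 * v1 - u2 * v2" using uv by (simp add: algebra_simps)
  have 1: "8 * ((u1 - u2) * (v1 * v1 * v1)) = 0"
    using y[of True True True False False True] uv by (simp only: ybe_raw) Groebner_Basis.algebra
  have 2: "8 * ((u1 - u2) * (v2 * v2 * v2)) = 0"
    using y[of True True True True False False] uv by (simp only: ybe_raw) Groebner_Basis.algebra
  have u: "u2 = u1"
  proof (rule ccontr)
    assume "u2 \<noteq> u1"
    then have "v1 = 0" "v2 = 0" using 1 2 by auto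
    then show False using y[of False False True False False True] uv
      by (simp only: ybe_raw) (simp add: algebra_simps)
  qed
  show ?thesis
  proof (rule listed_shift[OF R, of u1])
    fix R' assume R': "braiding R'"
      "R' = kron (mat2 1 (- u1) 0 1) (mat2 1 (- u1) 0 1) * bordered 1 b c d u1 u2 1 v1 v2 v3 * kron (mat2 1 u1 0 1) (mat2 1 u1 0 1)"
    have "R' = mat4 1 (R' $$ (0, Suc 0)) (R' $$ (0, 2)) (R' $$ (0, 3)) 0 (-1) 0 0 0 0 (-1) 0 0 (2 * v1) (2 * v2) 1"
      unfolding R'(2) bordered_def u v3 by (simp add: mat4_algebra algebra_simps)
    then show "listed R'" using listed_a_slash_degenerate R'(1) by metis
  qed
qed

lemma listed_bordered_neg_u3_zero:
  assumes R: "braiding (bordered (-1) (k * v1) (k * v2) (k * v3) u1 u2 0 v1 v2 v3)" and uv: "u1 * v1 + u2 * v2 = 1"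
  shows "listed (bordered (-1) (k * v1) (k * v2) (k * v3) u1 u2 0 v1 v2 v3)"
proof -
  note y = braidingD(3)[OF R[unfolded bordered_def]]
  let ?x = "u1 * v1"
  have "- 2 * (?x * ((2 * ?x - 1) * (2 * ?x - 1))) = 0"
    using y[of False False True False False True] uv by (simp only: ybe_raw) Groebner_Basis.algebra
  moreover have "- 2 * ((u2 * v2) * ((2 * (u2 * v2) - 1) * (2 * (u2 * v2) - 1))) = 0"
    using y[of True False False True False False] uv by (simp only: ybe_raw) Groebner_Basis.algebra
  \<comment> \<open>Each product is 0 or 1/2, and they cannot both be 0 since their sum is
    1.\<close>
  ultimately have "2 * (u1 * v1) = 1 \<or> 2 * (u2 * v2) = 1" using uv by auto
  moreover have "2 * (u1 * v1) + 2 * (u2 * v2) = 2" using uv by (metis distrib_left mult.right_neutral)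
  ultimately have x: "2 * (u1 * v1) = 1" "2 * (u2 * v2) = 1" by auto
  then have nz: "v1 \<noteq> 0" "v2 \<noteq> 0" by auto
  have u: "u1 = 1 / (2 * v1)" "u2 = 1 / (2 * v2)" using x nz by (simp_all add: field_simps)
  have e: "bordered (-1) (k * v1) (k * v2) (k * v3) u1 u2 0 v1 v2 v3 =
      mat4 1 (k * v1) (k * v1 * (v2 / v1)) (k * v1 * (v3 / v1)) 0 0 (- (v2 / v1)) (- (v3 / v1))
        0 (- 1 / (v2 / v1)) 0 (- (v3 / v1) / (v2 / v1)) 0 0 0 1"
    using nz by (simp add: bordered_def u)
  show ?thesis using R nz unfolding e by (intro listed_f_slash_shifted) auto
qed

lemma listed_bordered_neg_u3_one:
  assumes R: "braiding (bordered (-1) (k * v1) (k * v2) (k * v3) u1 u2 1 v1 v2 v3)" and uv: "u1 * v1 + u2 * v2 + v3 = 1"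
  shows "listed (bordered (-1) (k * v1) (k * v2) (k * v3) u1 u2 1 v1 v2 v3)"
proof -
  note y = braidingD(3)[OF R[unfolded bordered_def]]
  have v3: "v3 = 1 - u1 * v1 - u2 * v2" using uv by (simp add: algebra_simps)
  have 1: "8 * (v1 * v1 * (v1 * (u1 - u2) - 1)) = 0"
    using y[of True True True False False True] uv by (simp only: ybe_raw) Groebner_Basis.algebra
  have 2: "8 * (v2 * v2 * (v2 * (u2 - u1) - 1)) = 0"
    using y[of True True True True False False] uv by (simp only: ybe_raw) Groebner_Basis.algebra
  have "v1 \<noteq> 0"
  proof
    assume v1: "v1 = 0"
    have "2 * v2 = 0" using y[of False True True False True False] uv v1 by (simp only: ybe_raw) Groebner_Basis.algebra
    then have "v2 = 0" by simp
    then have "(2::complex) = 0" using y[of False True True False True True] uv v1 by (simp only: ybe_raw) Groebner_Basis.algebra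
    then show False by simp
  qed
  moreover have "v2 \<noteq> 0"
  proof
    assume v2: "v2 = 0"
    have "2 * v1 = 0" using y[of True True False False True False] uv v2 by (simp only: ybe_raw) Groebner_Basis.algebra
    then show False using \<open>v1 \<noteq> 0\<close> by simp
  qed
  ultimately have a: "v1 * (u1 - u2) - 1 = 0" "v2 * (u2 - u1) - 1 = 0" using 1 2 by auto
  then have "(u1 - u2) * (v1 + v2) = 0" by Groebner_Basis.algebra
  then have v2: "v2 = - v1" using a by (auto simp: add_eq_0_iff)
  have v3: "v3 = 0" using uv a v2 by (simp add: algebra_simps)
  \<comment> \<open>Since u1 - u2 = 1 / v1, this is the mean of u1 and u2; shifting by it makes the
    two coordinates opposite.\<close>
  define m where "m = u1 - 1 / (2 * v1)"
  have u2: "u2 = u1 - 1 / v1" using a(1) \<open>v1 \<noteq> 0\<close> by (simp add: field_simps)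
  have m: "u1 = m + 1 / (2 * v1)" "u2 = m - 1 / (2 * v1)"
    unfolding m_def u2 using \<open>v1 \<noteq> 0\<close> by (simp_all add: field_simps)
  show ?thesis
  proof (rule listed_shift[OF R, of m])
    fix R' assume R': "braiding R'"
      "R' = kron (mat2 1 (- m) 0 1) (mat2 1 (- m) 0 1) * bordered (-1) (k * v1) (k * v2) (k * v3) u1 u2 1 v1 v2 v3 *
        kron (mat2 1 m 0 1) (mat2 1 m 0 1)"
    have "R' = mat4 1 (R' $$ (0, Suc 0)) (R' $$ (0, 2)) (R' $$ (0, 3)) 0 0 1 0 0 1 0 0 0 (- 2 * v1) (2 * v1) 1"
      unfolding R'(2) bordered_def v2 v3 m using \<open>v1 \<noteq> 0\<close> by (simp add: mat4_algebra field_simps)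
    then show "listed R'" using listed_f_glue_degenerate[OF _ \<open>v1 \<noteq> 0\<close>] R'(1) by metis
  qed
qed

section \<open>Involutions of a three-dimensional space\<close>

lemma proportional_3:
  fixes a1 a2 a3 b1 b2 b3 :: complex
  assumes "a1 \<noteq> 0 \<or> a2 \<noteq> 0 \<or> a3 \<noteq> 0" "a1 * b2 = a2 * b1" "a1 * b3 = a3 * b1" "a2 * b3 = a3 * b2"
  shows "\<exists>l. b1 = l * a1 \<and> b2 = l * a2 \<and> b3 = l * a3"
proof -
  consider "a1 \<noteq> 0" | "a2 \<noteq> 0" | "a3 \<noteq> 0" using assms(1) by blast
  then show ?thesis
  proof cases
    case 1
    then show ?thesis using assms by (intro exI[of _ "b1 / a1"]) (simp add: field_simps)
  next
    case 2
    then show ?thesis using assms by (intro exI[of _ "b2 / a2"]) (simp add: field_simps)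
  next
    case 3
    then show ?thesis using assms by (intro exI[of _ "b3 / a3"]) (simp add: field_simps)
  qed
qed

text \<open>The double product c x (r x s) = r (c . s) - s (c . r) vanishes, so c is proportional to
  the nonzero vector r x s.\<close>

lemma orthogonal_cross_3:
  fixes r1 r2 r3 s1 s2 s3 c1 c2 c3 :: complex
  assumes "r2 * s3 - r3 * s2 \<noteq> 0 \<or> r3 * s1 - r1 * s3 \<noteq> 0 \<or> r1 * s2 - r2 * s1 \<noteq> 0"
    and "r1 * c1 + r2 * c2 + r3 * c3 = 0" "s1 * c1 + s2 * c2 + s3 * c3 = 0"
  shows "\<exists>l. c1 = l * (r2 * s3 - r3 * s2) \<and> c2 = l * (r3 * s1 - r1 * s3) \<and> c3 = l * (r1 * s2 - r2 * s1)"
  by (rule proportional_3[OF assms(1)]; insert assms(2,3); Groebner_Basis.algebra)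

text \<open>All nine 2 x 2 minors vanish, so the first nonzero row serves as v and the later rows
  are multiples of it.\<close>

lemma rank_one_3:
  fixes p11 p12 p13 p21 p22 p23 p31 p32 p33 :: complex
  assumes "p11 * p22 = p12 * p21" "p11 * p23 = p13 * p21" "p12 * p23 = p13 * p22"
    and "p11 * p32 = p12 * p31" "p11 * p33 = p13 * p31" "p12 * p33 = p13 * p32"
    and "p21 * p32 = p22 * p31" "p21 * p33 = p23 * p31" "p22 * p33 = p23 * p32"
  shows "\<exists>u1 u2 u3 v1 v2 v3. p11 = u1 * v1 \<and> p12 = u1 * v2 \<and> p13 = u1 * v3 \<and> p21 = u2 * v1 \<and> p22 = u2 * v2
    \<and> p23 = u2 * v3 \<and> p31 = u3 * v1 \<and> p32 = u3 * v2 \<and> p33 = u3 * v3"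
proof -
  consider "p11 \<noteq> 0 \<or> p12 \<noteq> 0 \<or> p13 \<noteq> 0" | "p11 = 0" "p12 = 0" "p13 = 0" "p21 \<noteq> 0 \<or> p22 \<noteq> 0
    \<or> p23 \<noteq> 0"
    | "p11 = 0" "p12 = 0" "p13 = 0" "p21 = 0" "p22 = 0" "p23 = 0" by blast
  then show ?thesis
  proof cases
    case 1
    from proportional_3[OF 1 assms(1-3)] obtain l where "p21 = l * p11" "p22 = l * p12" "p23 = l * p13" by blast
    moreover from proportional_3[OF 1 assms(4-6)] obtain m where "p31 = m * p11" "p32 = m * p12" "p33 = m * p13" by blast
    ultimately show ?thesis
      by (intro exI[of _ 1] exI[of _ l] exI[of _ m] exI[of _ p11] exI[of _ p12] exI[of _ p13]) simp
  next
    case 2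
    from proportional_3[OF 2(4) assms(7-9)] obtain m where "p31 = m * p21" "p32 = m * p22" "p33 = m * p23" by blast
    then show ?thesis
      using 2(1-3) by (intro exI[of _ 0] exI[of _ 1] exI[of _ m] exI[of _ p21] exI[of _ p22] exI[of _ p23]) simp
  next
    case 3
    then show ?thesis
      by (intro exI[of _ 0] exI[of _ 0] exI[of _ 1] exI[of _ p31] exI[of _ p32] exI[of _ p33]) simp
  qed
qed

text \<open>The square of u v^T is (u . v) u v^T, so every entry is annihilated by u . v -
  2.\<close>

lemma twice_projection_3:
  fixes u1 u2 u3 v1 v2 v3 :: complex
  assumes "(u1 * v1) * (u1 * v1) + (u1 * v2) * (u2 * v1) + (u1 * v3) * (u3 * v1) = 2 * (u1 * v1)" "(u1 * v1) * (u1 * v2) + (u1 * v2) * (u2 *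
    v2) + (u1 * v3) * (u3 * v2) = 2 * (u1 * v2)" "(u1 * v1) * (u1 * v3) + (u1 * v2) * (u2 * v3) + (u1 * v3) * (u3 * v3) = 2 * (u1 * v3)"
    "(u2 * v1) * (u1 * v1) + (u2 * v2) * (u2 * v1) + (u2 * v3) * (u3 * v1) = 2 * (u2 * v1)" "(u2 * v1) * (u1 * v2) + (u2 * v2) * (u2 * v2) +
    (u2 * v3) * (u3 * v2) = 2 * (u2 * v2)" "(u2 * v1) * (u1 * v3) + (u2 * v2) * (u2 * v3) + (u2 * v3) * (u3 * v3) = 2 * (u2 * v3)" "(u3 *
    v1) * (u1 * v1) + (u3 * v2) * (u2 * v1) + (u3 * v3) * (u3 * v1) = 2 * (u3 * v1)" "(u3 * v1) * (u1 * v2) + (u3 * v2) * (u2 * v2) + (u3 *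
    v3) * (u3 * v2) = 2 * (u3 * v2)" "(u3 * v1) * (u1 * v3) + (u3 * v2) * (u2 * v3) + (u3 * v3) * (u3 * v3) = 2 * (u3 * v3)"
  shows "(u1 * v1 = 0 \<and> u1 * v2 = 0 \<and> u1 * v3 = 0 \<and> u2 * v1 = 0 \<and> u2 * v2 = 0 \<and> u2 * v3 = 0 \<and> u3 * v1 = 0
    \<and> u3 * v2 = 0 \<and> u3 * v3 = 0) \<or> u1 * (v1 / 2) + u2 * (v2 / 2) + u3 * (v3 / 2) = 1"
proof (rule disjCI)
  assume "\<not> u1 * (v1 / 2) + u2 * (v2 / 2) + u3 * (v3 / 2) = 1"
  then have n: "u1 * v1 + u2 * v2 + u3 * v3 - 2 \<noteq> 0" by (simp add: field_simps)
  have z: "x = 0" if "x * (u1 * v1 + u2 * v2 + u3 * v3 - 2) = 0" for x using that n by simp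
  show "u1 * v1 = 0 \<and> u1 * v2 = 0 \<and> u1 * v3 = 0 \<and> u2 * v1 = 0 \<and> u2 * v2 = 0 \<and> u2 * v3 = 0 \<and> u3 * v1 = 0 \<and>
    u3 * v2 = 0 \<and> u3 * v3 = 0"
    by (intro conjI; rule z; insert assms; Groebner_Basis.algebra)
qed

text \<open>Diagonalisation is avoided by using (Q + 1) (1 - Q) = 0. If Q + 1 has two independent
  rows, the columns of 1 - Q are multiples of their cross product, so 1 - Q has rank at most one;
  otherwise Q + 1 has. Either factor equals twice a projection, and
  \<open>twice_projection_3\<close> applies.\<close>

lemma involution_3:
  fixes q11 q12 q13 q21 q22 q23 q31 q32 q33 :: complex
  assumes q: "q11 * q11 + q12 * q21 + q13 * q31 = 1" "q11 * q12 + q12 * q22 + q13 * q32 = 0" "q11 * q13 + q12 * q23 + q13 * q33 = 0" "q21 *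
    q11 + q22 * q21 + q23 * q31 = 0" "q21 * q12 + q22 * q22 + q23 * q32 = 1" "q21 * q13 + q22 * q23 + q23 * q33 = 0" "q31 * q11 + q32 * q21
    + q33 * q31 = 0" "q31 * q12 + q32 * q22 + q33 * q32 = 0" "q31 * q13 + q32 * q23 + q33 * q33 = 1"
  obtains (one) "q11 = 1 \<and> q12 = 0 \<and> q13 = 0 \<and> q21 = 0 \<and> q22 = 1 \<and> q23 = 0 \<and> q31 = 0 \<and> q32 = 0 \<and> q33 = 1"
    | (minus_one) "q11 = - 1 \<and> q12 = - 0 \<and> q13 = - 0 \<and> q21 = - 0 \<and> q22 = - 1 \<and> q23 = - 0 \<and> q31 = - 0 \<and>
      q32 = - 0 \<and> q33 = - 1"
    | (reflection) s u1 u2 u3 v1 v2 v3 where "s \<in> {1, -1}" "u1 * v1 + u2 * v2 + u3 * v3 = 1" "q11 = s * (2 * u1 * v1 - 1) \<and> q12 = s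
      * (2 * u1 * v2) \<and> q13 = s * (2 * u1 * v3) \<and> q21 = s * (2 * u2 * v1) \<and> q22 = s * (2 * u2 * v2 - 1) \<and> q23 = s * (2 *
      u2 * v3) \<and> q31 = s * (2 * u3 * v1) \<and> q32 = s * (2 * u3 * v2) \<and> q33 = s * (2 * u3 * v3 - 1)"
proof -
  have pm11: "(q11 + 1) * (1 - q11) + q12 * (- q21) + q13 * (- q31) = 0" using q(1) by Groebner_Basis.algebra
  have pm12: "(q11 + 1) * (- q12) + q12 * (1 - q22) + q13 * (- q32) = 0" using q(2) by Groebner_Basis.algebra
  have pm13: "(q11 + 1) * (- q13) + q12 * (- q23) + q13 * (1 - q33) = 0" using q(3) by Groebner_Basis.algebra
  have pm21: "q21 * (1 - q11) + (q22 + 1) * (- q21) + q23 * (- q31) = 0" using q(4) by Groebner_Basis.algebra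
  have pm22: "q21 * (- q12) + (q22 + 1) * (1 - q22) + q23 * (- q32) = 0" using q(5) by Groebner_Basis.algebra
  have pm23: "q21 * (- q13) + (q22 + 1) * (- q23) + q23 * (1 - q33) = 0" using q(6) by Groebner_Basis.algebra
  have pm31: "q31 * (1 - q11) + q32 * (- q21) + (q33 + 1) * (- q31) = 0" using q(7) by Groebner_Basis.algebra
  have pm32: "q31 * (- q12) + q32 * (1 - q22) + (q33 + 1) * (- q32) = 0" using q(8) by Groebner_Basis.algebra
  have pm33: "q31 * (- q13) + q32 * (- q23) + (q33 + 1) * (1 - q33) = 0" using q(9) by Groebner_Basis.algebra
  have plus: thesis if "(q11 + 1) = u1 * v1 \<and> q12 = u1 * v2 \<and> q13 = u1 * v3 \<and> q21 = u2 * v1 \<and> (q22 + 1) = u2 * v2 \<and>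
    q23 = u2 * v3 \<and> q31 = u3 * v1 \<and> q32 = u3 * v2 \<and> (q33 + 1) = u3 * v3" for u1 u2 u3 v1 v2 v3
  proof -
    have e: "q11 = u1 * v1 - 1" "q12 = u1 * v2" "q13 = u1 * v3" "q21 = u2 * v1" "q22 = u2 * v2 - 1" "q23 = u2 * v3" "q31 = u3 * v1" "q32 =
      u3 * v2" "q33 = u3 * v3 - 1"
      using that by (simp_all add: eq_diff_eq)
    have "(u1 * v1 = 0 \<and> u1 * v2 = 0 \<and> u1 * v3 = 0 \<and> u2 * v1 = 0 \<and> u2 * v2 = 0 \<and> u2 * v3 = 0 \<and> u3 * v1 = 0
      \<and> u3 * v2 = 0 \<and> u3 * v3 = 0) \<or> u1 * (v1 / 2) + u2 * (v2 / 2) + u3 * (v3 / 2) = 1"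
      by (rule twice_projection_3; insert q; unfold e; Groebner_Basis.algebra)
    then show thesis
    proof
      assume "u1 * v1 = 0 \<and> u1 * v2 = 0 \<and> u1 * v3 = 0 \<and> u2 * v1 = 0 \<and> u2 * v2 = 0 \<and> u2 * v3 = 0 \<and> u3 * v1 = 0
        \<and> u3 * v2 = 0 \<and> u3 * v3 = 0"
      then show thesis by (intro minus_one) (simp add: e)
    next
      assume "u1 * (v1 / 2) + u2 * (v2 / 2) + u3 * (v3 / 2) = 1"
      then show thesis by (intro reflection[of "1" u1 "v1 / 2" u2 "v2 / 2" u3 "v3 / 2"]) (simp_all add: e)
    qed
  qed
  have minus: thesis if "(1 - q11) = u1 * v1 \<and> (- q12) = u1 * v2 \<and> (- q13) = u1 * v3 \<and> (- q21) = u2 * v1 \<and> (1 - q22) =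
    u2 * v2 \<and> (- q23) = u2 * v3 \<and> (- q31) = u3 * v1 \<and> (- q32) = u3 * v2 \<and> (1 - q33) = u3 * v3" for u1 u2 u3 v1 v2 v3
  proof -
    have e: "q11 = 1 - u1 * v1" "q12 = - (u1 * v2)" "q13 = - (u1 * v3)" "q21 = - (u2 * v1)" "q22 = 1 - u2 * v2" "q23 = - (u2 * v3)" "q31 = -
      (u3 * v1)" "q32 = - (u3 * v2)" "q33 = 1 - u3 * v3"
      using that by (auto simp: algebra_simps minus_equation_iff[of q12] minus_equation_iff[of q13] minus_equation_iff[of q21]
        minus_equation_iff[of q23] minus_equation_iff[of q31] minus_equation_iff[of q32])
    have "(u1 * v1 = 0 \<and> u1 * v2 = 0 \<and> u1 * v3 = 0 \<and> u2 * v1 = 0 \<and> u2 * v2 = 0 \<and> u2 * v3 = 0 \<and> u3 * v1 = 0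
      \<and> u3 * v2 = 0 \<and> u3 * v3 = 0) \<or> u1 * (v1 / 2) + u2 * (v2 / 2) + u3 * (v3 / 2) = 1"
      by (rule twice_projection_3; insert q; unfold e; Groebner_Basis.algebra)
    then show thesis
    proof
      assume "u1 * v1 = 0 \<and> u1 * v2 = 0 \<and> u1 * v3 = 0 \<and> u2 * v1 = 0 \<and> u2 * v2 = 0 \<and> u2 * v3 = 0 \<and> u3 * v1 = 0
        \<and> u3 * v2 = 0 \<and> u3 * v3 = 0"
      then show thesis by (intro one) (simp add: e)
    next
      assume "u1 * (v1 / 2) + u2 * (v2 / 2) + u3 * (v3 / 2) = 1"
      then show thesis by (intro reflection[of "-1" u1 "v1 / 2" u2 "v2 / 2" u3 "v3 / 2"]) (simp_all add: e)
    qed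
  qed
  \<comment> \<open>Rows 1 and 2 of Q + 1 are independent here; \<open>l1\<close>,
    \<open>l2\<close>, \<open>l3\<close> are the factors of the three columns of 1 - Q.\<close>
  have c12: thesis if "q12 * q23 - q13 * (q22 + 1) \<noteq> 0 \<or> q13 * q21 - (q11 + 1) * q23 \<noteq> 0 \<or> (q11 + 1) * (q22 + 1) - q12
    * q21 \<noteq> 0"
  proof -
    from orthogonal_cross_3[OF that pm11 pm21] obtain l1 where l1: "(1 - q11) = l1 * (q12 * q23 - q13 * (q22 + 1))" "(- q21) = l1 * (q13 *
      q21 - (q11 + 1) * q23)" "(- q31) = l1 * ((q11 + 1) * (q22 + 1) - q12 * q21)" by blast
    from orthogonal_cross_3[OF that pm12 pm22] obtain l2 where l2: "(- q12) = l2 * (q12 * q23 - q13 * (q22 + 1))" "(1 - q22) = l2 * (q13 *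
      q21 - (q11 + 1) * q23)" "(- q32) = l2 * ((q11 + 1) * (q22 + 1) - q12 * q21)" by blast
    from orthogonal_cross_3[OF that pm13 pm23] obtain l3 where l3: "(- q13) = l3 * (q12 * q23 - q13 * (q22 + 1))" "(- q23) = l3 * (q13 * q21
      - (q11 + 1) * q23)" "(1 - q33) = l3 * ((q11 + 1) * (q22 + 1) - q12 * q21)" by blast
    show thesis
      by (rule minus[of "q12 * q23 - q13 * (q22 + 1)" l1 l2 l3 "q13 * q21 - (q11 + 1) * q23" "(q11 + 1) * (q22 + 1) - q12 * q21"]) (simp
        only: l1 l2 l3 mult.commute simp_thms)
  qed
  have c13: thesis if "q12 * (q33 + 1) - q13 * q32 \<noteq> 0 \<or> q13 * q31 - (q11 + 1) * (q33 + 1) \<noteq> 0 \<or> (q11 + 1) * q32 - q12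
    * q31 \<noteq> 0"
  proof -
    from orthogonal_cross_3[OF that pm11 pm31] obtain l1 where l1: "(1 - q11) = l1 * (q12 * (q33 + 1) - q13 * q32)" "(- q21) = l1 * (q13 *
      q31 - (q11 + 1) * (q33 + 1))" "(- q31) = l1 * ((q11 + 1) * q32 - q12 * q31)" by blast
    from orthogonal_cross_3[OF that pm12 pm32] obtain l2 where l2: "(- q12) = l2 * (q12 * (q33 + 1) - q13 * q32)" "(1 - q22) = l2 * (q13 *
      q31 - (q11 + 1) * (q33 + 1))" "(- q32) = l2 * ((q11 + 1) * q32 - q12 * q31)" by blast
    from orthogonal_cross_3[OF that pm13 pm33] obtain l3 where l3: "(- q13) = l3 * (q12 * (q33 + 1) - q13 * q32)" "(- q23) = l3 * (q13 * q31
      - (q11 + 1) * (q33 + 1))" "(1 - q33) = l3 * ((q11 + 1) * q32 - q12 * q31)" by blast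
    show thesis
      by (rule minus[of "q12 * (q33 + 1) - q13 * q32" l1 l2 l3 "q13 * q31 - (q11 + 1) * (q33 + 1)" "(q11 + 1) * q32 - q12 * q31"]) (simp
        only: l1 l2 l3 mult.commute simp_thms)
  qed
  have c23: thesis if "(q22 + 1) * (q33 + 1) - q23 * q32 \<noteq> 0 \<or> q23 * q31 - q21 * (q33 + 1) \<noteq> 0 \<or> q21 * q32 - (q22 + 1)
    * q31 \<noteq> 0"
  proof -
    from orthogonal_cross_3[OF that pm21 pm31] obtain l1 where l1: "(1 - q11) = l1 * ((q22 + 1) * (q33 + 1) - q23 * q32)" "(- q21) = l1 *
      (q23 * q31 - q21 * (q33 + 1))" "(- q31) = l1 * (q21 * q32 - (q22 + 1) * q31)" by blast
    from orthogonal_cross_3[OF that pm22 pm32] obtain l2 where l2: "(- q12) = l2 * ((q22 + 1) * (q33 + 1) - q23 * q32)" "(1 - q22) = l2 *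
      (q23 * q31 - q21 * (q33 + 1))" "(- q32) = l2 * (q21 * q32 - (q22 + 1) * q31)" by blast
    from orthogonal_cross_3[OF that pm23 pm33] obtain l3 where l3: "(- q13) = l3 * ((q22 + 1) * (q33 + 1) - q23 * q32)" "(- q23) = l3 * (q23
      * q31 - q21 * (q33 + 1))" "(1 - q33) = l3 * (q21 * q32 - (q22 + 1) * q31)" by blast
    show thesis
      by (rule minus[of "(q22 + 1) * (q33 + 1) - q23 * q32" l1 l2 l3 "q23 * q31 - q21 * (q33 + 1)" "q21 * q32 - (q22 + 1) * q31"]) (simp
        only: l1 l2 l3 mult.commute simp_thms)
  qed
  show thesis
  proof (rule ccontr)
    assume n: "\<not> thesis"
    \<comment> \<open>No pair of rows of Q + 1 is independent, so all of its 2 x 2 minors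
      vanish.\<close>
    have z: "q12 * q23 - q13 * (q22 + 1) = 0" "q13 * q21 - (q11 + 1) * q23 = 0" "(q11 + 1) * (q22 + 1) - q12 * q21 = 0" "q12 * (q33 + 1) -
      q13 * q32 = 0" "q13 * q31 - (q11 + 1) * (q33 + 1) = 0" "(q11 + 1) * q32 - q12 * q31 = 0" "(q22 + 1) * (q33 + 1) - q23 * q32 = 0" "q23
      * q31 - q21 * (q33 + 1) = 0" "q21 * q32 - (q22 + 1) * q31 = 0"
      using n c12 c13 c23 by blast+
    have "\<exists>u1 u2 u3 v1 v2 v3. (q11 + 1) = u1 * v1 \<and> q12 = u1 * v2 \<and> q13 = u1 * v3 \<and> q21 = u2 * v1 \<and> (q22 + 1) =
      u2 * v2 \<and> q23 = u2 * v3 \<and> q31 = u3 * v1 \<and> q32 = u3 * v2 \<and> (q33 + 1) = u3 * v3"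
      by (rule rank_one_3; insert z; Groebner_Basis.algebra)
    then show False using plus n by blast
  qed
qed

text \<open>As R * R = 1, the row (b, c, d) annihilates u when s = 1 and is a multiple of v when s =
  -1. Scaling u and v inversely makes u3, the coordinate of e1 \<otimes> e1, equal to 0 or 1, which
  gives four cases.\<close>

lemma listed_first_column:
  assumes R: "braiding (mat4 1 b c d 0 q11 q12 q13 0 q21 q22 q23 0 q31 q32 q33)"
  shows "listed (mat4 1 b c d 0 q11 q12 q13 0 q21 q22 q23 0 q31 q32 q33)"
proof -
  note y = braidingD(3)[OF R]
  have i: "b + (b * q11 + c * q21 + d * q31) = 0" "c + (b * q12 + c * q22 + d * q32) = 0" "d + (b * q13 + c * q23 + d * q33) = 0"
    using braidingD(2)[OF R] by (simp_all add: mat4_algebra add.assoc)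
  have "q11 * q11 + q12 * q21 + q13 * q31 = 1" "q11 * q12 + q12 * q22 + q13 * q32 = 0" "q11 * q13 + q12 * q23 + q13 * q33 = 0" "q21 * q11 +
    q22 * q21 + q23 * q31 = 0" "q21 * q12 + q22 * q22 + q23 * q32 = 1" "q21 * q13 + q22 * q23 + q23 * q33 = 0" "q31 * q11 + q32 * q21 + q33
    * q31 = 0" "q31 * q12 + q32 * q22 + q33 * q32 = 0" "q31 * q13 + q32 * q23 + q33 * q33 = 1"
    using braidingD(2)[OF R] by (simp_all add: mat4_algebra)
  then show ?thesis
  proof (cases rule: involution_3)
    case one
    then have "mat4 1 b c d 0 q11 q12 q13 0 q21 q22 q23 0 q31 q32 q33 = 1\<^sub>m 4" using i by (simp add: mat4_one)
    then show ?thesis using listed_std_forms(1) by simp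
  next
    case minus_one
    then have "(2::complex) = 0"
      using y[of False False True False False True] by (simp only: ybe_raw) Groebner_Basis.algebra
    then show ?thesis by simp
  next
    case (reflection s u1 u2 u3 v1 v2 v3)
    let ?k = "b * u1 + c * u2 + d * u3"
    have e: "mat4 1 b c d 0 q11 q12 q13 0 q21 q22 q23 0 q31 q32 q33 = bordered s b c d u1 u2 u3 v1 v2 v3"
      using reflection(3) by (simp add: bordered_def)
    note q = reflection(3)
    from reflection(1) consider "s = 1" | "s = -1" by auto
    then show ?thesis
    proof cases
      case 1
      have "2 * (?k * v1) = 0" "2 * (?k * v2) = 0" "2 * (?k * v3) = 0"
        using i q 1 by (simp_all add: algebra_simps)
      then have "?k * v1 = 0" "?k * v2 = 0" "?k * v3 = 0" by simp_all
      then have k: "?k = 0" using reflection(2) by Groebner_Basis.algebra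
      show ?thesis
      proof (cases "u3 = 0")
        case True
        then show ?thesis using listed_bordered_1_u3_zero[of b c d u1 u2 v1 v2 v3] R k reflection(2) unfolding e 1 by simp
      next
        case False
        have "bordered s b c d u1 u2 u3 v1 v2 v3 = bordered 1 b c d (u1 / u3) (u2 / u3) 1 (v1 * u3) (v2 * u3) (v3 * u3)"
          using False by (simp add: bordered_def 1)
        moreover have "u1 / u3 * (v1 * u3) + u2 / u3 * (v2 * u3) + v3 * u3 = 1"
          using reflection(2) False by (simp add: mult.commute)
        ultimately show ?thesis using listed_bordered_1_u3_one R unfolding e by metis
      qed
    next
      case 2
      have "2 * b = 2 * (?k * v1)" "2 * c = 2 * (?k * v2)" "2 * d = 2 * (?k * v3)"
        using i q 2 by (simp_all add: algebra_simps)
      then have b: "b = ?k * v1" "c = ?k * v2" "d = ?k * v3" by simp_all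
      define k where "k = ?k"
      note b = b[folded k_def]
      show ?thesis
      proof (cases "u3 = 0")
        case True
        have "bordered s b c d u1 u2 u3 v1 v2 v3 = bordered (-1) (k * v1) (k * v2) (k * v3) u1 u2 0 v1 v2 v3"
          by (simp add: 2 True b[symmetric])
        moreover have "u1 * v1 + u2 * v2 = 1" using reflection(2) True by simp
        ultimately show ?thesis using listed_bordered_neg_u3_zero R unfolding e by metis
      next
        case False
        have "bordered s b c d u1 u2 u3 v1 v2 v3 =
            bordered (-1) (k / u3 * (v1 * u3)) (k / u3 * (v2 * u3)) (k / u3 * (v3 * u3)) (u1 / u3) (u2 / u3) 1 (v1 * u3) (v2 * u3) (v3 * u3)"
          using False by (simp add: bordered_def 2 b[symmetric])
        moreover have "u1 / u3 * (v1 * u3) + u2 / u3 * (v2 * u3) + v3 * u3 = 1"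
          using reflection(2) False by (simp add: mult.commute)
        ultimately show ?thesis using listed_bordered_neg_u3_one R unfolding e by metis
      qed
    qed
  qed
qed

section \<open>Moving a fixed pure tensor into a basis position\<close>

lemma mat2_inverse:
  assumes "a0 * b1 - b0 * a1 = 1"
  shows "mat2 b1 (- b0) (- a1) a0 * mat2 a0 b0 a1 b1 = 1\<^sub>m 2" "mat2 a0 b0 a1 b1 * mat2 b1 (- b0) (- a1) a0 = 1\<^sub>m 2"
proof -
  have "b1 * a0 = 1 + b0 * a1" using assms by (simp add: algebra_simps)
  then show "mat2 b1 (- b0) (- a1) a0 * mat2 a0 b0 a1 b1 = 1\<^sub>m 2" "mat2 a0 b0 a1 b1 * mat2 b1 (- b0) (- a1) a0 = 1\<^sub>m 2"
    by (simp_all add: mat4_algebra algebra_simps)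
qed

text \<open>The vector x is completed to a basis of determinant 1, whose inverse is the adjugate;
  the conjugate then has e0 \<otimes> e0 as its first column.\<close>

lemma listed_square_fixed:
  assumes R: "braiding (mat4 r00 r01 r02 r03 r10 r11 r12 r13 r20 r21 r22 r23 r30 r31 r32 r33)" (is "braiding ?R") and x: "x0 \<noteq> 0 \<or> x1 \<noteq> 0"
    and f: "r00 * (x0 * x0) + r01 * (x0 * x1) + r02 * (x1 * x0) + r03 * (x1 * x1) = (x0 * x0)" "r10 * (x0 * x0) + r11 * (x0 * x1) + r12 *
      (x1 * x0) + r13 * (x1 * x1) = (x0 * x1)" "r20 * (x0 * x0) + r21 * (x0 * x1) + r22 * (x1 * x0) + r23 * (x1 * x1) = (x1 * x0)" "r30 *
      (x0 * x0) + r31 * (x0 * x1) + r32 * (x1 * x0) + r33 * (x1 * x1) = (x1 * x1)"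
  shows "listed ?R"
proof -
  have "\<exists>y0 y1. x0 * y1 - y0 * x1 = 1"
  proof (cases "x0 = 0")
    case True
    then show ?thesis using x by (intro exI[of _ "- 1 / x1"]) simp
  next
    case False
    then show ?thesis by (intro exI[of _ 0] exI[of _ "1 / x0"]) simp
  qed
  then obtain y0 y1 where det: "x0 * y1 - y0 * x1 = 1" by blast
  note inv = mat2_inverse[OF det]
  let ?K = "kron (mat2 x0 y0 x1 y1) (mat2 x0 y0 x1 y1)" and ?L = "kron (mat2 y1 (- y0) (- x1) x0) (mat2 y1 (- y0) (- x1) x0)"
  \<comment> \<open>The sixteen entries of the product get names, so that only the first column is
    ever computed.\<close>
  have "?R * ?K \<in> carrier_mat 4 4" by (simp add: kron_mat2 mat4_mult)
  then obtain w00 w01 w02 w03 w10 w11 w12 w13 w20 w21 w22 w23 w30 w31 w32 w33 where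
    w: "?R * ?K = mat4 w00 w01 w02 w03 w10 w11 w12 w13 w20 w21 w22 w23 w30 w31 w32 w33" by (rule mat4_cases)
  have w0: "w00 = x0 * x0" "w10 = x0 * x1" "w20 = x1 * x0" "w30 = x1 * x1"
    using w f unfolding kron_mat2 mat4_mult mat4_eq_iff by simp_all
  have "?L * ?R * ?K = ?L * (?R * ?K)"
    by (rule assoc_mult_mat[of _ 4 4 _ 4 _ 4]) (auto simp: kron_mat2)
  then obtain b c d q11 q12 q13 q21 q22 q23 q31 q32 q33 where e: "?L * ?R * ?K = mat4 1 b c d 0 q11 q12 q13 0 q21 q22 q23 0 q31 q32 q33"
  proof -
    let ?M = "?L * (?R * ?K)"
    have "?M \<in> carrier_mat 4 4" unfolding w by (simp add: kron_mat2 mat4_mult)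
    then obtain m00 m01 m02 m03 m10 m11 m12 m13 m20 m21 m22 m23 m30 m31 m32 m33 where
      m: "?M = mat4 m00 m01 m02 m03 m10 m11 m12 m13 m20 m21 m22 m23 m30 m31 m32 m33" by (rule mat4_cases)
    have "y1*y1*(x0*x0) + y1*(- y0)*(x0*x1) + (- y0)*y1*(x1*x0) + (- y0)*(- y0)*(x1*x1) = m00"
      using m[unfolded w, unfolded w0 kron_mat2 mat4_mult mat4_eq_iff] by (elim conjE)
    then have "m00 = (x0 * y1 - y0 * x1) * (x0 * y1 - y0 * x1)" by (simp add: algebra_simps)
    then have n0: "m00 = 1" using det by simp
    have "y1*(- x1)*(x0*x0) + y1*x0*(x0*x1) + (- y0)*(- x1)*(x1*x0) + (- y0)*x0*(x1*x1) = m10"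
      using m[unfolded w, unfolded w0 kron_mat2 mat4_mult mat4_eq_iff] by (elim conjE)
    then have n1: "m10 = 0" by (simp add: algebra_simps)
    have "(- x1)*y1*(x0*x0) + (- x1)*(- y0)*(x0*x1) + x0*y1*(x1*x0) + x0*(- y0)*(x1*x1) = m20"
      using m[unfolded w, unfolded w0 kron_mat2 mat4_mult mat4_eq_iff] by (elim conjE)
    then have n2: "m20 = 0" by (simp add: algebra_simps)
    have "(- x1)*(- x1)*(x0*x0) + (- x1)*x0*(x0*x1) + x0*(- x1)*(x1*x0) + x0*x0*(x1*x1) = m30"
      using m[unfolded w, unfolded w0 kron_mat2 mat4_mult mat4_eq_iff] by (elim conjE)
    then have n3: "m30 = 0" by (simp add: algebra_simps)
    show thesis using that m \<open>?L * ?R * ?K = ?M\<close> n0 n1 n2 n3 by metis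
  qed
  have "braiding (?L * ?R * ?K)" by (rule braiding_conj[OF mat2_carrier mat2_carrier inv R])
  then have "listed (?L * ?R * ?K)" unfolding e by (rule listed_first_column)
  then show ?thesis by (rule listed_conj[OF mat2_carrier mat2_carrier inv mat4_carrier])
qed

lemma quadratic_root:
  fixes a b c :: complex
  shows "\<exists>x0 x1. (x0 \<noteq> 0 \<or> x1 \<noteq> 0) \<and> a * (x0 * x0) + b * (x0 * x1) + c * (x1 * x1) = 0"
proof (cases "a = 0")
  case True
  then show ?thesis by (intro exI[of _ 1] exI[of _ 0]) simp
next
  case False
  define s where "s = csqrt (b * b - 4 * a * c)"
  have s: "s * s = b * b - 4 * a * c" using power2_csqrt[of "b * b - 4 * a * c"] by (simp add: s_def power2_eq_square)
  define x where "x = (s - b) / (2 * a)"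
  have x: "2 * a * x = s - b" using False by (simp add: x_def)
  have "4 * a * (a * (x * x) + b * x + c) = (2 * a * x) * (2 * a * x) + 2 * b * (2 * a * x) + 4 * a * c"
    by (simp add: algebra_simps)
  also have "\<dots> = 0" unfolding x using s by (simp add: algebra_simps)
  finally have "a * (x * x) + b * x + c = 0" using False by simp
  then show ?thesis by (intro exI[of _ x] exI[of _ 1]) simp
qed

text \<open>Never normalised directly: for s = -1 there is also a fixed square, for s = 1 and u1 = 0
  minus the transpose has one, and for s = 1 and u1 nonzero the braid relation fails by
  \<open>no_mixed_fixed_vector\<close>.\<close>

lemma listed_second_column:
  assumes R: "braiding (mat4 q11 0 q12 q13 e 1 g h q21 0 q22 q23 q31 0 q32 q33)"
  shows "listed (mat4 q11 0 q12 q13 e 1 g h q21 0 q22 q23 q31 0 q32 q33)"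
proof -
  note y = braidingD(3)[OF R]
  have i: "e + (e * q11 + g * q21 + h * q31) = 0" "g + (e * q12 + g * q22 + h * q32) = 0" "h + (e * q13 + g * q23 + h * q33) = 0"
    using braidingD(2)[OF R] by (simp_all add: mat4_algebra algebra_simps)
  have "q11 * q11 + q12 * q21 + q13 * q31 = 1" "q11 * q12 + q12 * q22 + q13 * q32 = 0" "q11 * q13 + q12 * q23 + q13 * q33 = 0" "q21 * q11 +
    q22 * q21 + q23 * q31 = 0" "q21 * q12 + q22 * q22 + q23 * q32 = 1" "q21 * q13 + q22 * q23 + q23 * q33 = 0" "q31 * q11 + q32 * q21 + q33
    * q31 = 0" "q31 * q12 + q32 * q22 + q33 * q32 = 0" "q31 * q13 + q32 * q23 + q33 * q33 = 1"
    using braidingD(2)[OF R] by (simp_all add: mat4_algebra)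
  then show ?thesis
  proof (cases rule: involution_3)
    case one
    then have "mat4 q11 0 q12 q13 e 1 g h q21 0 q22 q23 q31 0 q32 q33 = 1\<^sub>m 4" using i by (simp add: mat4_one)
    then show ?thesis using listed_std_forms(1) by simp
  next
    case minus_one
    then have "(2::complex) = 0"
      using y[of False True False False True False] by (simp only: ybe_raw) Groebner_Basis.algebra
    then show ?thesis by simp
  next
    case (reflection s u1 u2 u3 v1 v2 v3)
    let ?k = "e * u1 + g * u2 + h * u3"
    note q = reflection(3)
    from reflection(1) consider "s = 1" | "s = -1" by auto
    then show ?thesis
    proof cases
      case 1
      have "2 * (?k * v1) = 0" "2 * (?k * v2) = 0" "2 * (?k * v3) = 0"
        using i q 1 by (simp_all add: algebra_simps)
      then have "?k * v1 = 0" "?k * v2 = 0" "?k * v3 = 0" by simp_all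
      then have k: "?k = 0" using reflection(2) by Groebner_Basis.algebra
      show ?thesis
      proof (cases "u1 = 0")
        case True
        \<comment> \<open>The first row of R is minus a unit vector, so minus the transpose fixes e0
          \<otimes> e0.\<close>
        then have q': "q11 = -1" "q12 = 0" "q13 = 0" using q 1 by simp_all
        have t: "- transpose_mat (mat4 q11 0 q12 q13 e 1 g h q21 0 q22 q23 q31 0 q32 q33) =
            mat4 1 (- e) (- q21) (- q31) 0 (-1) 0 0 0 (- g) (- q22) (- q32) 0 (- h) (- q23) (- q33)"
          by (simp add: mat4_algebra q')
        have "listed (- transpose_mat (mat4 q11 0 q12 q13 e 1 g h q21 0 q22 q23 q31 0 q32 q33))"
          using braiding_uminus[OF braiding_transpose[OF R]] unfolding t by (rule listed_first_column)
        then show ?thesis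
          by (intro listed_transpose[OF mat4_carrier] listed_uminus[OF transpose_carrier_mat[THEN iffD2, OF mat4_carrier]])
      next
        case False
        let ?v2 = "v2 * u1" and ?v3 = "v3 * u1" and ?u2 = "u2 / u1" and ?u3 = "u3 / u1"
        have v1: "v1 * u1 = 1 - ?u2 * ?v2 - ?u3 * ?v3" using reflection(2) False by (simp add: algebra_simps)
        have "e * u1 = - g * u2 - h * u3" using k by Groebner_Basis.algebra
        then have e: "e = - g * ?u2 - h * ?u3" using False by (simp add: field_simps)
        have "mat4 q11 0 q12 q13 e 1 g h q21 0 q22 q23 q31 0 q32 q33 =
          mat4 (2 * (1 - ?u2 * ?v2 - ?u3 * ?v3) - 1) 0 (2 * ?v2) (2 * ?v3) (- g * ?u2 - h * ?u3) 1 g h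
            (2 * ?u2 * (1 - ?u2 * ?v2 - ?u3 * ?v3)) 0 (2 * ?u2 * ?v2 - 1) (2 * ?u2 * ?v3)
            (2 * ?u3 * (1 - ?u2 * ?v2 - ?u3 * ?v3)) 0 (2 * ?u3 * ?v2) (2 * ?u3 * ?v3 - 1)"
          unfolding v1[symmetric] using q 1 False by (simp add: e mult.commute)
        then show ?thesis
          using no_mixed_fixed_vector[of _ ?u2 ?v2 ?u3 ?v3 g h] R by (metis braiding_def)
      qed
    next
      case 2
      have "2 * e = 2 * (?k * v1)" "2 * g = 2 * (?k * v2)" "2 * h = 2 * (?k * v3)"
        using i q 2 by (simp_all add: algebra_simps)
      then have b: "e = ?k * v1" "g = ?k * v2" "h = ?k * v3" by simp_all
      define k where "k = ?k"
      note b = b[folded k_def]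
      \<comment> \<open>R fixes the whole hyperplane cut out by v in the coordinates of e0 \<otimes>
        e0, e1 \<otimes> e0 and e1 \<otimes> e1. On squares x \<otimes> x its equation is a binary
        quadratic form.\<close>
      obtain x0 x1 where x: "x0 \<noteq> 0 \<or> x1 \<noteq> 0" and z: "v1 * (x0 * x0) + v2 * (x0 * x1) + v3 * (x1 * x1) = 0"
        using quadratic_root by blast
      have q': "q11 = 1 - 2 * u1 * v1" "q12 = 0 - 2 * u1 * v2" "q13 = 0 - 2 * u1 * v3" "q21 = 0 - 2 * u2 * v1" "q22 = 1 - 2 * u2 * v2" "q23
        = 0 - 2 * u2 * v3" "q31 = 0 - 2 * u3 * v1" "q32 = 0 - 2 * u3 * v2" "q33 = 1 - 2 * u3 * v3"
        using q 2 by simp_all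
      show ?thesis
        by (rule listed_square_fixed[OF R x]; insert z; unfold q' b; Groebner_Basis.algebra)
    qed
  qed
qed

text \<open>Parallel factors give a fixed square; independent ones, with a divided by their
  determinant, form a basis in which e0 \<otimes> e1 is fixed.\<close>

lemma listed_tensor_fixed:
  assumes R: "braiding (mat4 r00 r01 r02 r03 r10 r11 r12 r13 r20 r21 r22 r23 r30 r31 r32 r33)" (is "braiding ?R") and a: "a0 \<noteq> 0 \<or> a1 \<noteq> 0"
    and b: "b0 \<noteq> 0 \<or> b1 \<noteq> 0"
    and f: "r00 * (a0 * b0) + r01 * (a0 * b1) + r02 * (a1 * b0) + r03 * (a1 * b1) = (a0 * b0)" "r10 * (a0 * b0) + r11 * (a0 * b1) + r12 *
      (a1 * b0) + r13 * (a1 * b1) = (a0 * b1)" "r20 * (a0 * b0) + r21 * (a0 * b1) + r22 * (a1 * b0) + r23 * (a1 * b1) = (a1 * b0)" "r30 *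
      (a0 * b0) + r31 * (a0 * b1) + r32 * (a1 * b0) + r33 * (a1 * b1) = (a1 * b1)"
  shows "listed ?R"
proof (cases "a0 * b1 - b0 * a1 = 0")
  case True
  have "\<exists>l. b0 = l * a0 \<and> b1 = l * a1"
  proof (cases "a0 = 0")
    case True
    then show ?thesis using \<open>a0 * b1 - b0 * a1 = 0\<close> a by (intro exI[of _ "b1 / a1"]) auto
  next
    case False
    then show ?thesis using True by (intro exI[of _ "b0 / a0"]) (simp add: field_simps)
  qed
  then obtain l where l: "b0 = l * a0" "b1 = l * a1" by blast
  then have "l \<noteq> 0" using b by auto
  have g: "l * (r00 * (a0 * a0) + r01 * (a0 * a1) + r02 * (a1 * a0) + r03 * (a1 * a1) - a0 * a0) = 0" "l * (r10 * (a0 * a0) + r11 * (a0 *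
    a1) + r12 * (a1 * a0) + r13 * (a1 * a1) - a0 * a1) = 0" "l * (r20 * (a0 * a0) + r21 * (a0 * a1) + r22 * (a1 * a0) + r23 * (a1 * a1) - a1
    * a0) = 0" "l * (r30 * (a0 * a0) + r31 * (a0 * a1) + r32 * (a1 * a0) + r33 * (a1 * a1) - a1 * a1) = 0"
    using f unfolding l by Groebner_Basis.algebra+
  show ?thesis
    by (rule listed_square_fixed[OF R a]) (use g \<open>l \<noteq> 0\<close> in simp_all)
next
  case False
  let ?D = "a0 * b1 - b0 * a1" and ?R = "mat4 r00 r01 r02 r03 r10 r11 r12 r13 r20 r21 r22 r23 r30 r31 r32 r33"
  define c0 c1 where "c0 = a0 / ?D" and "c1 = a1 / ?D"
  have det: "c0 * b1 - b0 * c1 = 1" using False by (simp add: c0_def c1_def diff_divide_distrib[symmetric])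
  have ac: "a0 = ?D * c0" "a1 = ?D * c1" using False by (simp_all add: c0_def c1_def)
  have f': "r00 * (c0 * b0) + r01 * (c0 * b1) + r02 * (c1 * b0) + r03 * (c1 * b1) = (c0 * b0)" "r10 * (c0 * b0) + r11 * (c0 * b1) + r12 *
    (c1 * b0) + r13 * (c1 * b1) = (c0 * b1)" "r20 * (c0 * b0) + r21 * (c0 * b1) + r22 * (c1 * b0) + r23 * (c1 * b1) = (c1 * b0)" "r30 * (c0
    * b0) + r31 * (c0 * b1) + r32 * (c1 * b0) + r33 * (c1 * b1) = (c1 * b1)"
  proof -
    have "?D * (r00 * (c0 * b0) + r01 * (c0 * b1) + r02 * (c1 * b0) + r03 * (c1 * b1) - c0 * b0) = 0"
      using f(1) ac by Groebner_Basis.algebra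
    then show "r00 * (c0 * b0) + r01 * (c0 * b1) + r02 * (c1 * b0) + r03 * (c1 * b1) = (c0 * b0)" using False by simp
    have "?D * (r10 * (c0 * b0) + r11 * (c0 * b1) + r12 * (c1 * b0) + r13 * (c1 * b1) - (c0 * b1)) = 0"
      using f(2) ac by Groebner_Basis.algebra
    then show "r10 * (c0 * b0) + r11 * (c0 * b1) + r12 * (c1 * b0) + r13 * (c1 * b1) = (c0 * b1)" using False by simp
    have "?D * (r20 * (c0 * b0) + r21 * (c0 * b1) + r22 * (c1 * b0) + r23 * (c1 * b1) - (c1 * b0)) = 0"
      using f(3) ac by Groebner_Basis.algebra
    then show "r20 * (c0 * b0) + r21 * (c0 * b1) + r22 * (c1 * b0) + r23 * (c1 * b1) = (c1 * b0)" using False by simp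
    have "?D * (r30 * (c0 * b0) + r31 * (c0 * b1) + r32 * (c1 * b0) + r33 * (c1 * b1) - (c1 * b1)) = 0"
      using f(4) ac by Groebner_Basis.algebra
    then show "r30 * (c0 * b0) + r31 * (c0 * b1) + r32 * (c1 * b0) + r33 * (c1 * b1) = (c1 * b1)" using False by simp
  qed
  note inv = mat2_inverse[OF det]
  let ?K = "kron (mat2 c0 b0 c1 b1) (mat2 c0 b0 c1 b1)" and ?L = "kron (mat2 b1 (- b0) (- c1) c0) (mat2 b1 (- b0) (- c1) c0)"
  have "?R * ?K \<in> carrier_mat 4 4" by (simp add: kron_mat2 mat4_mult)
  then obtain w00 w01 w02 w03 w10 w11 w12 w13 w20 w21 w22 w23 w30 w31 w32 w33 where w: "?R * ?K = mat4 w00 w01 w02 w03 w10 w11 w12 w13 w20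
    w21 w22 w23 w30 w31 w32 w33" by (rule mat4_cases)
  have w0: "w01 = c0 * b0" "w11 = c0 * b1" "w21 = c1 * b0" "w31 = c1 * b1"
    using w f' unfolding kron_mat2 mat4_mult mat4_eq_iff by simp_all
  have "?L * ?R * ?K = ?L * (?R * ?K)"
    by (rule assoc_mult_mat[of _ 4 4 _ 4 _ 4]) (auto simp: kron_mat2)
  then obtain q11 q12 q13 e g h q21 q22 q23 q31 q32 q33 where
    e: "?L * ?R * ?K = mat4 q11 0 q12 q13 e 1 g h q21 0 q22 q23 q31 0 q32 q33"
  proof -
    let ?M = "?L * (?R * ?K)"
    have "?M \<in> carrier_mat 4 4" unfolding w by (simp add: kron_mat2 mat4_mult)
    then obtain m00 m01 m02 m03 m10 m11 m12 m13 m20 m21 m22 m23 m30 m31 m32 m33 where m: "?M = mat4 m00 m01 m02 m03 m10 m11 m12 m13 m20 m21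
      m22 m23 m30 m31 m32 m33" by (rule mat4_cases)
    have "b1*b1*(c0*b0) + b1*(- b0)*(c0*b1) + (- b0)*b1*(c1*b0) + (- b0)*(- b0)*(c1*b1) = m01"
      using m[unfolded w, unfolded w0 kron_mat2 mat4_mult mat4_eq_iff] by (elim conjE)
    then have n0: "m01 = 0" by (simp add: algebra_simps)
    have "b1*(- c1)*(c0*b0) + b1*c0*(c0*b1) + (- b0)*(- c1)*(c1*b0) + (- b0)*c0*(c1*b1) = m11"
      using m[unfolded w, unfolded w0 kron_mat2 mat4_mult mat4_eq_iff] by (elim conjE)
    then have "m11 = (c0 * b1 - b0 * c1) * (c0 * b1 - b0 * c1)" by (simp add: algebra_simps)
    then have n1: "m11 = 1" using det by simp
    have "(- c1)*b1*(c0*b0) + (- c1)*(- b0)*(c0*b1) + c0*b1*(c1*b0) + c0*(- b0)*(c1*b1) = m21"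
      using m[unfolded w, unfolded w0 kron_mat2 mat4_mult mat4_eq_iff] by (elim conjE)
    then have n2: "m21 = 0" by (simp add: algebra_simps)
    have "(- c1)*(- c1)*(c0*b0) + (- c1)*c0*(c0*b1) + c0*(- c1)*(c1*b0) + c0*c0*(c1*b1) = m31"
      using m[unfolded w, unfolded w0 kron_mat2 mat4_mult mat4_eq_iff] by (elim conjE)
    then have n3: "m31 = 0" by (simp add: algebra_simps)
    show thesis using that m \<open>?L * ?R * ?K = ?M\<close> n0 n1 n2 n3 by metis
  qed
  have "braiding (?L * ?R * ?K)" by (rule braiding_conj[OF mat2_carrier mat2_carrier inv R])
  then have "listed (?L * ?R * ?K)" unfolding e by (rule listed_second_column)
  then show ?thesis by (rule listed_conj[OF mat2_carrier mat2_carrier inv mat4_carrier])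
qed

lemma listed_two_fixed:
  assumes R: "braiding (mat4 r00 r01 r02 r03 r10 r11 r12 r13 r20 r21 r22 r23 r30 r31 r32 r33)" (is "braiding ?R")
    and fx: "r00 * x0 + r01 * x1 + r02 * x2 + r03 * x3 = x0" "r10 * x0 + r11 * x1 + r12 * x2 + r13 * x3 = x1" "r20 * x0 + r21 * x1 + r22 *
      x2 + r23 * x3 = x2" "r30 * x0 + r31 * x1 + r32 * x2 + r33 * x3 = x3"
    and fy: "r00 * y0 + r01 * y1 + r02 * y2 + r03 * y3 = y0" "r10 * y0 + r11 * y1 + r12 * y2 + r13 * y3 = y1" "r20 * y0 + r21 * y1 + r22 *
      y2 + r23 * y3 = y2" "r30 * y0 + r31 * y1 + r32 * y2 + r33 * y3 = y3"
    and ind: "\<And>s t. s * x0 + t * y0 = 0 \<Longrightarrow> s * x1 + t * y1 = 0 \<Longrightarrow> s * x2 + t * y2 = 0 \<Longrightarrow> s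
      * x3 + t * y3 = 0 \<Longrightarrow> s = 0 \<and> t = 0"
  shows "listed ?R"
proof -
  obtain s t where st: "s \<noteq> 0 \<or> t \<noteq> 0"
    and det: "(x0 * x3 - x1 * x2) * (s * s) + (x0 * y3 + y0 * x3 - x1 * y2 - y1 * x2) * (s * t) + (y0 * y3 - y1 * y2) * (t * t) = 0"
    using quadratic_root by blast
  define z0 z1 z2 z3 where z: "z0 = s * x0 + t * y0" "z1 = s * x1 + t * y1" "z2 = s * x2 + t * y2" "z3 = s * x3 + t * y3"
  have lin: "a * (s * x0 + t * y0) + b * (s * x1 + t * y1) + c * (s * x2 + t * y2) + d * (s * x3 + t * y3) = s * v + t * w"
    if "a * x0 + b * x1 + c * x2 + d * x3 = v" "a * y0 + b * y1 + c * y2 + d * y3 = w" for a b c d v w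
    unfolding that[symmetric] by (simp add: algebra_simps)
  have fz: "r00 * z0 + r01 * z1 + r02 * z2 + r03 * z3 = z0" "r10 * z0 + r11 * z1 + r12 * z2 + r13 * z3 = z1" "r20 * z0 + r21 * z1 + r22 * z2
    + r23 * z3 = z2" "r30 * z0 + r31 * z1 + r32 * z2 + r33 * z3 = z3"
    unfolding z using lin[OF fx(1) fy(1)] lin[OF fx(2) fy(2)] lin[OF fx(3) fy(3)] lin[OF fx(4) fy(4)] .
  \<comment> \<open>The condition for z to be a pure tensor.\<close>
  have d: "z0 * z3 = z1 * z2" unfolding z using det by Groebner_Basis.algebra
  have nz: "z0 \<noteq> 0 \<or> z1 \<noteq> 0 \<or> z2 \<noteq> 0 \<or> z3 \<noteq> 0" using ind[of s t] st unfolding z by blast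
  show ?thesis
  \<comment> \<open>The factorisation is e1 \<otimes> (z2, z3) in the first case and (1, l)
    \<otimes> (z0, z1) in the second.\<close>
  proof (cases "z0 = 0 \<and> z1 = 0")
    case True
    then show ?thesis
      using listed_tensor_fixed[OF R, of 0 1 z2 z3] fz nz by simp
  next
    case False
    have "\<exists>l. z2 = l * z0 \<and> z3 = l * z1"
    proof (cases "z0 = 0")
      case True
      then show ?thesis using False d by (intro exI[of _ "z3 / z1"]) auto
    next
      case z0: False
      then show ?thesis using d by (intro exI[of _ "z2 / z0"]) (simp add: field_simps)
    qed
    then obtain l where "z2 = l * z0" "z3 = l * z1" by blast
    then show ?thesis
      using listed_tensor_fixed[OF R, of 1 l z0 z1] fz False by simp
  qed
qed

text \<open>Columns of 1 + R are fixed by R because R * R = 1. Either columns 0 and 1 or columns 2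
  and 3 are independent, or a dependency in each pair gives a vector negated by R; those two vectors
  have disjoint supports and are therefore independent.\<close>

lemma braiding_listed:
  assumes "braiding R"
  shows "listed R"
proof -
  obtain r00 r01 r02 r03 r10 r11 r12 r13 r20 r21 r22 r23 r30 r31 r32 r33 where R4: "R = mat4 r00 r01 r02 r03 r10 r11 r12 r13 r20 r21 r22 r23
    r30 r31 r32 r33"
    using mat4_cases[OF braidingD(1)[OF assms]] .
  note R = assms[unfolded R4]
  have sq: "mat4 r00 r01 r02 r03 r10 r11 r12 r13 r20 r21 r22 r23 r30 r31 r32 r33 * mat4 r00 r01 r02 r03 r10 r11 r12 r13 r20 r21 r22 r23 r30
    r31 r32 r33 = 1\<^sub>m 4" by (rule braidingD(2)[OF R])
  note sq = sq[unfolded mat4_mult mat4_one mat4_eq_iff]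
  let ?ind = "\<lambda>x0 x1 x2 x3 y0 y1 y2 y3. \<forall>s t. s * x0 + t * y0 = (0::complex) \<longrightarrow> s * x1 + t * y1 = 0 \<longrightarrow>
    s * x2 + t * y2 = 0 \<longrightarrow> s * x3 + t * y3 = 0 \<longrightarrow> s = 0 \<and> t = 0"
  consider "?ind (1 + r00) r10 r20 r30 r01 (1 + r11) r21 r31" | "?ind r02 r12 (1 + r22) r32 r03 r13 r23 (1 + r33)"
    | s t s' t' where "s \<noteq> 0 \<or> t \<noteq> 0" "s' \<noteq> 0 \<or> t' \<noteq> 0"
      "s * (1 + r00) + t * r01 = 0" "s * r10 + t * (1 + r11) = 0" "s * r20 + t * r21 = 0" "s * r30 + t * r31 = 0"
      "s' * r02 + t' * r03 = 0" "s' * r12 + t' * r13 = 0" "s' * (1 + r22) + t' * r23 = 0" "s' * r32 + t' * (1 + r33) = 0"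
    by blast
  then show ?thesis
  proof cases
    case 1
    show ?thesis unfolding R4
      by (rule listed_two_fixed[OF R, of "1 + r00" r10 r20 r30 r01 "1 + r11" r21 r31])
        ((insert sq; elim conjE; Groebner_Basis.algebra)+, (use 1 in blast)+)
  next
    case 2
    show ?thesis unfolding R4
      by (rule listed_two_fixed[OF R, of r02 r12 "1 + r22" r32 r03 r13 r23 "1 + r33"])
        ((insert sq; elim conjE; Groebner_Basis.algebra)+, (use 2 in blast)+)
  next
    case 3
    have "listed (mat4 (- r00) (- r01) (- r02) (- r03) (- r10) (- r11) (- r12) (- r13) (- r20) (- r21) (- r22) (- r23) (- r30) (- r31) (-
      r32) (- r33))"
    proof (rule listed_two_fixed[of _ _ _ _ _ _ _ _ _ _ _ _ _ _ _ _ s t 0 0 0 0 s' t'])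
      show "braiding (mat4 (- r00) (- r01) (- r02) (- r03) (- r10) (- r11) (- r12) (- r13) (- r20) (- r21) (- r22) (- r23) (- r30) (- r31)
        (- r32) (- r33))"
        using braiding_uminus[OF R] by (simp add: mat4_uminus)
    qed (insert 3, auto, Groebner_Basis.algebra+)
    then show ?thesis unfolding R4 by (rule listed_mat4_uminus)
  qed
qed

section \<open>The classification\<close>

lemma conj_conj_inverse:
  assumes "A \<in> carrier_mat 2 2" "B \<in> carrier_mat 2 2" "A * B = 1\<^sub>m 2" "B * A = 1\<^sub>m 2" and X: "X \<in> carrier_mat 4 4"
  shows "kron B B * (kron A A * X * kron B B) * kron A A = X"
proof -
  let ?P = "kron A A" and ?Q = "kron B B"
  have c: "?P \<in> carrier_mat 4 4" "?Q \<in> carrier_mat 4 4" using assms(1,2) by auto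
  have i: "?Q * ?P = 1\<^sub>m 4" by (rule kron_square_inverse[OF assms(2,1,4)])
  have "?Q * (?P * X * ?Q) * ?P = ?Q * (?P * (X * (?Q * ?P)))"
    using c X by (simp add: assoc_mult_mat[of _ 4 4 _ 4 _ 4])
  also have "\<dots> = X" using c X i by (simp add: mat_left_cancel[OF c(2,1) _ i])
  finally show ?thesis .
qed

lemma pair_equiv_conj:
  assumes "A \<in> carrier_mat 2 2" "B \<in> carrier_mat 2 2" "A * B = 1\<^sub>m 2" "B * A = 1\<^sub>m 2"
    and "R \<in> carrier_mat 4 4" "S \<in> carrier_mat 4 4"
  shows "pair_equiv 2 (R, S) (kron A A * R * kron B B, kron A A * S * kron B B)"
proof -
  have c: "kron A A \<in> carrier_mat 4 4" "kron B B \<in> carrier_mat 4 4" using assms(1,2) by auto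
  have "invertible_mat A" unfolding invertible_mat_def inverts_mat_def using assms(1-4) by auto
  moreover have "inverts_mat (kron A A) (kron B B)" "inverts_mat (kron B B) (kron A A)"
    unfolding inverts_mat_def using c kron_square_inverse[OF assms(1,2,3)] kron_square_inverse[OF assms(2,1,4)] by auto
  ultimately have "local_equiv 2 (R, S) (kron A A * R * kron B B, kron A A * S * kron B B)"
    unfolding local_equiv_def prod.case using assms(1,5,6) c by (intro conjI bexI[of _ A] bexI[of _ "kron B B"]) simp_all
  then show ?thesis unfolding pair_equiv_def by (intro r_into_equivclp) simp
qed

lemma pair_equiv_transpose: "pair_equiv 2 (R, S) (transpose_mat R, transpose_mat S)"
  unfolding pair_equiv_def by (intro r_into_equivclp) (simp add: transpose_step_def)

lemma pair_equiv_sign: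
  "R' = R \<or> R' = - R \<Longrightarrow> S' = S \<or> S' = - S \<Longrightarrow> pair_equiv 2 (R, S) (R', S')"
  unfolding pair_equiv_def by (intro r_into_equivclp) (simp add: sign_step_def)

lemma pair_equiv_refl: "pair_equiv N x x"
  by (simp add: pair_equiv_def)

lemma pair_equiv_trans: "pair_equiv N x y \<Longrightarrow> pair_equiv N y z \<Longrightarrow> pair_equiv N x z"
  unfolding pair_equiv_def by (rule equivclp_trans)

lemma local_equiv_md_pair_iff:
  assumes "local_equiv 2 (R, S) (R', S')"
  shows "md_pair 2 R S \<longleftrightarrow> md_pair 2 R' S'"
proof -
  obtain A Q where A: "A \<in> carrier_mat 2 2" and Q: "Q \<in> carrier_mat 4 4"
    and inv: "invertible_mat A" and PQ: "inverts_mat (kron A A) Q" "inverts_mat Q (kron A A)"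
    and eq: "R' = kron A A * R * Q" "S' = kron A A * S * Q" and RS: "R \<in> carrier_mat 4 4" "S \<in> carrier_mat 4 4"
    using assms unfolding local_equiv_def by auto
  obtain B where AB: "A * B = 1\<^sub>m (dim_row A)" "B * A = 1\<^sub>m (dim_row B)"
    using inv unfolding invertible_mat_def inverts_mat_def by auto
  have "dim_col B = 2" using arg_cong[OF AB(1), of dim_col] A by simp
  moreover have "dim_row B = 2" using arg_cong[OF AB(2), of dim_col] A by simp
  ultimately have B: "B \<in> carrier_mat 2 2" by (intro carrier_matI)
  have AB: "A * B = 1\<^sub>m 2" "B * A = 1\<^sub>m 2" using AB A B by auto
  have c: "kron A A \<in> carrier_mat 4 4" "kron B B \<in> carrier_mat 4 4" using A B by auto
  have "Q * kron A A = 1\<^sub>m 4" using PQ(2) Q unfolding inverts_mat_def by simp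
  \<comment> \<open>In \<open>local_equiv\<close> the inverse \<open>Q\<close> is an arbitrary
    matrix; uniqueness of inverses identifies it with \<open>kron B B\<close>.\<close>
  then have "Q * (kron A A * kron B B) = kron B B" by (rule mat_left_cancel[OF Q c(1,2)])
  then have Q: "Q = kron B B" using kron_square_inverse[OF A B AB(1)] Q by simp
  show ?thesis
  proof
    assume "md_pair 2 R S"
    then show "md_pair 2 R' S'" unfolding eq Q by (rule md_pair_conj[OF A B AB])
  next
    assume "md_pair 2 R' S'"
    then have "md_pair 2 (kron B B * R' * kron A A) (kron B B * S' * kron A A)"
      by (rule md_pair_conj[OF B A AB(2,1)])
    then show "md_pair 2 R S" unfolding eq Q by (simp only: conj_conj_inverse[OF A B AB] RS)
  qed
qed

lemma pair_equiv_md_pair: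
  assumes "pair_equiv 2 (R, S) (R', S')"
  shows "md_pair 2 R S \<longleftrightarrow> md_pair 2 R' S'"
proof -
  let ?md = "\<lambda>x. md_pair 2 (fst x) (snd x)"
  have step: "?md x \<longleftrightarrow> ?md y" if "local_equiv 2 x y \<or> transpose_step x y \<or> sign_step x y" for x y
  proof -
    obtain R S R' S' where xy: "x = (R, S)" "y = (R', S')" by (cases x, cases y)
    from that consider "local_equiv 2 (R, S) (R', S')" | "R' = transpose_mat R" "S' = transpose_mat S"
      | "R' = R \<or> R' = - R" "S' = S \<or> S' = - S"
      unfolding xy transpose_step_def sign_step_def prod.case by metis
    then show ?thesis unfolding xy fst_conv snd_conv
    proof cases
      case 1
      then show "md_pair 2 R S \<longleftrightarrow> md_pair 2 R' S'" by (rule local_equiv_md_pair_iff)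
    next
      case 2
      then show "md_pair 2 R S \<longleftrightarrow> md_pair 2 R' S'"
        using md_pair_transpose[of R S] md_pair_transpose[of R' S'] by (metis transpose_transpose)
    next
      case 3
      then have "R = R' \<or> R = - R'" "S = S' \<or> S = - S'" by auto
      with 3 show "md_pair 2 R S \<longleftrightarrow> md_pair 2 R' S'" using md_pair_sign by metis
    qed
  qed
  have "?md (R, S) \<longleftrightarrow> ?md (R', S')"
    using assms unfolding pair_equiv_def by (induction rule: equivclp_induct) (use step in blast)+
  then show ?thesis by simp
qed

text \<open>The partner is carried along without control over its shape. This is enough, since the
  relations are invariant and the partner of the standard form is solved for afterwards.\<close>

lemma orbit_pair_equiv:
  assumes "orbit R0 R" "S \<in> carrier_mat 4 4"
  shows "\<exists>S0. pair_equiv 2 (R, S) (R0, S0)"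
  using assms
proof (induction arbitrary: S)
  case orbit_refl
  then show ?case using pair_equiv_refl by blast
next
  case (orbit_conj A B R)
  then show ?case
    using pair_equiv_trans[OF pair_equiv_conj] conj_carrier by metis
next
  case (orbit_transpose R)
  then show ?case using pair_equiv_trans[OF pair_equiv_transpose] transpose_carrier_mat by metis
next
  case (orbit_uminus R)
  then show ?case using pair_equiv_trans[OF pair_equiv_sign[of "- R" R S S]] by blast
qed

lemma flip_conj:
  assumes "A \<in> carrier_mat 2 2" "B \<in> carrier_mat 2 2" "A * B = 1\<^sub>m 2"
  shows "kron A A * flip * kron B B = flip"
proof -
  have f: "flip \<in> carrier_mat 4 4" by (simp add: entries_mat4)
  obtain a b c d where A: "A = mat2 a b c d" using mat2_cases[OF assms(1)] .
  have "kron A A * flip = flip * kron A A" unfolding A by (simp add: mat4_algebra entries_mat4 mult.commute)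
  then have "kron A A * flip * kron B B = flip * (kron A A * kron B B)"
    using f kron_square_carrier[OF assms(1)] kron_square_carrier[OF assms(2)]
    by (simp add: assoc_mult_mat[of flip 4 4 _ 4 _ 4])
  then show ?thesis using f by (simp add: kron_square_inverse[OF assms])
qed

lemma flip_transpose: "transpose_mat flip = flip"
  by (simp add: entries_mat4 mat4_transpose)

text \<open>The flip is unchanged by every step: it is symmetric, and a sign can be placed on S
  alone.\<close>

lemma orbit_flip_pair_equiv:
  "orbit S0 S \<Longrightarrow> pair_equiv 2 (flip, S) (flip, S0)"
proof (induction rule: orbit.induct)
  case orbit_refl
  show ?case by (rule pair_equiv_refl)
next
  case (orbit_conj A B R)
  have "flip \<in> carrier_mat 4 4" by (simp add: entries_mat4)
  from pair_equiv_conj[OF orbit_conj(1-4) this orbit_conj(6)] have "pair_equiv 2 (flip, R) (flip, kron A A * R * kron B B)"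
    by (simp only: flip_conj[OF orbit_conj(1-3)])
  then show ?case using orbit_conj.IH by (rule pair_equiv_trans)
next
  case (orbit_transpose R)
  show ?case
    using pair_equiv_transpose[of flip R] orbit_transpose.IH unfolding flip_transpose by (rule pair_equiv_trans)
next
  case (orbit_uminus R)
  show ?case using pair_equiv_sign[of flip flip "- R" R] orbit_uminus.IH by (blast intro: pair_equiv_trans)
qed

section \<open>Every listed pair satisfies the relations\<close>

lemma md_pair_slash:
  assumes "p \<noteq> 0" "q \<noteq> 0" "e\<^sup>2 = 1" "f\<^sup>2 = 1"
  shows "md_pair 2 (slash p e) (slash q f)"
  using assms square_one(1)[of p e] square_one(1)[of q f] by (simp add: md_pair_2 ybe_slash entries_carrier)

lemma md_pair_a_glue_sgn: "e\<^sup>2 = 1 \<Longrightarrow> md_pair 2 (a_glue_sgn e p) (a_glue_sgn e q)"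
  using square_one(2)[of e p] square_one(2)[of e q] ybe_a_glue_sgn[of e] by (simp add: md_pair_2 entries_carrier)

lemma a_glue_eq: "a_glue p = a_glue_sgn 1 p"
  by (simp add: entries_mat4)

lemma slash_eq: "p\<^sup>2 = 1 \<Longrightarrow> slash p (-1) = a_glue_sgn p 0"
  by (auto simp: entries_mat4 power2_eq_1_iff)

lemma md_pair_f_glue:
  assumes "S \<in> S_f_glue p q"
  shows "md_pair 2 (f_glue p q) S"
proof (cases "p = - q")
  case True
  then obtain s where "S = f_glue (- s) s" using assms by (auto simp: S_f_glue_def)
  then show ?thesis unfolding True by (simp add: md_pair_2 entries_carrier square_one(3) ybe_f_glue_neg)
next
  case False
  then have "S = f_glue p q" using assms by (simp add: S_f_glue_def)
  then show ?thesis by (simp add: md_pair_2 entries_carrier square_one(3) ybe_f_glue)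
qed

lemma md_pair_anti_slash_gen:
  assumes "s \<noteq> 0" "e\<^sup>2 = 1"
  shows "md_pair 2 (slash (-1) 1) (anti_slash_gen s e)"
  unfolding md_pair_2
  using ybe_anti_slash_gen[OF assms] square_one(4)[OF assms] square_one(1)[of "-1" 1] ybe_slash[of "-1" "-1" "-1" 1 1 1]
  by (simp add: entries_carrier)

lemma md_pair_S_f_slash: "p \<noteq> 0 \<Longrightarrow> S \<in> S_f_slash p \<Longrightarrow> md_pair 2 (slash p 1) S"
  unfolding S_f_slash_def
  by (auto intro: md_pair_slash md_pair_anti_slash_gen split: if_splits)

lemma md_pair_S_a_slash:
  assumes "p \<noteq> 0" "S \<in> S_a_slash p"
  shows "md_pair 2 (slash p (-1)) S"
proof -
  consider s e where "S = slash s e" "s \<noteq> 0" "e\<^sup>2 = 1" | s where "p\<^sup>2 = 1" "S = a_glue_sgn p s"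
    using assms(2) by (auto simp: S_a_slash_def split: if_splits)
  then show ?thesis
    by cases (use assms(1) in \<open>simp_all add: md_pair_slash slash_eq md_pair_a_glue_sgn\<close>)
qed

lemma md_pair_S_a_glue: "S \<in> S_a_glue \<Longrightarrow> md_pair 2 (a_glue p) S"
  unfolding S_a_glue_def a_glue_eq by (auto intro: md_pair_a_glue_sgn)

lemma md_pair_S_identity: "S \<in> S_identity \<Longrightarrow> md_pair 2 (1\<^sub>m 4) S"
proof -
  have "md_pair 2 (1\<^sub>m 4) (1\<^sub>m 4)" by (simp add: md_pair_2 ybe_def)
  then show "S \<in> S_identity \<Longrightarrow> md_pair 2 (1\<^sub>m 4) S"
    unfolding S_identity_def by (auto intro: md_pair_sign)
qed

lemma flip_eq: "flip = slash 1 1" "flip = f_glue (- 0) 0"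
  by (simp_all add: entries_mat4)

lemma md_pair_flip_f_glue: "md_pair 2 flip (f_glue (- q) q)"
  unfolding flip_eq(2) by (rule md_pair_f_glue) (auto simp: S_f_glue_def)

lemma md_pair_flip_anti_slash: "md_pair 2 flip anti_slash"
  unfolding md_pair_2 by (simp add: entries_mat4 ybe_2_mat4 ybe_expand mat4_algebra)

lemma md_pair_S_flip: "S \<in> S_flip \<Longrightarrow> md_pair 2 flip S"
  using md_pair_flip_f_glue md_pair_flip_anti_slash md_pair_slash[of 1 _ 1] md_pair_slash[of 1 1 1 1] unfolding S_flip_def
  by (auto simp: flip_eq(1)[symmetric])

lemma md_pair_up_to_sign:
  "S \<in> up_to_sign X \<Longrightarrow> (\<And>S. S \<in> X \<Longrightarrow> md_pair 2 R S) \<Longrightarrow> md_pair 2 R S"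
  unfolding up_to_sign_def by (auto intro: md_pair_sign)

section \<open>The possible S for each normalised R\<close>

lemma md_pair_Collect_eqI:
  assumes "\<And>S. S \<in> carrier_mat 4 4 \<Longrightarrow> ybe 2 R R S \<Longrightarrow> ybe 2 R S S \<Longrightarrow> S * S = 1\<^sub>m
    4 \<Longrightarrow> S \<in> X"
    and "\<And>S. S \<in> X \<Longrightarrow> md_pair 2 R S"
  shows "{S. md_pair 2 R S} = X"
proof (intro equalityI subsetI CollectI)
  fix S assume "S \<in> {S. md_pair 2 R S}"
  then have "md_pair 2 R S" by simp
  then show "S \<in> X" unfolding md_pair_2 by (elim conjE) (rule assms(1))
qed (rule assms(2))

lemma S_given_one: "{S. md_pair 2 (1\<^sub>m 4) S} = S_identity"
  by (rule md_pair_Collect_eqI[OF solve_one md_pair_S_identity])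

lemma S_given_a_glue: "p \<noteq> 0 \<Longrightarrow> {S. md_pair 2 (a_glue p) S} = up_to_sign S_a_glue"
  by (rule md_pair_Collect_eqI[OF solve_a_glue md_pair_up_to_sign[OF _ md_pair_S_a_glue]])

lemma S_given_f_glue: "q \<noteq> 0 \<Longrightarrow> {S. md_pair 2 (f_glue p q) S} = up_to_sign (S_f_glue p q)"
  by (rule md_pair_Collect_eqI[OF solve_f_glue md_pair_up_to_sign[OF _ md_pair_f_glue]])

lemma S_given_slash_neg:
  assumes p: "p \<noteq> 0" "p\<^sup>2 \<noteq> 1"
  shows "{S. md_pair 2 (slash p (-1)) S} = up_to_sign (S_a_slash p)"
proof (rule md_pair_Collect_eqI)
  fix S assume "S \<in> carrier_mat 4 4" "ybe 2 (slash p (-1)) (slash p (-1)) S" "ybe 2 (slash p (-1)) S S" "S * S = 1\<^sub>m 4"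
  then show "S \<in> up_to_sign (S_a_slash p)" by (rule solve_slash[OF p]) (auto simp: S_a_slash_def)
next
  fix S assume "S \<in> up_to_sign (S_a_slash p)"
  then show "md_pair 2 (slash p (-1)) S" by (rule md_pair_up_to_sign) (rule md_pair_S_a_slash[OF p(1)])
qed

lemma slash_transpose: "p\<^sup>2 = 1 \<Longrightarrow> transpose_mat (slash p e) = slash p e"
  by (auto simp: entries_mat4 mat4_transpose power2_eq_1_iff)

text \<open>For p^2 = 1 the matrix R is symmetric, so transposing S alone preserves the
  relations.\<close>

lemma S_given_slash_neg_symmetric:
  assumes p: "p\<^sup>2 = 1"
  shows "{S. md_pair 2 (slash p (-1)) S} = up_to_sign (S_a_slash p \<union> transpose_mat ` S_a_slash p)"
proof (rule md_pair_Collect_eqI[OF solve_a_slash[OF p]])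
  fix S assume "S \<in> up_to_sign (S_a_slash p \<union> transpose_mat ` S_a_slash p)"
  then show "md_pair 2 (slash p (-1)) S"
  proof (rule md_pair_up_to_sign)
    have p0: "p \<noteq> 0" using p by auto
    fix S assume "S \<in> S_a_slash p \<union> transpose_mat ` S_a_slash p"
    then consider "S \<in> S_a_slash p" | T where "T \<in> S_a_slash p" "S = transpose_mat T" by blast
    then show "md_pair 2 (slash p (-1)) S"
    proof cases
      case 1
      then show ?thesis by (rule md_pair_S_a_slash[OF p0])
    next
      case 2
      then show ?thesis using md_pair_transpose[OF md_pair_S_a_slash[OF p0]] slash_transpose[OF p] by metis
    qed
  qed
qed

lemma S_given_slash_pos:
  assumes p: "p \<noteq> 0" "p \<noteq> 1"
  shows "{S. md_pair 2 (slash p 1) S} = up_to_sign (S_f_slash p)"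
proof (rule md_pair_Collect_eqI)
  fix S assume S: "S \<in> carrier_mat 4 4" "ybe 2 (slash p 1) (slash p 1) S" "ybe 2 (slash p 1) S S" "S * S = 1\<^sub>m 4"
  show "S \<in> up_to_sign (S_f_slash p)"
  proof (cases "p = -1")
    case True
    from S[unfolded True] show ?thesis unfolding True by (rule solve_f_slash)
  next
    case False
    then have "p\<^sup>2 \<noteq> 1" using p by (simp add: power2_eq_1_iff)
    then show ?thesis by (rule solve_slash[OF p(1) _ S]) (auto simp: S_f_slash_def)
  qed
next
  fix S assume "S \<in> up_to_sign (S_f_slash p)"
  then show "md_pair 2 (slash p 1) S" by (rule md_pair_up_to_sign) (rule md_pair_S_f_slash[OF p(1)])
qed

lemma S_given_flip:
  assumes S: "md_pair 2 flip S"
  shows "\<exists>S'\<in>S_flip. pair_equiv 2 (flip, S) (flip, S')"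
proof -
  have "listed S" using S unfolding md_pair_2 by (intro braiding_listed) (simp only: braiding_def simp_thms)
  then obtain S0 where S0: "S0 \<in> std_braidings" "orbit S0 S" unfolding listed_def by blast
  have eq: "pair_equiv 2 (flip, S) (flip, S0)" by (rule orbit_flip_pair_equiv[OF S0(2)])
  then have "md_pair 2 flip S0" using S pair_equiv_md_pair by blast
  then have y: "ybe 2 flip S0 S0" by (simp add: md_pair_2)
  from S0(1) consider "S0 = 1\<^sub>m 4" | p where "S0 = a_glue p" "p \<noteq> 0" | p q where "S0 = f_glue p q" "q \<noteq> 0"
    | p where "p \<noteq> 0" "S0 = slash p 1 \<or> S0 = slash p (-1)"
    unfolding std_braidings_def by blast
  \<comment> \<open>One entry of the relation for flip, S, S decides each form: it excludes the
    identity and the a-glue forms, and forces p = -q for f-glue. Slash forms all remain.\<close>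
  then have "S0 \<in> S_flip"
  proof cases
    case 1
    have "ybe_at flip S0 S0 0 0 1 0 0 1" by (rule ybe_atD[OF y]) (simp_all add: 1 entries_mat4)
    then show ?thesis unfolding 1 by (simp add: entries_mat4 mat4_one ybe_expand)
  next
    case 2
    have "ybe_at flip S0 S0 1 0 0 1 1 1" by (rule ybe_atD[OF y]) (simp_all add: 2 entries_mat4)
    then show ?thesis unfolding 2 using 2(2) by (simp add: entries_mat4 ybe_expand)
  next
    case 3
    have "ybe_at flip S0 S0 0 1 0 1 1 1" by (rule ybe_atD[OF y]) (simp_all add: 3 entries_mat4)
    then have "q * (p + q) = 0" unfolding 3 by (simp add: entries_mat4 ybe_expand algebra_simps)
    then have "p = - q" using 3(2) by (simp add: add_eq_0_iff2)
    then show ?thesis using 3 by (auto simp: S_flip_def)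
  next
    case 4
    then show ?thesis by (auto simp: S_flip_def)
  qed
  with eq show ?thesis by blast
qed

text \<open>Conjugation by the Hadamard matrix exchanges \<^term>\<open>anti_slash\<close> and \<^term>\<open>slash (-1) 1\<close>.\<close>

abbreviation hadamard :: "complex mat" where "hadamard \<equiv> mat2 1 1 1 (-1)"
abbreviation hadamard_inv :: "complex mat" where "hadamard_inv \<equiv> mat2 (1/2) (1/2) (1/2) (- 1/2)"

lemma hadamard_inverse: "hadamard * hadamard_inv = 1\<^sub>m 2" "hadamard_inv * hadamard = 1\<^sub>m 2"
  by (simp_all add: mat4_algebra)

definition hadamard_conj :: "complex mat \<Rightarrow> complex mat" where
  "hadamard_conj M = kron hadamard hadamard * M * kron hadamard_inv hadamard_inv"

text \<open>Here t stands for 1 / s. Kept as a separate variable, it makes the new parameters affine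
  in s and t, so they can be solved for again.\<close>

lemma hadamard_conj_mat4:
  "hadamard_conj (mat4 1 0 0 0 0 0 s 0 0 t 0 0 0 0 0 1) = anti_slash_S_a (-1) ((t - s) / 4) ((s + t + 2) / 4)"
  "hadamard_conj (mat4 1 0 0 0 0 0 s 0 0 t 0 0 0 0 0 (-1)) = anti_slash_S_b 1 ((s + t) / 4) ((2 - s + t) / 4)"
  "hadamard_conj (mat4 0 0 0 s 0 e 0 0 0 0 e 0 t 0 0 0) = anti_slash_S_c e (- (s + t + 2 * e) / 4) ((t - s) / 4)"
  by (simp_all add: hadamard_conj_def entries_mat4 mat4_algebra field_simps)

text \<open>Conjugation yields the first two families with one fixed sign of the parameter e;
  negating S supplies the other sign.\<close>

lemma anti_slash_S_uminus:
  "- anti_slash_S_a (-1) x z = anti_slash_S_a 1 (- x) (- z)"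
  "- anti_slash_S_b 1 r y = anti_slash_S_b (-1) (- r) (- y)"
  "- anti_slash_S_c e r y = anti_slash_S_c (- e) (- r) (- y)"
  by (simp_all add: entries_mat4 mat4_uminus)

lemma hadamard_conj_slash: "hadamard_conj (slash (-1) 1) = anti_slash"
  by (simp add: hadamard_conj_def entries_mat4 mat4_algebra)

lemma hadamard_conj_uminus:
  assumes "M \<in> carrier_mat 4 4"
  shows "hadamard_conj (- M) = - hadamard_conj M"
proof -
  have "kron hadamard hadamard \<in> carrier_mat 4 4" "kron hadamard_inv hadamard_inv \<in> carrier_mat 4 4"
    by (simp_all add: kron_mat2)
  then show ?thesis using assms unfolding hadamard_conj_def by (simp del: assoc_mult_mat)
qed

lemma anti_slash_S_memI:
  "e\<^sup>2 = 1 \<Longrightarrow> x\<^sup>2 = z\<^sup>2 + e * z \<Longrightarrow> anti_slash_S_a e x z \<in> S_anti_slash"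
  "e\<^sup>2 = 1 \<Longrightarrow> 2 * r\<^sup>2 - 2 * y\<^sup>2 + 2 * e * y - 1 = 0 \<Longrightarrow> anti_slash_S_b e r y \<in> S_anti_slash"
  "e\<^sup>2 = 1 \<Longrightarrow> r\<^sup>2 - y\<^sup>2 + e * r = 0 \<Longrightarrow> anti_slash_S_c e r y \<in> S_anti_slash"
  unfolding S_anti_slash_def by blast+

lemma hadamard_conj_mem:
  assumes "S \<in> S_f_slash (-1)"
  shows "hadamard_conj S \<in> S_anti_slash" "hadamard_conj (- S) \<in> S_anti_slash"
proof -
  consider s where "s \<noteq> 0" "S = slash s 1" | s where "s \<noteq> 0" "S = slash s (-1)"
    | s e where "s \<noteq> 0" "S = anti_slash_gen s e" "e\<^sup>2 = 1"
    using assms by (auto simp: S_f_slash_def)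
  then have "hadamard_conj S \<in> S_anti_slash \<and> - hadamard_conj S \<in> S_anti_slash"
  proof cases
    case 1
    show ?thesis unfolding 1(2) entries_mat4(3) hadamard_conj_mat4 anti_slash_S_uminus
      by (intro conjI anti_slash_S_memI) (use 1 in \<open>simp_all add: power2_eq_square field_simps\<close>)
  next
    case 2
    show ?thesis unfolding 2(2) entries_mat4(3) hadamard_conj_mat4 anti_slash_S_uminus
      by (intro conjI anti_slash_S_memI) (use 2 in \<open>simp_all add: power2_eq_square field_simps\<close>)
  next
    case 3
    have e: "e = 1 \<or> e = -1" using 3(3) by (simp add: power2_eq_1_iff)
    show ?thesis unfolding 3(2) entries_mat4(5) hadamard_conj_mat4 anti_slash_S_uminus
      by (intro conjI anti_slash_S_memI; use e in \<open>elim disjE; use 3(1) in \<open>simp add: power2_eq_square field_simps\<close>\<close>)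
  qed
  moreover have "S \<in> carrier_mat 4 4" using assms by (auto simp: S_f_slash_def entries_carrier)
  ultimately show "hadamard_conj S \<in> S_anti_slash" "hadamard_conj (- S) \<in> S_anti_slash"
    by (simp_all add: hadamard_conj_uminus)
qed

lemma md_pair_hadamard_conj:
  assumes "md_pair 2 (slash (-1) 1) S"
  shows "md_pair 2 anti_slash (hadamard_conj S)" "md_pair 2 anti_slash (- hadamard_conj S)"
proof -
  show "md_pair 2 anti_slash (hadamard_conj S)"
    using md_pair_conj[OF mat2_carrier mat2_carrier hadamard_inverse assms]
    unfolding hadamard_conj_def[symmetric] hadamard_conj_slash .
  then show "md_pair 2 anti_slash (- hadamard_conj S)" by (rule md_pair_sign) simp_all
qed

lemma md_pair_S_anti_slash:
  assumes "S \<in> S_anti_slash"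
  shows "md_pair 2 anti_slash S"
proof -
  have inv: "s \<noteq> 0 \<and> 1 / s = t" if "s * t = 1" for s t :: complex using that by (auto simp: divide_eq_eq mult.commute)
  from assms consider e x z where "e\<^sup>2 = 1" "x\<^sup>2 = z\<^sup>2 + e * z" "S = anti_slash_S_a e x z"
    | e r y where "e\<^sup>2 = 1" "2 * r\<^sup>2 - 2 * y\<^sup>2 + 2 * e * y - 1 = 0" "S = anti_slash_S_b e r y"
    | e r y where "e\<^sup>2 = 1" "r\<^sup>2 - y\<^sup>2 + e * r = 0" "S = anti_slash_S_c e r y"
    unfolding S_anti_slash_def by blast
  then show ?thesis
  proof cases
    case 1
    \<comment> \<open>The inverse of the substitution in \<open>hadamard_conj_mat4\<close>, with e
      inserted so that one formula serves both signs. The constraint on x and z is exactly s * t =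
      1; the other two cases follow the same pattern.\<close>
    define s t where st: "s = -1 - 2 * e * z + 2 * e * x" "t = -1 - 2 * e * z - 2 * e * x"
    have e: "e = 1 \<or> e = -1" using 1(1) by (simp add: power2_eq_1_iff)
    have "s * t = 1" unfolding st using 1(1,2) by Groebner_Basis.algebra
    note st0 = inv[OF this]
    have "md_pair 2 (slash (-1) 1) (slash s 1)" using st0 by (intro md_pair_slash) simp_all
    note m = md_pair_hadamard_conj[OF this, unfolded entries_mat4(3)[of s] st0[THEN conjunct2] hadamard_conj_mat4 anti_slash_S_uminus]
    have "(t - s) / 4 = - e * x" "(s + t + 2) / 4 = - e * z" unfolding st by (simp_all add: field_simps)
    then show ?thesis unfolding 1(3) using m e by auto
  next
    case 2
    define s t where st: "s = 2 * e * r + 1 - 2 * e * y" "t = 2 * e * r - 1 + 2 * e * y"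
    have e: "e = 1 \<or> e = -1" using 2(1) by (simp add: power2_eq_1_iff)
    have "s * t = 1" unfolding st using 2(1,2) by Groebner_Basis.algebra
    note st0 = inv[OF this]
    have "md_pair 2 (slash (-1) 1) (slash s (-1))" using st0 by (intro md_pair_slash) simp_all
    note m = md_pair_hadamard_conj[OF this, unfolded entries_mat4(3)[of s] st0[THEN conjunct2] hadamard_conj_mat4 anti_slash_S_uminus]
    have "(s + t) / 4 = e * r" "(2 - s + t) / 4 = e * y" unfolding st by (simp_all add: field_simps)
    then show ?thesis unfolding 2(3) using m e by auto
  next
    case 3
    define s t where st: "s = - 2 * r - e - 2 * y" "t = - 2 * r - e + 2 * y"
    have "s * t = 1" unfolding st using 3(1,2) by Groebner_Basis.algebra
    note st0 = inv[OF this]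
    have "md_pair 2 (slash (-1) 1) (anti_slash_gen s e)" using st0 3(1) by (intro md_pair_anti_slash_gen) simp_all
    note m = md_pair_hadamard_conj[OF this, unfolded entries_mat4(5)[of s] st0[THEN conjunct2] hadamard_conj_mat4]
    have "- (s + t + 2 * e) / 4 = r" "(t - s) / 4 = y" unfolding st by (simp_all add: field_simps)
    then show ?thesis unfolding 3(3) using m(1) by simp
  qed
qed

text \<open>The case is transported from \<open>slash (-1) 1\<close>. No \<open>up_to_sign\<close>
  appears, since each family is closed under negating S: all its parameters, including e, change
  sign.\<close>

lemma S_given_anti_slash: "{S. md_pair 2 anti_slash S} = S_anti_slash"
proof (intro equalityI subsetI CollectI)
  fix S assume "S \<in> {S. md_pair 2 anti_slash S}"
  then have S: "md_pair 2 anti_slash S" by simp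
  let ?P = "kron hadamard hadamard" and ?Q = "kron hadamard_inv hadamard_inv"
  have "md_pair 2 (?Q * anti_slash * ?P) (?Q * S * ?P)"
    by (rule md_pair_conj[OF mat2_carrier mat2_carrier hadamard_inverse(2,1) S])
  moreover have "?Q * anti_slash * ?P = slash (-1) 1" by (simp add: entries_mat4 mat4_algebra)
  ultimately have "?Q * S * ?P \<in> up_to_sign (S_f_slash (-1))"
    using S_given_slash_pos[of "-1"] by auto
  then have "hadamard_conj (?Q * S * ?P) \<in> S_anti_slash"
    using hadamard_conj_mem unfolding up_to_sign_def by auto
  moreover have "hadamard_conj (?Q * S * ?P) = S"
    unfolding hadamard_conj_def using S
    by (intro conj_conj_inverse[OF mat2_carrier mat2_carrier hadamard_inverse(2,1)]) (simp add: md_pair_2)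
  ultimately show "S \<in> S_anti_slash" by simp
qed (rule md_pair_S_anti_slash)

text \<open>The matrix \<open>antidiag\<close> is the Kronecker square of the exchange of basis
  vectors, so the symmetry is a transposition followed by a local equivalence and preserves the
  relations.\<close>

lemma antidiag_sym_conj: "antidiag_sym M = kron (mat2 0 1 1 0) (mat2 0 1 1 0) * transpose_mat M * kron (mat2 0 1 1 0) (mat2 0 1 1 0)"
  by (simp add: antidiag_sym_def entries_mat4 kron_mat2)

lemma antidiag_sym_mat4:
  "antidiag_sym (mat4 a00 a01 a02 a03 a10 a11 a12 a13 a20 a21 a22 a23 a30 a31 a32 a33) =
   mat4 a33 a23 a13 a03 a32 a22 a12 a02 a31 a21 a11 a01 a30 a20 a10 a00"
  by (simp add: antidiag_sym_def entries_mat4 mat4_algebra)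

lemma antidiag_sym_involution: "M \<in> carrier_mat 4 4 \<Longrightarrow> antidiag_sym (antidiag_sym M) = M"
  by (erule mat4_cases) (simp add: antidiag_sym_mat4)

lemma md_pair_antidiag_sym: "md_pair 2 R S \<Longrightarrow> md_pair 2 (antidiag_sym R) (antidiag_sym S)"
  unfolding antidiag_sym_conj
  by (rule md_pair_conj[OF mat2_carrier mat2_carrier _ _ md_pair_transpose]) (simp_all add: mat4_algebra)

lemma antidiag_sym_f_glue: "antidiag_sym (f_glue p q) = f_glue q p"
  by (simp add: entries_mat4 antidiag_sym_mat4)

text \<open>The symmetry exchanges the two glue parameters, so the case with second parameter 0 is
  the image of one already solved.\<close>

lemma S_given_f_glue_zero:
  assumes "p \<noteq> 0"
  shows "{S. md_pair 2 (f_glue p 0) S} = antidiag_sym ` up_to_sign (S_f_glue 0 p)"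
proof -
  have "{S. md_pair 2 (f_glue p 0) S} = antidiag_sym ` {S. md_pair 2 (f_glue 0 p) S}"
  proof (intro equalityI subsetI)
    fix S assume "S \<in> {S. md_pair 2 (f_glue p 0) S}"
    then have S: "md_pair 2 (f_glue p 0) S" by simp
    then have "S = antidiag_sym (antidiag_sym S)" by (simp add: antidiag_sym_involution md_pair_2)
    moreover have "md_pair 2 (f_glue 0 p) (antidiag_sym S)"
      using md_pair_antidiag_sym[OF S] unfolding antidiag_sym_f_glue .
    ultimately show "S \<in> antidiag_sym ` {S. md_pair 2 (f_glue 0 p) S}" by blast
  next
    fix S assume "S \<in> antidiag_sym ` {S. md_pair 2 (f_glue 0 p) S}"
    then obtain T where "md_pair 2 (f_glue 0 p) T" "S = antidiag_sym T" by blast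
    then have "md_pair 2 (f_glue p 0) S" using md_pair_antidiag_sym[of "f_glue 0 p" T] unfolding antidiag_sym_f_glue by blast
    then show "S \<in> {S. md_pair 2 (f_glue p 0) S}" by simp
  qed
  then show ?thesis unfolding S_given_f_glue[OF assms] .
qed

section \<open>Assembling the classification\<close>

lemma MD_listI:
  "p \<noteq> 0 \<Longrightarrow> S \<in> S_a_slash p \<Longrightarrow> (slash p (-1), S) \<in> MD_list"
  "p \<noteq> 0 \<Longrightarrow> p \<noteq> 1 \<Longrightarrow> S \<in> S_f_slash p \<Longrightarrow> (slash p 1, S) \<in> MD_list"
  "S \<in> S_flip \<Longrightarrow> (flip, S) \<in> MD_list"
  "S \<in> S_identity \<Longrightarrow> (1\<^sub>m 4, S) \<in> MD_list"
  "p \<noteq> 0 \<Longrightarrow> S \<in> S_a_glue \<Longrightarrow> (a_glue p, S) \<in> MD_list"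
  "q \<noteq> 0 \<Longrightarrow> S \<in> S_f_glue p q \<Longrightarrow> (f_glue p q, S) \<in> MD_list"
  unfolding MD_list_def by blast+

lemma MD_list_md_pair:
  assumes "(R, S) \<in> MD_list"
  shows "md_pair 2 R S"
proof -
  from assms consider "R = 1\<^sub>m 4" "S \<in> S_identity" | p where "R = a_glue p" "S \<in> S_a_glue"
    | p q where "R = f_glue p q" "S \<in> S_f_glue p q" | p where "R = slash p (-1)" "p \<noteq> 0" "S \<in> S_a_slash p"
    | p where "R = slash p 1" "p \<noteq> 0" "S \<in> S_f_slash p" | "R = anti_slash" "S \<in> S_anti_slash"
    | "R = flip" "S \<in> S_flip"
    unfolding MD_list_def by blast
  then show ?thesis
    by cases (simp_all only: md_pair_S_identity md_pair_S_a_glue md_pair_f_glue md_pair_S_a_slash md_pair_S_f_slash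
      md_pair_S_anti_slash md_pair_S_flip not_False_eq_True)
qed

lemma up_to_sign_listed:
  assumes "S \<in> up_to_sign X" and X: "\<And>S. S \<in> X \<Longrightarrow> \<exists>x\<in>MD_list. pair_equiv 2 (R, S) x"
  shows "\<exists>x\<in>MD_list. pair_equiv 2 (R, S) x"
proof -
  obtain T where T: "T \<in> X" "S = T \<or> S = - T" using assms(1) unfolding up_to_sign_def by blast
  from T(2) have "T = S \<or> T = - S" by auto
  then have "pair_equiv 2 (R, S) (R, T)" by (intro pair_equiv_sign) simp_all
  with X[OF T(1)] show ?thesis using pair_equiv_trans by blast
qed

lemma mem_listed: "(R, S) \<in> MD_list \<Longrightarrow> \<exists>x\<in>MD_list. pair_equiv 2 (R, S) x"
  using pair_equiv_refl by blast

lemma std_braidings_listed: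
  assumes R: "R \<in> std_braidings" and RS: "md_pair 2 R S"
  shows "\<exists>x\<in>MD_list. pair_equiv 2 (R, S) x"
proof -
  from R consider "R = 1\<^sub>m 4" | p where "R = a_glue p" "p \<noteq> 0" | p q where "R = f_glue p q" "q \<noteq> 0"
    | p where "p \<noteq> 0" "p\<^sup>2 \<noteq> 1" "R = slash p (-1)" | p where "p\<^sup>2 = 1" "R = slash p (-1)"
    | p where "p \<noteq> 0" "p \<noteq> 1" "R = slash p 1" | "R = slash 1 1"
    unfolding std_braidings_def by blast
  then show ?thesis
  proof cases
    case 1
    then have "S \<in> S_identity" using RS S_given_one by blast
    then show ?thesis unfolding 1 by (intro mem_listed MD_listI)
  next
    case 2
    then have "S \<in> up_to_sign S_a_glue" using RS S_given_a_glue by blast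
    then show ?thesis unfolding 2(1) by (rule up_to_sign_listed) (intro mem_listed MD_listI 2(2))
  next
    case 3
    then have "S \<in> up_to_sign (S_f_glue p q)" using RS S_given_f_glue by blast
    then show ?thesis unfolding 3(1) by (rule up_to_sign_listed) (intro mem_listed MD_listI 3(2))
  next
    case 4
    then have "S \<in> up_to_sign (S_a_slash p)" using RS S_given_slash_neg by blast
    then show ?thesis unfolding 4(3) by (rule up_to_sign_listed) (intro mem_listed MD_listI 4(1))
  next
    case 5
    then have p: "p \<noteq> 0" by auto
    have "S \<in> up_to_sign (S_a_slash p \<union> transpose_mat ` S_a_slash p)"
      using 5 RS S_given_slash_neg_symmetric by blast
    then show ?thesis
    proof (rule up_to_sign_listed)
      fix S assume "S \<in> S_a_slash p \<union> transpose_mat ` S_a_slash p"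
      then consider "S \<in> S_a_slash p" | T where "T \<in> S_a_slash p" "S = transpose_mat T" by blast
      then show "\<exists>x\<in>MD_list. pair_equiv 2 (R, S) x"
      proof cases
        case 1
        then show ?thesis unfolding 5(2) by (intro mem_listed MD_listI p)
      next
        case 2
        have "pair_equiv 2 (R, S) (R, T)"
          using pair_equiv_transpose[of R S] unfolding 5(2) 2(2) transpose_transpose slash_transpose[OF 5(1)] .
        moreover have "(R, T) \<in> MD_list" unfolding 5(2) using 2(1) by (intro MD_listI p)
        ultimately show ?thesis by blast
      qed
    qed
  next
    case 6
    then have "S \<in> up_to_sign (S_f_slash p)" using RS S_given_slash_pos by blast
    then show ?thesis unfolding 6(3) by (rule up_to_sign_listed) (intro mem_listed MD_listI 6(1,2))
  next
    case 7
    then have "R = flip" by (simp add: flip_eq(1))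
    with RS S_given_flip[of S] MD_listI(3) show ?thesis by blast
  qed
qed

lemma md_pair_classification:
  "md_pair 2 R S \<longleftrightarrow> (\<exists>x\<in>MD_list. pair_equiv 2 (R, S) x)"
proof
  assume RS: "md_pair 2 R S"
  then have "listed R" unfolding md_pair_2 by (intro braiding_listed) (simp only: braiding_def simp_thms)
  then obtain R0 where R0: "R0 \<in> std_braidings" "orbit R0 R" unfolding listed_def by blast
  have "S \<in> carrier_mat 4 4" using RS by (simp add: md_pair_2)
  from orbit_pair_equiv[OF R0(2) this] obtain S0 where eq: "pair_equiv 2 (R, S) (R0, S0)" by blast
  then have "md_pair 2 R0 S0" using RS pair_equiv_md_pair by blast
  from std_braidings_listed[OF R0(1) this] show "\<exists>x\<in>MD_list. pair_equiv 2 (R, S) x"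
    using pair_equiv_trans[OF eq] by blast
next
  assume "\<exists>x\<in>MD_list. pair_equiv 2 (R, S) x"
  then obtain R' S' where "(R', S') \<in> MD_list" "pair_equiv 2 (R, S) (R', S')" by (metis surj_pair)
  then show "md_pair 2 R S" using MD_list_md_pair pair_equiv_md_pair by blast
qed

theorem theorem4p20:
  shows
    "(\<forall>Fo Fm Go Gm. MD_functor Fo Fm \<and> MD_functor Go Gm \<and> Fo 1 = 2 \<and> Go 1 = 2 \<and>
        Fm 2 2 md_r = Gm 2 2 md_r \<and> Fm 2 2 md_s = Gm 2 2 md_s \<longrightarrow>
        Fo = Go \<and> (\<forall>m n. \<forall>a\<in>Hom MD m n. Fm m n a = Gm m n a)) \<and>
     (\<forall>R S. (R, S) \<in> MD_pairs 2 \<longleftrightarrow> (\<exists>(R', S')\<in>MD_list. pair_equiv 2 (R, S) (R', S'))) \<and>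
     (\<forall>S. (1\<^sub>m 4, S) \<in> MD_pairs 2 \<longrightarrow> kron S (1\<^sub>m 2) = kron (1\<^sub>m 2) S) \<and>
     {S. (1\<^sub>m 4, S) \<in> MD_pairs 2} = S_identity \<and>
     (\<forall>p. p \<noteq> 0 \<longrightarrow> {S. (a_glue p, S) \<in> MD_pairs 2} = up_to_sign S_a_glue) \<and>
     (\<forall>p q. q \<noteq> 0 \<longrightarrow> {S. (f_glue p q, S) \<in> MD_pairs 2} = up_to_sign (S_f_glue p q)) \<and>
     (\<forall>p. p \<noteq> 0 \<longrightarrow> f_glue p 0 = antidiag_sym (f_glue 0 p) \<and>
        {S. (f_glue p 0, S) \<in> MD_pairs 2} = antidiag_sym ` up_to_sign (S_f_glue 0 p)) \<and>
     (\<forall>p. p \<noteq> 0 \<and> p\<^sup>2 \<noteq> 1 \<longrightarrow>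
        {S. (slash p (-1), S) \<in> MD_pairs 2} = up_to_sign (S_a_slash p)) \<and>
     (\<forall>p. p\<^sup>2 = 1 \<longrightarrow>
        {S. (slash p (-1), S) \<in> MD_pairs 2} =
          up_to_sign (S_a_slash p \<union> transpose_mat ` S_a_slash p)) \<and>
     (\<forall>p. p \<noteq> 0 \<and> p \<noteq> 1 \<longrightarrow>
        {S. (slash p 1, S) \<in> MD_pairs 2} = up_to_sign (S_f_slash p)) \<and>
     {S. (anti_slash, S) \<in> MD_pairs 2} = S_anti_slash \<and>
     {S. (flip, S) \<in> MD_pairs 2} = {S. \<exists>S'\<in>S_flip. pair_equiv 2 (flip, S) (flip, S')}"
proof -
  \<comment> \<open>The answer for the flip is stated up to equivalence, since with S every local
    conjugate of S is again a solution.\<close>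
  have flip: "{S. md_pair 2 flip S} = {S. \<exists>S'\<in>S_flip. pair_equiv 2 (flip, S) (flip, S')}"
    using S_given_flip pair_equiv_md_pair md_pair_S_flip by blast
  have one: "kron S (1\<^sub>m 2) = kron (1\<^sub>m 2) S" if "md_pair 2 (1\<^sub>m 4) S" for S
  proof -
    have "S \<in> {S. md_pair 2 (1\<^sub>m 4) S}" using that by simp
    then have "S = 1\<^sub>m 4 \<or> S = - 1\<^sub>m 4" unfolding S_given_one S_identity_def by simp
    then show ?thesis by (elim disjE) (simp_all add: kron_uminus)
  qed
  show ?thesis
    unfolding MD_pairs_iff
  proof (intro conjI allI impI)
    fix Fo Fm Go Gm
    assume F: "MD_functor Fo Fm \<and> MD_functor Go Gm \<and> Fo 1 = 2 \<and> Go 1 = 2 \<and>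
        Fm 2 2 md_r = Gm 2 2 md_r \<and> Fm 2 2 md_s = Gm 2 2 md_s"
    have "Fo = Go \<and> (\<forall>m n. \<forall>a\<in>Hom MD m n. Fm m n a = Gm m n a)"
      using F by (intro functor_unique) simp_all
    then show "Fo = Go" "\<And>m n. \<forall>a\<in>Hom MD m n. Fm m n a = Gm m n a" by blast+
  next
    fix R S
    show "md_pair 2 R S \<longleftrightarrow> (\<exists>(R', S')\<in>MD_list. pair_equiv 2 (R, S) (R', S'))"
      unfolding md_pair_classification by (simp add: split_def)
  qed (simp_all only: one S_given_one S_given_a_glue S_given_f_glue S_given_f_glue_zero antidiag_sym_f_glue
      S_given_slash_neg S_given_slash_neg_symmetric S_given_slash_pos S_given_anti_slash flip not_False_eq_True)
qed

end
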